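(* Let $n\ge 3$ and let $U=B(0,1)$ be the unit ball in $\mathbb{R}^n$. Let $D_1$ and $D_2$ be non-overlapping (i.e. disjoint) domains lying in $U$, let $a_k\in D_k$, and let $\Gamma_k$ be closed sets with $(\partial D_k)\cap U\subset\Gamma_k\subset\partial D_k$ and $(D_k,\Gamma_k)$ admissible, $k=1,2$. Then $$-\lambda_n\, r(D_1,a_1,\Gamma_1)^{2-n}-\lambda_n\, r(D_2,a_2,\Gamma_2)^{2-n}\ \le\ M\left(U,\emptyset,\{a_1,a_2\},\{1,-1\}\right).$$
   Context: Notation: $\omega_{n-1}=2\pi^{n/2}/\Gamma(n/2)$ (here $\Gamma(\cdot)$ is the Gamma function) is the area of the unit sphere in $\mathbb{R}^n$, and $\lambda_n=((n-2)\omega_{n-1})^{-1}$. $\partial/\partial n$ denotes the inward normal derivative on the boundary. Robin function and Robin radius. For a bounded domain $D\subset\mathbb{R}^n$ and a closed set $\Gamma\subset\partial D$, the pair $(D,\Gamma)$ is called admissible if (for $z_0\in D$) there exists the Robin function $g_\Gamma(z,z_0,D)$, which is harmonic in $z\in D\setminus\{z_0\}$, continuous in $\overline D\setminus\{z_0\}$, satisfies $\partial g_\Gamma/\partial n=0$ on $(\partial D)\setminus\Gamma$ and $g_\Gamma=0$ on $\Gamma$, and near $z_0$ has the expansion $$g_\Gamma(z,z_0,D)=\lambda_n\left(|z-z_0|^{2-n}-r(D,z_0,\Gamma)^{2-n}+o(1)\right),\quad z\to z_0 .$$ The constant $r(D,z_0,\Gamma)$ is called the Robin radius. In the case $\Gamma=\emptyset$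 the boundary condition is replaced by $\partial g_\Gamma/\partial n=1/\mu_{n-1}(\partial D)$ on $\partial D$, where $\mu_{n-1}(\partial D)$ is the area of $\partial D$; in this case $g_\Gamma(\cdot,z_0,D)$ is defined only up to an additive constant. One sets $g_\Gamma(z_0,z_0,D):=-\lambda_n r(D,z_0,\Gamma)^{2-n}$, i.e. the constant term of the expansion at $z_0$. Potential function and reduced modulus. For points $Z=\{z_k\}_{k=1}^m$ of $D$ and real numbers $\Delta=\{\delta_k\}_{k=1}^m$ (with $\sum_k\delta_k=0$ required if $\Gamma=\emptyset$), the potential function is $u(z)=\sum_{k=1}^m\delta_k g_\Gamma(z,z_k,D)$. Near $z_k$ it satisfies $u(z)=\delta_k\lambda_n|z-z_k|^{2-n}+a_k+o(1)$, where $a_k=\sum_{l=1}^m\delta_l g_\Gamma(z_l,z_k,D)$. (In this paragraph $a_k$ denotes these constants, not the points of the claim.) The reduced modulus is $M(D,\Gamma,Z,\Delta)=\sum_{k=1}^m\delta_k a_k=\sum_{k=1}^m\sum_{l=1}^m\delta_k\delta_l g_\Gamma(z_l,z_k,D)$. *)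

theory Defs
  imports "HOL-Analysis.Analysis"
begin

text \<open>
  Euclidean space of dimension \<open>n\<close> is a type of class \<^class>\<open>euclidean_space\<close> with \<open>DIM('a) = n\<close>.
  \<open>sphere_area n\<close> is \<open>\<omega>\<close> with index \<open>n - 1\<close>, the area of the unit sphere of \<open>n\<close>-dimensional space.
\<close>

definition sphere_area :: "nat \<Rightarrow> real" where
  "sphere_area n = 2 * pi powr (real n / 2) / Gamma (real n / 2)"

definition lam :: "nat \<Rightarrow> real" where
  "lam n = 1 / ((real n - 2) * sphere_area n)"

text \<open>
  The area of a boundary is taken as its \<open>(n - 1)\<close>-dimensional Minkowski content, which is the usual
  surface area for compact smooth hypersurfaces; the lemma \<open>surface_area_unit_sphere\<close> below
  checks the value on the unit sphere.
\<close>

definition surface_area :: "'a::euclidean_space set \<Rightarrow> real" where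
  "surface_area A = Lim (at_right 0) (\<lambda>\<epsilon>. measure lebesgue {x. infdist x A \<le> \<epsilon>} / (2 * \<epsilon>))"

text \<open>Below, \<open>G\<close> is the gradient and \<open>H\<close> the (continuous) Hessian of \<open>f\<close>.\<close>

definition harmonic_on :: "('a::euclidean_space \<Rightarrow> real) \<Rightarrow> 'a set \<Rightarrow> bool"
    (infixl "harmonic'_on" 50) where
  "f harmonic_on S \<longleftrightarrow> open S \<and>
     (\<exists>G H. (\<forall>x\<in>S. GDERIV f x :> G x) \<and>
            (\<forall>x\<in>S. (G has_derivative H x) (at x)) \<and>
            (\<forall>v. continuous_on S (\<lambda>x. H x v)) \<and>
            (\<forall>x\<in>S. (\<Sum>b\<in>Basis. H x b \<bullet> b) = 0))"

text \<open>
  A normal at \<open>z\<close> presupposes that the boundary is a \<open>C\<^sup>1\<close> hypersurface near \<open>z\<close> with the domain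
  on one side; \<open>\<phi>\<close> is a local defining function with gradient \<open>G\<close>.
\<close>

definition inward_unit_normal :: "'a::euclidean_space set \<Rightarrow> 'a \<Rightarrow> 'a \<Rightarrow> bool" where
  "inward_unit_normal D z \<nu> \<longleftrightarrow>
     (\<exists>V \<phi> G. open V \<and> z \<in> V \<and>
        (\<forall>x\<in>V. GDERIV \<phi> x :> G x) \<and> continuous_on V G \<and>
        D \<inter> V = {x \<in> V. \<phi> x > 0} \<and> \<phi> z = 0 \<and> G z \<noteq> 0 \<and> \<nu> = G z /\<^sub>R norm (G z))"

definition has_inward_normal_deriv ::
    "('a::euclidean_space \<Rightarrow> real) \<Rightarrow> 'a set \<Rightarrow> 'a \<Rightarrow> real \<Rightarrow> bool" where
  "has_inward_normal_deriv g D z d \<longleftrightarrow>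
     (\<exists>\<nu>. inward_unit_normal D z \<nu> \<and>
          ((\<lambda>t. g (z + t *\<^sub>R \<nu>)) has_real_derivative d) (at_right 0))"

text \<open>
  The asymptotic expansion of a Robin function determines only the number written \<open>r\<close> to the power
  \<open>2 - n\<close>, and for admissible pairs this number may be zero or negative: it tends to minus infinity when the
  pole approaches a boundary point off \<open>\<Gamma>\<close> (with \<open>\<Gamma>\<close> nonempty), by reflection there.
  We therefore let \<open>r\<close> be a real number of either sign and read the power as the signed power below.
  It is the ordinary power for \<open>r > 0\<close>, and, for odd \<open>n\<close>, the ordinary integer power for every \<open>r \<noteq> 0\<close>.
  The value \<open>r = 0\<close> encodes an infinite Robin radius, whose power \<open>2 - n\<close> is \<open>0\<close>.
  For a nonzero exponent every real number is the signed power of exactly one \<open>r\<close>.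
\<close>

definition spowr :: "real \<Rightarrow> real \<Rightarrow> real" (infixr "spowr" 80) where
  "r spowr s = sgn r * (\<bar>r\<bar> powr s)"

lemma spowr_pos: "r > 0 \<Longrightarrow> r spowr s = r powr s"
  by (simp add: spowr_def)

lemma spowr_ex1:
  assumes "s \<noteq> 0"
  shows "\<exists>!r. r spowr s = y"
proof
  show "(y spowr (1 / s)) spowr s = y"
    using assms by (auto simp: spowr_def abs_mult sgn_mult powr_powr abs_sgn sgn_if)
next
  fix r assume "r spowr s = y"
  then show "r = y spowr (1 / s)"
    using assms by (auto simp: spowr_def abs_mult sgn_mult powr_powr sgn_if split: if_splits)
qed

text \<open>
  \<open>g\<close> is a Robin function of \<open>(D, \<Gamma>)\<close> with pole \<open>z0\<close> and Robin radius \<open>r\<close>.  The value of \<open>g\<close> at the pole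
  is, by convention, the constant term of the expansion there.  For \<open>\<Gamma> = {}\<close> neither \<open>g\<close> nor \<open>r\<close>
  is unique: a constant may be added to \<open>g\<close>.
\<close>

definition is_robin_function ::
    "'a::euclidean_space set \<Rightarrow> 'a set \<Rightarrow> 'a \<Rightarrow> real \<Rightarrow> ('a \<Rightarrow> real) \<Rightarrow> bool" where
  "is_robin_function D \<Gamma> z0 r g \<longleftrightarrow>
     g harmonic_on (D - {z0}) \<and>
     continuous_on (closure D - {z0}) g \<and>
     (\<forall>z \<in> frontier D - \<Gamma>.
        has_inward_normal_deriv g D z (if \<Gamma> = {} then 1 / surface_area (frontier D) else 0)) \<and>
     (\<forall>z \<in> \<Gamma>. g z = 0) \<and>
     ((\<lambda>z. g z / lam DIM('a) - (norm (z - z0) powr (2 - real DIM('a)) - r spowr (2 - real DIM('a))))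
        \<longlongrightarrow> 0) (at z0) \<and>
     g z0 = - lam DIM('a) * r spowr (2 - real DIM('a))"

definition admissible :: "'a::euclidean_space set \<Rightarrow> 'a set \<Rightarrow> bool" where
  "admissible D \<Gamma> \<longleftrightarrow> (\<forall>z0\<in>D. \<exists>r g. is_robin_function D \<Gamma> z0 r g)"

definition robin_radius :: "'a::euclidean_space set \<Rightarrow> 'a \<Rightarrow> 'a set \<Rightarrow> real" where
  "robin_radius D z0 \<Gamma> = (THE r. \<exists>g. is_robin_function D \<Gamma> z0 r g)"

text \<open>\<open>robin_function \<Gamma> z z0 D\<close> follows the argument order of the usual notation \<open>g\<^sub>\<Gamma>(z, z0, D)\<close>.\<close>

definition robin_function :: "'a::euclidean_space set \<Rightarrow> 'a \<Rightarrow> 'a \<Rightarrow> 'a set \<Rightarrow> real" where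
  "robin_function \<Gamma> z z0 D = (SOME g. \<exists>r. is_robin_function D \<Gamma> z0 r g) z"

text \<open>
  For \<open>\<Gamma> = {}\<close> this is meant for \<open>sum_list \<Delta> = 0\<close>; the additive constants left open in the Robin
  functions then cancel: shifting the one with pole \<open>Z ! k\<close> by \<open>c\<close> adds \<open>c * \<Delta> ! k * sum_list \<Delta>\<close>.
\<close>

definition reduced_modulus ::
    "'a::euclidean_space set \<Rightarrow> 'a set \<Rightarrow> 'a list \<Rightarrow> real list \<Rightarrow> real" where
  "reduced_modulus D \<Gamma> Z \<Delta> =
     (\<Sum>k<length Z. \<Sum>l<length Z. \<Delta> ! k * \<Delta> ! l * robin_function \<Gamma> (Z ! l) (Z ! k) D)"

lemma infdist_unit_sphere: "infdist (x::'a::euclidean_space) (sphere 0 1) = \<bar>norm x - 1\<bar>"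
proof -
  obtain y :: 'a where y: "norm y = 1" "dist x y = \<bar>norm x - 1\<bar>"
  proof (cases "x = 0")
    case True
    obtain b :: 'a where "b \<in> Basis" using nonempty_Basis by blast
    then show ?thesis using True by (intro that[of b]) auto
  next
    case False
    have "x - x /\<^sub>R norm x = (norm x - 1) *\<^sub>R (x /\<^sub>R norm x)"
      using False by (simp add: algebra_simps)
    then have "norm (x - x /\<^sub>R norm x) = \<bar>norm x - 1\<bar> * norm (x /\<^sub>R norm x)"
      by (simp only: norm_scaleR)
    then have "norm (x - x /\<^sub>R norm x) = \<bar>norm x - 1\<bar>" using False by simp
    then show ?thesis using False by (intro that[of "x /\<^sub>R norm x"]) (auto simp: dist_norm)
  qed
  show ?thesis
  proof (rule antisym)
    show "infdist x (sphere 0 1) \<le> \<bar>norm x - 1\<bar>"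
      using infdist_le[of y "sphere 0 1" x] y by auto
    show "\<bar>norm x - 1\<bar> \<le> infdist x (sphere 0 1)"
    proof -
      have "\<bar>norm x - 1\<bar> \<le> dist x a" if "norm a = 1" for a :: 'a
        using that norm_triangle_ineq3[of x a] by (simp add: dist_norm)
      moreover have "sphere (0::'a) 1 \<noteq> {}" using y by auto
      ultimately show ?thesis
        unfolding infdist_def by (auto intro!: cINF_greatest)
    qed
  qed
qed

lemma surface_area_unit_sphere:
  "surface_area (sphere (0::'a::euclidean_space) 1) = sphere_area DIM('a)"
proof -
  let ?n = "DIM('a)" and ?V = "unit_ball_vol (real DIM('a))"
  let ?m = "\<lambda>\<epsilon>. measure lebesgue {x::'a. infdist x (sphere 0 1) \<le> \<epsilon>} / (2 * \<epsilon>)"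
  let ?q = "\<lambda>\<epsilon>. ?V * (((1 + \<epsilon>) ^ ?n - (1 - \<epsilon>) ^ ?n) / (2 * \<epsilon>))"
  have eq: "?m \<epsilon> = ?q \<epsilon>" if "0 < \<epsilon>" "\<epsilon> < 1" for \<epsilon>
  proof -
    have "{x::'a. infdist x (sphere 0 1) \<le> \<epsilon>} = cball 0 (1 + \<epsilon>) - ball 0 (1 - \<epsilon>)"
      by (auto simp: infdist_unit_sphere)
    then have "measure lebesgue {x::'a. infdist x (sphere 0 1) \<le> \<epsilon>} =
        measure lebesgue (cball (0::'a) (1 + \<epsilon>) - ball 0 (1 - \<epsilon>))"
      by simp
    also have "\<dots> = ?V * ((1 + \<epsilon>) ^ ?n - (1 - \<epsilon>) ^ ?n)"
    proof -
      have "measure lebesgue (cball (0::'a) (1 + \<epsilon>) - ball 0 (1 - \<epsilon>)) =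
        measure lebesgue (cball (0::'a) (1 + \<epsilon>)) - measure lebesgue (ball (0::'a) (1 - \<epsilon>))"
      using that by (intro measurable_measure_Diff) auto
      then show ?thesis
        using that by (simp add: content_cball content_ball algebra_simps)
    qed
    finally show ?thesis by simp
  qed
  have "((\<lambda>\<epsilon>. (1 + \<epsilon>) ^ ?n - (1 - \<epsilon>) ^ ?n) has_real_derivative 2 * real ?n) (at 0)"
    by (auto intro!: derivative_eq_intros)
  then have "((\<lambda>\<epsilon>::real. ((1 + \<epsilon>) ^ ?n - (1 - \<epsilon>) ^ ?n) / \<epsilon>) \<longlongrightarrow> 2 * real ?n) (at 0)"
    by (simp add: has_field_derivative_iff)
  then have "((\<lambda>\<epsilon>::real. ?V * (((1 + \<epsilon>) ^ ?n - (1 - \<epsilon>) ^ ?n) / \<epsilon> / 2)) \<longlongrightarrow> ?V * (2 * real ?n / 2)) (at_right 0)"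
    by (intro tendsto_intros) (auto elim: tendsto_within_subset)
  then have "(?q \<longlongrightarrow> ?V * real ?n) (at_right 0)"
    by (simp add: mult.commute)
  moreover have "\<forall>\<^sub>F \<epsilon> in at_right 0. ?q \<epsilon> = ?m \<epsilon>"
    using eq by (intro eventually_at_rightI[of 0 1]) auto
  ultimately have "(?m \<longlongrightarrow> ?V * real ?n) (at_right 0)"
    by (rule Lim_transform_eventually)
  then have "surface_area (sphere (0::'a) 1) = ?V * real ?n"
    unfolding surface_area_def by (intro tendsto_Lim) auto
  also have "\<dots> = sphere_area ?n"
  proof -
    have pos: "real ?n / 2 > 0" by simp
    then have "real ?n / 2 \<notin> \<int>\<^sub>\<le>\<^sub>0" by (auto elim: nonpos_Ints_cases)
    then have Suc: "Gamma (real ?n / 2 + 1) = real ?n / 2 * Gamma (real ?n / 2)"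
      by (rule Gamma_plus1)
    show ?thesis
      unfolding unit_ball_vol_def sphere_area_def Suc by simp
  qed
  finally show ?thesis .
qed

end

theory Submission
  imports Defs
begin

text \<open>
  Write \<open>N\<close> for the Neumann function of the ball and \<open>g\<^sub>1\<close>, \<open>g\<^sub>2\<close> for the Robin functions of the two domains,
  all divided by \<open>lam n\<close>.  On \<open>D\<^sub>1\<close> the function \<open>w\<^sub>1 = N a\<^sub>1 - N a\<^sub>2 - g\<^sub>1\<close> extends harmonically over \<open>a\<^sub>1\<close> and
  has vanishing normal derivative off \<open>\<Gamma>\<^sub>1\<close>; with \<open>w\<^sub>2\<close> defined symmetrically, the claim is \<open>w\<^sub>1 a\<^sub>1 + w\<^sub>2 a\<^sub>2 \<ge> 0\<close>.
  If \<open>m\<^sub>k\<close> is the sweeping of the unit mass at \<open>a\<^sub>k\<close> onto \<open>\<Gamma>\<^sub>k\<close>, then \<open>w\<^sub>1 a\<^sub>1 + w\<^sub>2 a\<^sub>2\<close> is the \<open>N\<close>-energy of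
  \<open>m\<^sub>1 - m\<^sub>2\<close>, a measure of total mass zero, hence nonnegative.

  Since the domains are arbitrary, \<open>\<Gamma>\<^sub>k\<close> is replaced by a level set of \<open>g\<^sub>k\<close>, \<open>N\<close> by a bounded positive definite
  kernel which is superharmonic in each variable, and the swept measure by a finitely supported one; the latter
  exists by a minimax argument, whose hypothesis is the minimum principle for superharmonic functions with
  pointwise Neumann conditions.  The same sweeping, applied to the whole ball, reduces positive definiteness of
  the kernel to the sphere, where it is explicit.
\<close>

section \<open>Local supersolutions and the minimum principle\<close>

text \<open>Nothing is known about the boundary near \<open>\<Gamma>\<^sub>k\<close>, and off it the
  Neumann condition is a one-sided derivative at single points; neither Green's formula nor harmonic
  measure can be used. All analytic input therefore passes through the minimum principle, which
  rests on the second-derivative test and on the sign of a one-sided derivative. There the flux is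
  an obstacle: a Neumann function has inward derivative \<open>n - 2 > 0\<close> on the sphere, the
  wrong sign for a supersolution. Every function to be swept is balanced by the Neumann function
  whose pole lies in the other domain, where it is regular on the set considered. In the energy, the
  two diagonal terms need an upper bound only, and superharmonicity of the kernel supplies it. The
  cross terms need a lower bound, for which the kernel has to be almost harmonic. This is a second
  reason for level sets: the level set of one domain is compact and disjoint from the superlevel set
  of the other, so the regularised kernel with pole on the former tends uniformly to a harmonic
  function on the latter.\<close>

definition has_lap :: "('a::euclidean_space \<Rightarrow> real) \<Rightarrow> 'a \<Rightarrow> real \<Rightarrow> bool" where
  "has_lap f x L \<longleftrightarrow> (\<exists>G H. (\<forall>\<^sub>F y in nhds x. GDERIV f y :> G y) \<and> (G has_derivative H) (at x) \<and>
     L = (\<Sum>b\<in>Basis. H b \<bullet> b))"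

text \<open>On the unit sphere \<open>- z\<close> is the inner unit normal. No domain occurs here,
  so that derivatives of Robin functions of subdomains and of kernels on the whole ball can be
  added.\<close>

definition inward_deriv :: "('a::euclidean_space \<Rightarrow> real) \<Rightarrow> 'a \<Rightarrow> real \<Rightarrow> bool" where
  "inward_deriv f z d \<longleftrightarrow> ((\<lambda>t. f (z - t *\<^sub>R z)) has_real_derivative d) (at_right 0)"

section \<open>Calculus of pointwise Laplacians and inward derivatives\<close>

lemma has_lap_add:
  assumes "has_lap f x L" "has_lap g x M"
  shows "has_lap (\<lambda>y. f y + g y) x (L + M)"
proof -
  obtain G H G' H' where *: "\<forall>\<^sub>F y in nhds x. GDERIV f y :> G y" "(G has_derivative H) (at x)"
     "L = (\<Sum>b\<in>Basis. H b \<bullet> b)"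
     "\<forall>\<^sub>F y in nhds x. GDERIV g y :> G' y" "(G' has_derivative H') (at x)"
     "M = (\<Sum>b\<in>Basis. H' b \<bullet> b)"
    using assms unfolding has_lap_def by blast
  have "\<forall>\<^sub>F y in nhds x. GDERIV (\<lambda>y. f y + g y) y :> G y + G' y"
    using *(1,4) by eventually_elim (rule GDERIV_add)
  moreover have "((\<lambda>y. G y + G' y) has_derivative (\<lambda>v. H v + H' v)) (at x)"
    using *(2,5) by (rule has_derivative_add)
  ultimately show ?thesis
    unfolding has_lap_def using *(3,6)
    by (intro exI[of _ "\<lambda>y. G y + G' y"] exI[of _ "\<lambda>v. H v + H' v"])
       (auto simp: inner_add_left sum.distrib)
qed

lemma has_lap_cmult:
  assumes "has_lap f x L"
  shows "has_lap (\<lambda>y. c * f y) x (c * L)"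
proof -
  obtain G H where *: "\<forall>\<^sub>F y in nhds x. GDERIV f y :> G y" "(G has_derivative H) (at x)"
     "L = (\<Sum>b\<in>Basis. H b \<bullet> b)"
    using assms unfolding has_lap_def by blast
  have "\<forall>\<^sub>F y in nhds x. GDERIV (\<lambda>y. c * f y) y :> c *\<^sub>R G y"
    using *(1)
  proof eventually_elim
    case (elim y)
    then show ?case
      unfolding gderiv_def by (auto intro!: derivative_eq_intros)
  qed
  moreover have "((\<lambda>y. c *\<^sub>R G y) has_derivative (\<lambda>v. c *\<^sub>R H v)) (at x)"
    using *(2) by (rule has_derivative_scaleR_right)
  ultimately show ?thesis
    unfolding has_lap_def using *(3)
    by (intro exI[of _ "\<lambda>y. c *\<^sub>R G y"] exI[of _ "\<lambda>v. c *\<^sub>R H v"])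
       (auto simp: sum_distrib_left)
qed

lemma has_lap_const: "has_lap (\<lambda>y. c) x 0"
  unfolding has_lap_def
  by (intro exI[of _ "\<lambda>y. 0"] exI[of _ "\<lambda>v. 0"]) (auto simp: GDERIV_const)

lemma harmonic_on_has_lap:
  assumes "f harmonic_on S" "x \<in> S"
  shows "has_lap f x 0"
proof -
  obtain G H where *: "open S" "\<forall>x\<in>S. GDERIV f x :> G x" "\<forall>x\<in>S. (G has_derivative H x) (at x)"
    "\<forall>x\<in>S. (\<Sum>b\<in>Basis. H x b \<bullet> b) = 0"
    using assms unfolding harmonic_on_def by blast
  have "\<forall>\<^sub>F y in nhds x. y \<in> S" using * assms by (simp add: eventually_nhds_in_open)
  then have "\<forall>\<^sub>F y in nhds x. GDERIV f y :> G y" by eventually_elim (use * in auto)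
  then show ?thesis unfolding has_lap_def using * assms by (intro exI[of _ G] exI[of _ "H x"]) auto
qed

text \<open>The gradient is assumed differentiable at \<open>x\<close> only, so the restriction to a
  line through \<open>x\<close> replaces a Taylor expansion. Its derivative \<open>\<psi>\<close>
  vanishes at 0; a negative second derivative would make \<open>\<psi>\<close> negative just to the
  right of 0 and, by the mean value theorem, push \<open>f\<close> below \<open>f x\<close>.\<close>

lemma has_lap_local_min:
  assumes "has_lap f x L" "\<forall>\<^sub>F y in nhds x. f x \<le> f y"
  shows "L \<ge> 0"
proof -
  obtain G H where *: "\<forall>\<^sub>F y in nhds x. GDERIV f y :> G y" "(G has_derivative H) (at x)"
     "L = (\<Sum>b\<in>Basis. H b \<bullet> b)"
    using assms unfolding has_lap_def by blast
  have "H b \<bullet> b \<ge> 0" for b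
  proof (rule ccontr)
    assume neg: "\<not> H b \<bullet> b \<ge> 0"
    have "\<forall>\<^sub>F y in nhds x. GDERIV f y :> G y \<and> f x \<le> f y"
      using *(1) assms(2) by (rule eventually_conj)
    then obtain e where e: "e > 0" "\<And>y. dist y x < e \<Longrightarrow> GDERIV f y :> G y \<and> f x \<le> f y"
      unfolding eventually_nhds_metric by blast
    define \<phi> where "\<phi> t = f (x + t *\<^sub>R b)" for t :: real
    define \<psi> where "\<psi> t = G (x + t *\<^sub>R b) \<bullet> b" for t :: real
    define r where "r = e / (norm b + 1)"
    have r: "r > 0" using e(1) by (simp add: r_def add_nonneg_pos)
    have near: "dist (x + t *\<^sub>R b) x < e" if "\<bar>t\<bar> < r" for t
    proof -
      have "\<bar>t\<bar> * norm b \<le> \<bar>t\<bar> * (norm b + 1)" by (simp add: mult_left_mono)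
      also have "\<dots> < e" using that by (simp add: r_def pos_less_divide_eq add_nonneg_pos)
      finally show ?thesis by (simp add: dist_norm)
    qed
    have d\<phi>: "(\<phi> has_real_derivative \<psi> t) (at t)" if "\<bar>t\<bar> < r" for t
    proof -
      have "(f has_derivative (\<lambda>h. h \<bullet> G (x + t *\<^sub>R b))) (at (x + t *\<^sub>R b))"
        using e(2)[OF near[OF that]] by (simp add: gderiv_def)
      moreover have "((\<lambda>t. x + t *\<^sub>R b) has_derivative (\<lambda>h. h *\<^sub>R b)) (at t)"
        by (auto intro!: derivative_eq_intros)
      ultimately have "((f \<circ> (\<lambda>t. x + t *\<^sub>R b)) has_derivative
          ((\<lambda>h. h \<bullet> G (x + t *\<^sub>R b)) \<circ> (\<lambda>h. h *\<^sub>R b))) (at t)"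
        by (intro diff_chain_at)
      then show ?thesis
        by (simp add: has_field_derivative_def o_def \<phi>_def[abs_def] \<psi>_def inner_commute mult.commute)
           (simp add: mult_commute_abs)
    qed
    have d\<psi>: "(\<psi> has_real_derivative H b \<bullet> b) (at 0)"
    proof -
      have lin: "linear H" using *(2) by (simp add: has_derivative_linear)
      have "((\<lambda>t. x + t *\<^sub>R b) has_derivative (\<lambda>h. h *\<^sub>R b)) (at 0)"
        by (auto intro!: derivative_eq_intros)
      then have "((G \<circ> (\<lambda>t. x + t *\<^sub>R b)) has_derivative (H \<circ> (\<lambda>h. h *\<^sub>R b))) (at 0)"
        by (rule diff_chain_at) (use *(2) in simp)
      then have "((\<lambda>t. (G \<circ> (\<lambda>t. x + t *\<^sub>R b)) t \<bullet> b) has_derivative (\<lambda>h. (H \<circ> (\<lambda>h. h *\<^sub>R b)) h \<bullet> b)) (at 0)"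
        by (rule has_derivative_inner_left)
      then show ?thesis
        by (simp add: has_field_derivative_def o_def \<psi>_def[abs_def] linear_scale[OF lin] mult_commute_abs)
    qed
    have \<psi>0: "\<psi> 0 = 0"
    proof (rule DERIV_local_min[OF d\<phi>])
      show "\<forall>y. \<bar>0 - y\<bar> < r \<longrightarrow> \<phi> 0 \<le> \<phi> y"
        using e(2) near by (auto simp: \<phi>_def)
    qed (use r in auto)
    obtain d where d: "d > 0" "\<And>h. 0 < h \<Longrightarrow> h < d \<Longrightarrow> \<psi> h < \<psi> 0"
      using DERIV_neg_dec_right[OF d\<psi>] neg by auto
    define t where "t = min d r / 2"
    have t: "0 < t" "t < d" "t < r" using d(1) r by (auto simp: t_def)
    have "\<exists>z>0. z < t \<and> \<phi> t - \<phi> 0 = (t - 0) * \<psi> z"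
      using t by (intro MVT2) (auto intro!: d\<phi>)
    then obtain z where z: "0 < z" "z < t" "\<phi> t - \<phi> 0 = t * \<psi> z" by auto
    have "\<psi> z < 0" using d(2)[of z] z t \<psi>0 by auto
    then have "\<phi> t < \<phi> 0" using z t by (smt (verit) mult_pos_neg)
    moreover have "\<phi> 0 \<le> \<phi> t" using e(2) near[of t] t by (auto simp: \<phi>_def)
    ultimately show False by simp
  qed
  then show ?thesis using *(3) by (auto intro: sum_nonneg)
qed

lemma inward_deriv_add: "inward_deriv f z d \<Longrightarrow> inward_deriv g z e \<Longrightarrow> inward_deriv (\<lambda>y. f y + g y) z (d + e)"
  unfolding inward_deriv_def by (rule DERIV_add)

lemma inward_deriv_cmult: "inward_deriv f z d \<Longrightarrow> inward_deriv (\<lambda>y. c * f y) z (c * d)"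
  unfolding inward_deriv_def by (rule DERIV_cmult)

lemma inward_deriv_const: "inward_deriv (\<lambda>y. c) z 0"
  unfolding inward_deriv_def by simp

lemma GDERIV_imp_inward_deriv:
  assumes "GDERIV f z :> G"
  shows "inward_deriv f z (- (z \<bullet> G))"
proof -
  have "(f has_derivative (\<lambda>h. h \<bullet> G)) (at (z - 0 *\<^sub>R z))"
    using assms by (simp add: gderiv_def)
  moreover have "((\<lambda>t::real. z - t *\<^sub>R z) has_derivative (\<lambda>h. - (h *\<^sub>R z))) (at 0)"
    by (auto intro!: derivative_eq_intros)
  ultimately have "((f \<circ> (\<lambda>t. z - t *\<^sub>R z)) has_derivative ((\<lambda>h. h \<bullet> G) \<circ> (\<lambda>h. - (h *\<^sub>R z)))) (at 0)"
    by (intro diff_chain_at)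
  then have "((\<lambda>t. f (z - t *\<^sub>R z)) has_real_derivative - (z \<bullet> G)) (at 0)"
    unfolding has_field_derivative_def o_def by (rule has_derivative_eq_rhs) (simp add: fun_eq_iff)
  then show ?thesis unfolding inward_deriv_def by (rule DERIV_subset) simp
qed

lemma GDERIV_imp_continuous: "GDERIV f x :> G \<Longrightarrow> continuous (at x) f"
  unfolding gderiv_def by (rule has_derivative_continuous)

text \<open>\<open>K\<close> carries the boundary values and \<open>a\<close> is a possible pole,
  where continuity is asked but no Laplacian. On the sphere outside \<open>K\<close> the inward
  derivative takes the role of the Laplacian.\<close>

definition supersol :: "'a::euclidean_space set \<Rightarrow> 'a set \<Rightarrow> 'a \<Rightarrow> ('a \<Rightarrow> real) \<Rightarrow> bool" where
  "supersol C K a h \<longleftrightarrow> continuous_on C h \<and>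
     (\<forall>x\<in>C - K. x \<noteq> a \<longrightarrow> norm x < 1 \<longrightarrow> (\<exists>L\<le>0. has_lap h x L)) \<and>
     (\<forall>x\<in>C - K. norm x = 1 \<longrightarrow> (\<exists>d\<le>0. inward_deriv h x d))"

text \<open>The inequalities are strict, so that adding a small positive multiple of
  \<open>P\<close> makes a supersolution strict. The blow-up at \<open>a\<close> keeps minima away
  from the one point without a Laplacian.\<close>

definition barrier :: "'a::euclidean_space set \<Rightarrow> 'a set \<Rightarrow> 'a \<Rightarrow> ('a \<Rightarrow> real) \<Rightarrow> bool" where
  "barrier C K a P \<longleftrightarrow> continuous_on (C - {a}) P \<and>
     (\<forall>x\<in>C - K. x \<noteq> a \<longrightarrow> norm x < 1 \<longrightarrow> (\<exists>L<0. has_lap P x L)) \<and>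
     (\<forall>x\<in>C - K. norm x = 1 \<longrightarrow> (\<exists>d<0. inward_deriv P x d)) \<and>
     (a \<in> C \<longrightarrow> filterlim P at_top (at a))"

text \<open>By the last clause \<open>C - K\<close> is relatively open in the closed ball: each of
  its points is interior to \<open>C\<close> or lies on the unit sphere, with \<open>C\<close>
  filling the ball nearby.\<close>

definition cell :: "'a::euclidean_space set \<Rightarrow> 'a set \<Rightarrow> 'a \<Rightarrow> bool" where
  "cell C K a \<longleftrightarrow> compact C \<and> compact K \<and> C \<subseteq> cball 0 1 \<and> K \<subseteq> C \<and> a \<notin> K \<and> norm a < 1 \<and>
     (\<forall>x\<in>C - K. \<exists>r>0. cball 0 1 \<inter> ball x r \<subseteq> C)"

lemma cell_interior_point:
  assumes "cell C K a" "x \<in> C - K" "norm x < 1"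
  shows "\<forall>\<^sub>F y in nhds x. y \<in> C"
proof -
  obtain r where r: "r > 0" "cball 0 1 \<inter> ball x r \<subseteq> C"
    using assms unfolding cell_def by blast
  have "\<forall>\<^sub>F y in nhds x. y \<in> ball 0 1 \<inter> ball x r"
    by (rule eventually_nhds_in_open) (use assms r in \<open>auto simp: dist_norm\<close>)
  then show ?thesis by eventually_elim (use r in auto)
qed

text \<open>If \<open>h\<close> fell below \<open>m\<close>, then for small \<open>e\<close> the
  function \<open>F = h + e * P\<close> would still be smaller at some \<open>x0\<close> than on
  \<open>K\<close> and near \<open>a\<close>. Its minimum is then attained in \<open>C - K\<close>
  off \<open>a\<close>. Inside the ball this contradicts the negative Laplacian, on the sphere the
  negative inward derivative.\<close>

theorem minimum_principle:
  fixes h :: "'a::euclidean_space \<Rightarrow> real"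
  assumes cell: "cell C K a" and h: "supersol C K a h" and P: "barrier C K a P"
    and m: "\<And>x. x \<in> K \<Longrightarrow> h x \<ge> m" and x: "x \<in> C"
  shows "h x \<ge> m"
proof (rule ccontr)
  assume "\<not> h x \<ge> m"
  have C: "compact C" "compact K" "C \<subseteq> cball 0 1" "K \<subseteq> C" "a \<notin> K" "norm a < 1"
    and ropen: "\<And>x. x \<in> C - K \<Longrightarrow> \<exists>r>0. cball 0 1 \<inter> ball x r \<subseteq> C"
    using cell by (auto simp: cell_def)
  have hc: "continuous_on C h" using h by (simp add: supersol_def)
  have Pc: "continuous_on (C - {a}) P" using P by (simp add: barrier_def)
  \<comment> \<open>The value of \<open>P\<close> at \<open>a\<close> itself carries no information,
    so a violation at \<open>a\<close> is moved to a neighbouring point by continuity.\<close>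
  have "\<exists>x\<in>C. x \<noteq> a \<and> h x < m"
  proof (cases "x = a")
    case True
    have "\<forall>\<^sub>F y in nhds a. y \<in> C" by (rule cell_interior_point[OF cell]) (use True x C in auto)
    then have inC: "\<forall>\<^sub>F y in at a. y \<in> C" by (simp add: eventually_at_filter eventually_mono)
    have "a \<in> interior C"
      using \<open>\<forall>\<^sub>F y in nhds a. y \<in> C\<close> unfolding eventually_nhds interior_def by blast
    then have "isCont h a" using hc continuous_on_interior by blast
    then have "\<forall>\<^sub>F y in at a. h y < m"
      using \<open>\<not> h x \<ge> m\<close> True by (intro order_tendstoD[of h "h a"]) (auto simp: isCont_def)
    with inC have "\<forall>\<^sub>F y in at a. y \<in> C \<and> y \<noteq> a \<and> h y < m"
      using eventually_neq_at_within by eventually_elim auto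
    then show ?thesis using eventually_happens[of _ "at a"] by (auto simp: trivial_limit_at)
  qed (use x \<open>\<not> h x \<ge> m\<close> in auto)
  then obtain x0 where x0: "x0 \<in> C" "x0 \<noteq> a" "h x0 < m" by blast
  have "bounded (P ` K)"
    by (rule compact_imp_bounded, rule compact_continuous_image, rule continuous_on_subset[OF Pc])
       (use C in auto)
  then obtain B where B: "B > 0" "\<And>x. x \<in> K \<Longrightarrow> \<bar>P x\<bar> \<le> B"
    unfolding bounded_pos by auto
  \<comment> \<open>Half of the value for which \<open>e * (\<bar>P x0\<bar> + B)\<close> equals the
    deficit \<open>m - h x0\<close>; this keeps \<open>F x0\<close> strictly below \<open>F\<close>
    on \<open>K\<close>.\<close>
  define e where "e = (m - h x0) / (2 * (\<bar>P x0\<bar> + B))"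
  have e: "e > 0" using x0 B by (auto simp: e_def intro!: divide_pos_pos)
  define F where "F x = h x + e * P x" for x
  have eP: "e * (\<bar>P x0\<bar> + B) < m - h x0"
  proof -
    have s: "\<bar>P x0\<bar> + B > 0" using B by simp
    have "e * (\<bar>P x0\<bar> + B) = (m - h x0) / (2 * (\<bar>P x0\<bar> + B)) * (\<bar>P x0\<bar> + B)" by (simp add: e_def)
    also have "\<dots> = (m - h x0) / 2" using s by (simp add: field_simps)
    finally show ?thesis using x0 by simp
  qed
  have FK: "F x > F x0" if "x \<in> K" for x
  proof -
    have "e * P x \<ge> - (e * B)" using B(2)[OF that] e
      by (metis abs_le_D2 minus_le_iff mult_left_mono mult_minus_right less_imp_le)
    moreover have "e * P x0 \<le> e * \<bar>P x0\<bar>" using e by simp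
    ultimately show ?thesis using m[OF that] eP by (simp add: F_def algebra_simps)
  qed
  have "\<exists>\<rho>>0. \<forall>x\<in>C. x \<noteq> a \<longrightarrow> dist x a < \<rho> \<longrightarrow> F x > F x0"
  proof (cases "a \<in> C")
    case True
    have "bounded (h ` C)" using hc C by (intro compact_imp_bounded compact_continuous_image)
    then obtain A where A: "\<And>x. x \<in> C \<Longrightarrow> \<bar>h x\<bar> \<le> A" unfolding bounded_pos by auto
    have "filterlim P at_top (at a)" using P True by (simp add: barrier_def)
    then have "\<forall>\<^sub>F x in at a. P x \<ge> (F x0 + 1 + A) / e"
      by (simp add: filterlim_at_top)
    then obtain \<rho> where \<rho>: "\<rho> > 0" "\<And>x. x \<noteq> a \<Longrightarrow> dist x a < \<rho> \<Longrightarrow> P x \<ge> (F x0 + 1 + A) / e"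
      unfolding eventually_at by auto
    have "F x > F x0" if "x \<in> C" "x \<noteq> a" "dist x a < \<rho>" for x
    proof -
      have "e * P x \<ge> F x0 + 1 + A"
        using \<rho>(2)[OF that(2,3)] e by (simp add: pos_divide_le_eq mult.commute)
      then show ?thesis using A[OF that(1)] by (simp add: F_def abs_le_iff)
    qed
    then show ?thesis using \<rho>(1) by blast
  next
    case False
    then have "open (- C)" "a \<in> - C" using C compact_imp_closed by auto
    then obtain \<rho> where "\<rho> > 0" "ball a \<rho> \<subseteq> - C" using open_contains_ball by blast
    then show ?thesis by (intro exI[of _ \<rho>]) (auto simp: dist_commute subset_iff)
  qed
  then obtain \<rho> where \<rho>: "\<rho> > 0" "\<And>x. x \<in> C \<Longrightarrow> x \<noteq> a \<Longrightarrow> dist x a < \<rho> \<Longrightarrow> F x > F x0" by blast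
  \<comment> \<open>Removing a ball in which \<open>F\<close> exceeds \<open>F x0\<close> leaves a
    compact set on which \<open>F\<close> is continuous.\<close>
  define C' where "C' = C - ball a \<rho>"
  have C': "compact C'" "C' \<subseteq> C - {a}" using C \<rho>(1) by (auto simp: C'_def intro: compact_diff)
  have x0': "x0 \<in> C'" using x0 \<rho>(2)[of x0] by (auto simp: C'_def dist_commute)
  have "continuous_on C' F"
    unfolding F_def using C' by (intro continuous_intros continuous_on_subset[OF hc] continuous_on_subset[OF Pc]) auto
  then obtain x1 where x1: "x1 \<in> C'" "\<And>x. x \<in> C' \<Longrightarrow> F x1 \<le> F x"
    using continuous_attains_inf[OF C'(1)] x0' by (metis empty_iff)
  have min: "F x1 \<le> F x" if "x \<in> C" "x \<noteq> a" for x
  proof (cases "x \<in> C'")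
    case False
    then have "F x > F x0" using \<rho>(2)[OF that] that by (auto simp: C'_def dist_commute)
    then show ?thesis using x1(2)[OF x0'] by simp
  qed (use x1 in auto)
  have x1': "x1 \<in> C - K" "x1 \<noteq> a"
    using x1 FK[of x1] x1(2)[OF x0'] C' by force+
  show False
  proof (cases "norm x1 < 1")
    case True
    obtain L L' where L: "L \<le> 0" "has_lap h x1 L" "L' < 0" "has_lap P x1 L'"
      using h P x1' True unfolding supersol_def barrier_def by meson
    have "has_lap F x1 (L + e * L')"
      unfolding F_def by (intro has_lap_add has_lap_cmult L)
    moreover have "\<forall>\<^sub>F y in nhds x1. F x1 \<le> F y"
    proof -
      have "\<forall>\<^sub>F y in nhds x1. y \<in> C" by (rule cell_interior_point[OF cell x1'(1) True])
      moreover have "\<forall>\<^sub>F y in nhds x1. y \<noteq> a"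
        using x1'(2) by (simp add: t1_space_nhds)
      ultimately show ?thesis by eventually_elim (use min in auto)
    qed
    ultimately have "L + e * L' \<ge> 0" by (rule has_lap_local_min)
    moreover have "e * L' < 0" using e L by (simp add: mult_pos_neg)
    ultimately show False using L by simp
  next
    case False
    then have n1: "norm x1 = 1" using x1' C by force
    obtain d d' where d: "d \<le> 0" "inward_deriv h x1 d" "d' < 0" "inward_deriv P x1 d'"
      using h P x1' n1 unfolding supersol_def barrier_def by meson
    have "inward_deriv F x1 (d + e * d')"
      unfolding F_def by (intro inward_deriv_add inward_deriv_cmult d)
    then have D: "((\<lambda>t. F (x1 - t *\<^sub>R x1)) has_real_derivative (d + e * d')) (at_right 0)"
      by (simp add: inward_deriv_def)
    have neg: "d + e * d' < 0" using e d by (smt (verit) mult_pos_neg)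
    obtain s where s: "s > 0" "\<And>t. 0 < t \<Longrightarrow> t < s \<Longrightarrow> F (x1 - t *\<^sub>R x1) < F x1"
      using has_real_derivative_neg_dec_right[OF D neg] by auto
    obtain r where r: "r > 0" "cball 0 1 \<inter> ball x1 r \<subseteq> C" using ropen x1' by blast
    have dx: "dist x1 a > 0" using x1' by simp
    \<comment> \<open>Short enough for the decrease of \<open>F\<close>, for staying in
      \<open>C\<close> and for missing the pole.\<close>
    define t where "t = min (min s r) (min 1 (dist x1 a)) / 2"
    have t: "0 < t" "t < s" "t < r" "t < 1" "t < dist x1 a"
      using s(1) r(1) dx by (auto simp: t_def min_def)
    have "norm (x1 - t *\<^sub>R x1) = 1 - t"
    proof -
      have "x1 - t *\<^sub>R x1 = (1 - t) *\<^sub>R x1" by (simp add: algebra_simps)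
      then show ?thesis using n1 t by simp
    qed
    moreover have "dist x1 (x1 - t *\<^sub>R x1) = t" using n1 t by (simp add: dist_norm)
    ultimately have "x1 - t *\<^sub>R x1 \<in> C" "x1 - t *\<^sub>R x1 \<noteq> a" using r t by (auto simp: subset_iff)
    then have "F x1 \<le> F (x1 - t *\<^sub>R x1)" by (rule min)
    with s(2)[of t] t show False by simp
  qed
qed

section \<open>Supersolutions form a convex cone containing all constants\<close>

lemma supersol_add:
  assumes "supersol C K a f" "supersol C K a g"
  shows "supersol C K a (\<lambda>x. f x + g x)"
  unfolding supersol_def
proof (intro conjI ballI impI)
  show "continuous_on C (\<lambda>x. f x + g x)"
    using assms unfolding supersol_def by (intro continuous_intros) auto
next
  fix x assume x: "x \<in> C - K" "x \<noteq> a" "norm x < 1"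
  then obtain L M where "L \<le> 0" "has_lap f x L" "M \<le> 0" "has_lap g x M"
    using assms unfolding supersol_def by meson
  then show "\<exists>L\<le>0. has_lap (\<lambda>x. f x + g x) x L"
    by (intro exI[of _ "L + M"]) (auto intro: has_lap_add)
next
  fix x assume x: "x \<in> C - K" "norm x = 1"
  then obtain L M where "L \<le> 0" "inward_deriv f x L" "M \<le> 0" "inward_deriv g x M"
    using assms unfolding supersol_def by meson
  then show "\<exists>L\<le>0. inward_deriv (\<lambda>x. f x + g x) x L"
    by (intro exI[of _ "L + M"]) (auto intro: inward_deriv_add)
qed

lemma supersol_cmult:
  assumes "supersol C K a f" "c \<ge> 0"
  shows "supersol C K a (\<lambda>x. c * f x)"
  unfolding supersol_def
proof (intro conjI ballI impI)
  show "continuous_on C (\<lambda>x. c * f x)"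
    using assms unfolding supersol_def by (intro continuous_intros) auto
next
  fix x assume x: "x \<in> C - K" "x \<noteq> a" "norm x < 1"
  then obtain L where "L \<le> 0" "has_lap f x L"
    using assms unfolding supersol_def by meson
  then show "\<exists>L\<le>0. has_lap (\<lambda>x. c * f x) x L"
    using assms(2) by (intro exI[of _ "c * L"]) (auto intro: has_lap_cmult simp: mult_nonneg_nonpos)
next
  fix x assume x: "x \<in> C - K" "norm x = 1"
  then obtain L where "L \<le> 0" "inward_deriv f x L"
    using assms unfolding supersol_def by meson
  then show "\<exists>L\<le>0. inward_deriv (\<lambda>x. c * f x) x L"
    using assms(2) by (intro exI[of _ "c * L"]) (auto intro: inward_deriv_cmult simp: mult_nonneg_nonpos)
qed

lemma supersol_const: "supersol C K a (\<lambda>x. c)"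
  unfolding supersol_def using has_lap_const inward_deriv_const by (auto intro!: exI[of _ 0])

lemma supersol_sum:
  assumes "\<And>i. i \<in> I \<Longrightarrow> supersol C K a (f i)"
  shows "supersol C K a (\<lambda>x. \<Sum>i\<in>I. f i x)"
  using assms
proof (induction I rule: infinite_finite_induct)
  case (insert i I)
  then show ?case by (simp add: supersol_add)
qed (simp_all add: supersol_const)

section \<open>Powers of quadratic functions and the Neumann function of the ball\<close>

definition qf :: "real \<Rightarrow> 'a::euclidean_space \<Rightarrow> real \<Rightarrow> 'a \<Rightarrow> real" where
  "qf p l c x = p * (x \<bullet> x) + 2 * (l \<bullet> x) + c"

text \<open>With a squared distance as base, the exponent \<open>1 - n / 2\<close> gives the
  Newtonian power \<open>2 - n\<close>. The Newton kernel, its smoothing and its Kelvin image all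
  have this form, so one computation of derivatives serves them all.\<close>

definition qpow :: "real \<Rightarrow> 'a::euclidean_space \<Rightarrow> real \<Rightarrow> 'a \<Rightarrow> real" where
  "qpow p l c x = qf p l c x powr (1 - real DIM('a) / 2)"

definition qgrad :: "real \<Rightarrow> 'a::euclidean_space \<Rightarrow> real \<Rightarrow> 'a \<Rightarrow> 'a" where
  "qgrad p l c x = ((2 - real DIM('a)) * qf p l c x powr (- (real DIM('a) / 2))) *\<^sub>R (p *\<^sub>R x + l)"

definition qhess :: "real \<Rightarrow> 'a::euclidean_space \<Rightarrow> real \<Rightarrow> 'a \<Rightarrow> 'a \<Rightarrow> 'a" where
  "qhess p l c x v = (2 - real DIM('a)) *\<^sub>R
     ((p * qf p l c x powr (- (real DIM('a) / 2))) *\<^sub>R v -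
      (real DIM('a) * qf p l c x powr (- (real DIM('a) / 2) - 1) * ((p *\<^sub>R x + l) \<bullet> v)) *\<^sub>R (p *\<^sub>R x + l))"

section \<open>Gradient, Hessian and Laplacian of powers of quadratic functions\<close>

lemma continuous_on_qf [continuous_intros]:
  assumes "continuous_on S f" "continuous_on S g" "continuous_on S h" "continuous_on S k"
  shows "continuous_on S (\<lambda>x. qf (f x) (g x) (h x) (k x))"
  unfolding qf_def by (intro continuous_intros assms)

lemma GDERIV_cmult:
  assumes "GDERIV f x :> G"
  shows "GDERIV (\<lambda>x. c * f x) x :> c *\<^sub>R G"
  using has_derivative_mult_right[OF assms[unfolded gderiv_def], of c]
  by (simp add: gderiv_def mult.left_commute)

lemma GDERIV_qf: "GDERIV (qf p l c) x :> 2 *\<^sub>R (p *\<^sub>R x + l)"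
  unfolding gderiv_def qf_def[abs_def]
  by (auto intro!: derivative_eq_intros simp: algebra_simps inner_commute)

lemma GDERIV_qf_powr:
  assumes "qf p l c x > 0"
  shows "GDERIV (\<lambda>x. qf p l c x powr r) x :> (2 * r * qf p l c x powr (r - 1)) *\<^sub>R (p *\<^sub>R x + l)"
proof (rule GDERIV_subst)
  show "GDERIV (\<lambda>x. qf p l c x powr r) x :> (r * qf p l c x powr (r - 1)) *\<^sub>R (2 *\<^sub>R (p *\<^sub>R x + l))"
    by (rule GDERIV_DERIV_compose[OF GDERIV_qf has_real_derivative_powr[OF assms]])
qed (simp add: mult_ac)

lemma GDERIV_qpow:
  fixes x :: "'a::euclidean_space"
  assumes "qf p l c x > 0"
  shows "GDERIV (qpow p l c) x :> qgrad p l c x"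
  unfolding qpow_def[abs_def] qgrad_def
  by (rule GDERIV_subst[OF GDERIV_qf_powr[OF assms]]) (simp add: algebra_simps)

lemma qgrad_has_derivative:
  fixes x :: "'a::euclidean_space"
  assumes "qf p l c x > 0"
  shows "(qgrad p l c has_derivative qhess p l c x) (at x)"
proof -
  have "((\<lambda>x. qf p l c x powr (- (real DIM('a) / 2))) has_derivative
      (\<lambda>h. h \<bullet> ((2 * (- (real DIM('a) / 2)) * qf p l c x powr (- (real DIM('a) / 2) - 1)) *\<^sub>R (p *\<^sub>R x + l)))) (at x)"
    using GDERIV_qf_powr[OF assms] unfolding gderiv_def .
  note D = this
  show ?thesis
    unfolding qgrad_def[abs_def] qhess_def[abs_def]
    by (rule derivative_eq_intros D refl)+
       (simp add: fun_eq_iff algebra_simps inner_commute)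
qed

lemma sum_inner_Basis: "(\<Sum>b\<in>Basis. (v \<bullet> b) * (v \<bullet> b)) = v \<bullet> (v::'a::euclidean_space)"
  by (simp add: euclidean_inner[of v v])

text \<open>For the base \<open>Q\<close>, the squared norm of \<open>p *\<^sub>R x + l\<close> is
  \<open>p * (Q - c) + l \<bullet> l\<close>. With this exponent the terms in \<open>p * Q\<close>
  cancel and the discriminant \<open>l \<bullet> l - p * c\<close> remains. It is 0 for the Kelvin
  image and \<open>- \<theta>\<close> for the smoothed Newton kernel.\<close>

lemma trace_qhess:
  fixes x :: "'a::euclidean_space"
  assumes "qf p l c x > 0"
  shows "(\<Sum>b\<in>Basis. qhess p l c x b \<bullet> b) = real DIM('a) * (real DIM('a) - 2) *
           qf p l c x powr (- (real DIM('a) / 2) - 1) * (l \<bullet> l - p * c)"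
proof -
  let ?n = "real DIM('a)" and ?Q = "qf p l c x" and ?w = "p *\<^sub>R x + l"
  have Q: "?Q powr (- (?n / 2)) = ?Q powr (- (?n / 2) - 1) * ?Q"
    using assms by (simp add: powr_diff)
  have ww: "?w \<bullet> ?w = p * (?Q - c) + l \<bullet> l"
    by (simp add: qf_def algebra_simps inner_commute power2_eq_square)
  have "(\<Sum>b\<in>Basis. qhess p l c x b \<bullet> b) =
      (2 - ?n) * (\<Sum>b\<in>Basis. p * ?Q powr (- (?n / 2)) - ?n * ?Q powr (- (?n / 2) - 1) * ((?w \<bullet> b) * (?w \<bullet> b)))"
    unfolding qhess_def sum_distrib_left
    by (intro sum.cong) (auto simp: inner_diff_left inner_Basis)
  also have "\<dots> = (2 - ?n) * (?n * p * ?Q powr (- (?n / 2)) - ?n * ?Q powr (- (?n / 2) - 1) * (?w \<bullet> ?w))"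
    by (simp add: sum_subtractf sum_distrib_left[symmetric] sum_inner_Basis del: inner_add_left)
  also have "\<dots> = ?n * (?n - 2) * ?Q powr (- (?n / 2) - 1) * (l \<bullet> l - p * c)"
    unfolding Q ww by (simp add: algebra_simps)
  finally show ?thesis .
qed

lemma eventually_qf_pos:
  assumes "qf p l c x > 0"
  shows "\<forall>\<^sub>F y in nhds x. qf p l c y > 0"
proof -
  have "isCont (qf p l c) x" using GDERIV_qf GDERIV_imp_continuous by blast
  then have "\<forall>\<^sub>F y in at x. qf p l c y > 0"
    using assms by (intro order_tendstoD[of _ "qf p l c x"]) (auto simp: isCont_def)
  then show ?thesis using assms by (simp add: eventually_nhds_conv_at)
qed

text \<open>
  Up to the factor \<open>lam n\<close>, the Neumann function of the unit ball with pole \<open>y\<close> is the Newton kernel at \<open>y\<close>, plus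
  its Kelvin image \<open>kelvin y\<close>, plus \<open>n - 2\<close> times the integral of \<open>(kelvin (t *\<^sub>R y) x - 1) / t\<close>
  over \<open>0 \<le> t \<le> 1\<close>.  The radial derivative of the integral is \<open>kelvin y x - 1\<close>, which on the sphere cancels
  the non-constant part of the flux of the first two terms.  At \<open>t = 0\<close> the integrand is given its limit.
\<close>

definition newton :: "real \<Rightarrow> 'a::euclidean_space \<Rightarrow> 'a \<Rightarrow> real" where
  "newton \<theta> y = qpow 1 (- y) (y \<bullet> y + \<theta>)"

definition kelvin :: "'a::euclidean_space \<Rightarrow> 'a \<Rightarrow> real" where
  "kelvin y = qpow (y \<bullet> y) (- y) 1"

definition flux_fun :: "'a::euclidean_space \<Rightarrow> 'a \<Rightarrow> real \<Rightarrow> real" where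
  "flux_fun y x t = (if t = 0 then (real DIM('a) - 2) * (x \<bullet> y) else (kelvin (t *\<^sub>R y) x - 1) / t)"

definition flux_int :: "'a::euclidean_space \<Rightarrow> 'a \<Rightarrow> real" where
  "flux_int y x = integral {0..1} (flux_fun y x)"

definition regpart :: "'a::euclidean_space \<Rightarrow> 'a \<Rightarrow> real" where
  "regpart y x = kelvin y x + (real DIM('a) - 2) * flux_int y x"

section \<open>Positivity of the bases and symmetry in the two points\<close>

lemma newton_base: "qf 1 (- y) (y \<bullet> y + \<theta>) x = (norm (x - y))\<^sup>2 + \<theta>"
  by (simp add: qf_def power2_norm_eq_inner algebra_simps inner_commute)

lemma kelvin_base_ge: "qf (y \<bullet> y) (- y) 1 x \<ge> (1 - norm x * norm y)\<^sup>2"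
proof -
  have "x \<bullet> y \<le> norm x * norm y" by (rule norm_cauchy_schwarz)
  then show ?thesis
    by (simp add: qf_def power2_eq_square algebra_simps inner_commute dot_square_norm)
qed

text \<open>Only the product of the norms matters, so a pole inside the ball allows points on the
  sphere and slightly beyond it. This yields two-sided derivatives at boundary points.\<close>

lemma kelvin_base_pos:
  assumes "norm x * norm y < 1"
  shows "qf (y \<bullet> y) (- y) 1 x > 0"
  using kelvin_base_ge[of x y] assms by (smt (verit) zero_less_power)

lemma scaled_prod_less_1:
  assumes "norm x * norm y < 1" "0 \<le> t" "t \<le> (1::real)"
  shows "norm x * norm (t *\<^sub>R y) < 1"
proof -
  have "norm x * norm (t *\<^sub>R y) = t * (norm x * norm y)" using assms by simp
  also have "\<dots> \<le> 1 * (norm x * norm y)" using assms by (intro mult_right_mono) auto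
  finally show ?thesis using assms by simp
qed

lemma kelvin_commute: "kelvin y x = kelvin x y"
  by (simp add: kelvin_def qpow_def qf_def inner_commute mult_ac)

lemma newton_commute: "newton \<theta> y x = newton \<theta> x y"
  by (simp add: newton_def qpow_def qf_def inner_commute algebra_simps)

lemma kelvin_scale: "kelvin (t *\<^sub>R y) x = kelvin (t *\<^sub>R x) y"
  by (simp add: kelvin_def qpow_def qf_def inner_commute mult_ac)

lemma flux_fun_commute: "flux_fun y x t = flux_fun x y t"
  unfolding flux_fun_def using kelvin_scale[of t y x] by (simp add: inner_commute)

lemma flux_int_commute: "flux_int y x = flux_int x y"
proof -
  have "flux_fun y x = flux_fun x y" by (rule ext) (rule flux_fun_commute)
  then show ?thesis by (simp add: flux_int_def)
qed

lemma regpart_commute: "regpart y x = regpart x y"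
  by (simp add: regpart_def kelvin_commute flux_int_commute)

text \<open>The Kelvin base depends on the points only through \<open>x \<bullet> y\<close> and the
  product of the squared norms, so a scale factor can be moved from one point to the other. The
  symmetry of \<open>reg_kernel\<close> rests on this.\<close>

lemma regpart_scale_commute: "regpart (s *\<^sub>R y) x = regpart (s *\<^sub>R x) y"
proof -
  have "flux_fun (s *\<^sub>R y) x t = flux_fun (s *\<^sub>R x) y t" for t
    using kelvin_scale[of "t * s" y x] by (simp add: flux_fun_def inner_commute)
  then have "flux_fun (s *\<^sub>R y) x = flux_fun (s *\<^sub>R x) y" by (rule ext)
  then show ?thesis
    using kelvin_scale[of s y x] by (simp add: regpart_def flux_int_def)
qed

text \<open>The difference quotient of \<open>(1 + u) powr e\<close> at \<open>u = 0\<close>,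
  completed continuously. It makes \<open>flux_fun\<close> jointly continuous across
  \<open>t = 0\<close>.\<close>

definition powr_quotient :: "real \<Rightarrow> real \<Rightarrow> real" where
  "powr_quotient e u = (if u = 0 then e else ((1 + u) powr e - 1) / u)"

lemma continuous_on_powr_quotient: "continuous_on {-1<..} (powr_quotient e)"
proof (rule continuous_at_imp_continuous_on, rule ballI)
  fix u :: real assume u: "u \<in> {-1<..}"
  show "isCont (powr_quotient e) u"
  proof (cases "u = 0")
    case True
    have "((\<lambda>u. (1 + u) powr e) has_real_derivative e) (at 0)"
      by (auto intro!: derivative_eq_intros)
    then have "((\<lambda>u. ((1 + u) powr e - 1) / u) \<longlongrightarrow> e) (at 0)"
      by (simp add: has_field_derivative_iff)
    then have "(powr_quotient e \<longlongrightarrow> e) (at 0)"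
      by (rule Lim_transform_eventually) (simp add: powr_quotient_def eventually_at_filter)
    then show ?thesis using True by (simp add: isCont_def powr_quotient_def)
  next
    case False
    have c: "isCont (\<lambda>u. ((1 + u) powr e - 1) / u) u"
      using u False by (intro continuous_intros) auto
    have ev: "\<forall>\<^sub>F v in nhds u. ((1 + v) powr e - 1) / v = powr_quotient e v"
    proof -
      have "\<forall>\<^sub>F v in nhds u. v \<noteq> 0" using False by (rule t1_space_nhds)
      then show ?thesis by eventually_elim (simp add: powr_quotient_def)
    qed
    show ?thesis by (rule iffD1[OF isCont_cong[OF ev] c])
  qed
qed

text \<open>The base of \<open>kelvin (t *\<^sub>R y) x\<close> is \<open>1 + t * \<beta> t\<close>.
  Dividing by \<open>t\<close> thus amounts to taking the quotient at \<open>t * \<beta> t\<close>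
  and multiplying by \<open>\<beta> t\<close>, which is harmless also where \<open>\<beta> t\<close>
  vanishes.\<close>

lemma flux_fun_powr_quotient:
  fixes y x :: "'a::euclidean_space"
  defines "\<beta> t \<equiv> t * (x \<bullet> x) * (y \<bullet> y) - 2 * (x \<bullet> y)"
  shows "flux_fun y x t = powr_quotient (1 - real DIM('a) / 2) (t * \<beta> t) * \<beta> t"
proof (cases "t = 0")
  case False
  have "kelvin (t *\<^sub>R y) x = (1 + t * \<beta> t) powr (1 - real DIM('a) / 2)"
    by (simp add: kelvin_def qpow_def qf_def \<beta>_def algebra_simps inner_commute)
  then show ?thesis using False by (auto simp: flux_fun_def powr_quotient_def)
qed (simp add: flux_fun_def powr_quotient_def \<beta>_def algebra_simps)

lemma continuous_on_flux_fun:
  "continuous_on ({z. norm (snd z) * norm (fst z) < 1} \<times> {0..1}) (\<lambda>(z, t). flux_fun (fst z) (snd z) t)"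
proof -
  let ?\<beta> = "\<lambda>w::('a \<times> 'a) \<times> real. snd w * (snd (fst w) \<bullet> snd (fst w)) * (fst (fst w) \<bullet> fst (fst w)) - 2 * (snd (fst w) \<bullet> fst (fst w))"
  let ?S = "{z::'a \<times> 'a. norm (snd z) * norm (fst z) < 1} \<times> {0..1::real}"
  have "-1 < snd w * ?\<beta> w" if "w \<in> ?S" for w
  proof -
    have "0 < qf ((snd w *\<^sub>R fst (fst w)) \<bullet> (snd w *\<^sub>R fst (fst w))) (- (snd w *\<^sub>R fst (fst w))) 1 (snd (fst w))"
      using that by (intro kelvin_base_pos scaled_prod_less_1) auto
    then show ?thesis by (simp add: qf_def algebra_simps inner_commute)
  qed
  then have "continuous_on ?S (\<lambda>w. powr_quotient (1 - real DIM('a) / 2) (snd w * ?\<beta> w))"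
    by (intro continuous_on_compose2[OF continuous_on_powr_quotient]) (auto intro!: continuous_intros)
  then have "continuous_on ?S (\<lambda>w. powr_quotient (1 - real DIM('a) / 2) (snd w * ?\<beta> w) * ?\<beta> w)"
    by (intro continuous_on_mult) (auto intro!: continuous_intros)
  then show ?thesis by (simp add: case_prod_unfold flux_fun_powr_quotient)
qed

lemma continuous_on_flux_int:
  "continuous_on {z. norm (snd z) * norm (fst z) < 1} (\<lambda>z. flux_int (fst z) (snd z))"
  unfolding flux_int_def
  using integral_continuous_on_param[of _ 0 "1::real" "\<lambda>z. flux_fun (fst z) (snd z)"] continuous_on_flux_fun
  by simp

lemma continuous_on_kelvin:
  "continuous_on {z. norm (snd z) * norm (fst z) < 1} (\<lambda>z. kelvin (fst z) (snd z))"
  unfolding kelvin_def qpow_def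
  by (intro continuous_intros) (use kelvin_base_pos in force)

lemma continuous_on_regpart:
  "continuous_on {z. norm (snd z) * norm (fst z) < 1} (\<lambda>z. regpart (fst z) (snd z))"
  unfolding regpart_def by (intro continuous_intros continuous_on_flux_int continuous_on_kelvin)

lemma flux_fun_integrable:
  assumes "norm x * norm y < 1"
  shows "flux_fun y x integrable_on {0..1}"
proof (rule integrable_continuous_real)
  have "continuous_on {0..1} (\<lambda>t. (\<lambda>(z, t). flux_fun (fst z) (snd z) t) ((y, x), t))"
    by (rule continuous_on_compose2[OF continuous_on_flux_fun]) (use assms in \<open>auto intro!: continuous_intros\<close>)
  then show "continuous_on {0..1} (flux_fun y x)" by simp
qed

section \<open>Differentiation of the flux integral under the integral sign\<close>

definition flux_base :: "'a::euclidean_space \<Rightarrow> 'a \<Rightarrow> real \<Rightarrow> real" where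
  "flux_base y x t = qf (t\<^sup>2 * (y \<bullet> y)) (- (t *\<^sub>R y)) 1 x"

text \<open>The gradient of the Kelvin image with pole \<open>t *\<^sub>R y\<close> contains a
  factor \<open>t\<close>, here cancelled against \<open>1 / t\<close>. The formula is therefore
  valid at \<open>t = 0\<close> too, and likewise the Hessian below.\<close>

definition flux_fun_grad :: "'a::euclidean_space \<Rightarrow> 'a \<Rightarrow> real \<Rightarrow> 'a" where
  "flux_fun_grad y x t = ((2 - real DIM('a)) * flux_base y x t powr (- (real DIM('a) / 2))) *\<^sub>R ((t * (y \<bullet> y)) *\<^sub>R x - y)"

definition flux_fun_hess :: "'a::euclidean_space \<Rightarrow> 'a \<Rightarrow> real \<Rightarrow> 'a \<Rightarrow> 'a" where
  "flux_fun_hess y x t v = (2 - real DIM('a)) *\<^sub>R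
     ((t * (y \<bullet> y) * flux_base y x t powr (- (real DIM('a) / 2))) *\<^sub>R v -
      (t * real DIM('a) * flux_base y x t powr (- (real DIM('a) / 2) - 1) * (((t * (y \<bullet> y)) *\<^sub>R x - y) \<bullet> v)) *\<^sub>R
        ((t * (y \<bullet> y)) *\<^sub>R x - y))"

lemma flux_base_eq: "flux_base y x t = qf ((t *\<^sub>R y) \<bullet> (t *\<^sub>R y)) (- (t *\<^sub>R y)) 1 x"
  by (simp add: flux_base_def power2_eq_square mult_ac)

lemma flux_base_pos:
  assumes "norm x * norm y < 1" "t \<in> {0..1}"
  shows "flux_base y x t > 0"
  unfolding flux_base_eq using assms by (intro kelvin_base_pos scaled_prod_less_1) auto

lemma flux_fun_GDERIV:
  fixes x y :: "'a::euclidean_space"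
  assumes "norm x * norm y < 1" "t \<in> {0..1}"
  shows "GDERIV (\<lambda>x. flux_fun y x t) x :> flux_fun_grad y x t"
proof (cases "t = 0")
  case True
  have "GDERIV (\<lambda>x. (real DIM('a) - 2) * (x \<bullet> y)) x :> (real DIM('a) - 2) *\<^sub>R y"
    unfolding gderiv_def by (auto intro!: derivative_eq_intros)
  then show ?thesis
    using True by (simp add: flux_fun_def flux_fun_grad_def flux_base_def qf_def algebra_simps)
next
  case False
  have "GDERIV (\<lambda>x. kelvin (t *\<^sub>R y) x) x :> qgrad ((t *\<^sub>R y) \<bullet> (t *\<^sub>R y)) (- (t *\<^sub>R y)) 1 x"
    unfolding kelvin_def using flux_base_pos[OF assms] by (intro GDERIV_qpow) (simp add: flux_base_eq)
  then have "GDERIV (\<lambda>x. (1 / t) * (kelvin (t *\<^sub>R y) x - 1)) x :>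
      (1 / t) *\<^sub>R (qgrad ((t *\<^sub>R y) \<bullet> (t *\<^sub>R y)) (- (t *\<^sub>R y)) 1 x - 0)"
    by (intro GDERIV_cmult GDERIV_diff GDERIV_const)
  moreover have "(1 / t) *\<^sub>R qgrad ((t *\<^sub>R y) \<bullet> (t *\<^sub>R y)) (- (t *\<^sub>R y)) 1 x = flux_fun_grad y x t"
    using False by (simp add: qgrad_def flux_fun_grad_def flux_base_def power2_eq_square algebra_simps)
  ultimately show ?thesis using False by (simp add: flux_fun_def)
qed

lemma flux_fun_grad_has_derivative:
  fixes x y :: "'a::euclidean_space"
  assumes "norm x * norm y < 1" "t \<in> {0..1}"
  shows "((\<lambda>x. flux_fun_grad y x t) has_derivative flux_fun_hess y x t) (at x)"
proof (cases "t = 0")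
  case True
  then show ?thesis
    by (simp add: flux_fun_grad_def flux_fun_hess_def[abs_def] flux_base_def qf_def)
next
  case False
  let ?p = "(t *\<^sub>R y) \<bullet> (t *\<^sub>R y)"
  have "((\<lambda>x. (1 / t) *\<^sub>R qgrad ?p (- (t *\<^sub>R y)) 1 x) has_derivative
      (\<lambda>v. (1 / t) *\<^sub>R qhess ?p (- (t *\<^sub>R y)) 1 x v)) (at x)"
    using flux_base_pos[OF assms] by (intro has_derivative_scaleR_right qgrad_has_derivative) (simp add: flux_base_eq)
  moreover have "(1 / t) *\<^sub>R qgrad ?p (- (t *\<^sub>R y)) 1 x = flux_fun_grad y x t" for x
    using False by (simp add: qgrad_def flux_fun_grad_def flux_base_def power2_eq_square algebra_simps)
  moreover have "(1 / t) *\<^sub>R qhess ?p (- (t *\<^sub>R y)) 1 x v = flux_fun_hess y x t v" for v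
    using False by (simp add: qhess_def flux_fun_hess_def flux_base_def power2_eq_square algebra_simps)
  ultimately show ?thesis by simp
qed

lemma trace_flux_fun_hess:
  fixes x y :: "'a::euclidean_space"
  assumes "norm x * norm y < 1" "t \<in> {0..1}"
  shows "(\<Sum>b\<in>Basis. flux_fun_hess y x t b \<bullet> b) = 0"
proof (cases "t = 0")
  case True
  then show ?thesis by (simp add: flux_fun_hess_def)
next
  case False
  let ?p = "(t *\<^sub>R y) \<bullet> (t *\<^sub>R y)"
  have "flux_fun_hess y x t v = (1 / t) *\<^sub>R qhess ?p (- (t *\<^sub>R y)) 1 x v" for v
    using False by (simp add: qhess_def flux_fun_hess_def flux_base_def power2_eq_square algebra_simps)
  then have "(\<Sum>b\<in>Basis. flux_fun_hess y x t b \<bullet> b) = (1 / t) * (\<Sum>b\<in>Basis. qhess ?p (- (t *\<^sub>R y)) 1 x b \<bullet> b)"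
    by (simp add: sum_distrib_left)
  also have "\<dots> = 0"
    using trace_qhess[of ?p "- (t *\<^sub>R y)" 1 x] flux_base_pos[OF assms] by (simp add: flux_base_eq)
  finally show ?thesis .
qed

lemma continuous_on_flux_fun_grad:
  assumes "\<And>x. x \<in> U \<Longrightarrow> norm x * norm y < 1"
  shows "continuous_on (U \<times> {0..1}) (\<lambda>(x, t). flux_fun_grad y x t)"
proof -
  have "flux_base y (fst w) (snd w) \<noteq> 0" if "w \<in> U \<times> {0..1}" for w
    using flux_base_pos[of "fst w" y "snd w"] assms that by auto
  then show ?thesis
    unfolding flux_fun_grad_def flux_base_def case_prod_unfold
    by (intro continuous_intros) auto
qed

lemma continuous_on_flux_fun_hess:
  assumes "\<And>x. x \<in> U \<Longrightarrow> norm x * norm y < 1"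
  shows "continuous_on (U \<times> {0..1}) (\<lambda>(x, t). flux_fun_hess y x t v)"
proof -
  have "flux_base y (fst w) (snd w) \<noteq> 0" if "w \<in> U \<times> {0..1}" for w
    using flux_base_pos[of "fst w" y "snd w"] assms that by auto
  then show ?thesis
    unfolding flux_fun_hess_def flux_base_def case_prod_unfold
    by (intro continuous_intros) auto
qed

text \<open>Differentiation under the integral sign asks for a convex neighbourhood. A ball about
  the origin is a natural one, since the condition depends on the norm alone.\<close>

lemma ex_ball_prod_less_1:
  assumes "norm (x::'a::euclidean_space) * norm (y::'a) < 1"
  shows "\<exists>r. x \<in> ball (0::'a) r \<and> (\<forall>z\<in>ball (0::'a) r. norm z * norm y < 1)"
proof (cases "y = 0")
  case True
  then show ?thesis by (intro exI[of _ "norm x + 1"]) auto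
next
  case False
  then have "norm y > 0" by simp
  then show ?thesis using assms
    by (intro exI[of _ "1 / norm y"]) (auto simp: field_simps)
qed

definition flux_int_grad :: "'a::euclidean_space \<Rightarrow> 'a \<Rightarrow> 'a" where
  "flux_int_grad y x = integral {0..1} (flux_fun_grad y x)"

definition flux_int_hess :: "'a::euclidean_space \<Rightarrow> 'a \<Rightarrow> 'a \<Rightarrow> 'a" where
  "flux_int_hess y x v = integral {0..1} (\<lambda>t. flux_fun_hess y x t v)"

lemma continuous_on_slice:
  assumes "continuous_on (U \<times> T) (\<lambda>(x, t). f x t)" "x \<in> U"
  shows "continuous_on T (f x)"
proof -
  have "continuous_on T (\<lambda>t. (\<lambda>(x, t). f x t) (x, t))"
    by (rule continuous_on_compose2[OF assms(1)]) (use assms(2) in \<open>auto intro!: continuous_intros\<close>)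
  then show ?thesis by simp
qed

lemma flux_fun_grad_integrable: "norm x * norm y < 1 \<Longrightarrow> flux_fun_grad y x integrable_on {0..1}"
  by (intro integrable_continuous_real continuous_on_slice[OF continuous_on_flux_fun_grad, of "{x}"]) auto

lemma flux_fun_hess_integrable: "norm x * norm y < 1 \<Longrightarrow> (\<lambda>t. flux_fun_hess y x t v) integrable_on {0..1}"
  by (intro integrable_continuous_real continuous_on_slice[OF continuous_on_flux_fun_hess, of "{x}"]) auto

lemma flux_int_GDERIV:
  fixes x y :: "'a::euclidean_space"
  assumes "norm x * norm y < 1"
  shows "GDERIV (flux_int y) x :> flux_int_grad y x"
proof -
  obtain r where r: "x \<in> ball 0 r" "\<forall>z\<in>ball (0::'a) r. norm z * norm y < 1"
    using ex_ball_prod_less_1[OF assms] by blast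
  let ?fx = "\<lambda>x t. blinfun_inner_left (flux_fun_grad y x t)"
  have "continuous_on (ball 0 r \<times> cbox 0 1) (\<lambda>w. blinfun_inner_left ((\<lambda>(x, t). flux_fun_grad y x t) w))"
    using continuous_on_flux_fun_grad[of "ball 0 r" y] r(2)
    by (intro bounded_linear.continuous_on[OF bounded_linear_blinfun_inner_left]) auto
  then have "((\<lambda>x. integral (cbox 0 1) (flux_fun y x)) has_derivative blinfun_apply (integral (cbox 0 1) (?fx x)))
      (at x within ball 0 r)"
  proof (intro leibniz_rule[where fx = ?fx])
    fix z :: 'a and t assume zt: "z \<in> ball 0 r" "t \<in> cbox (0::real) 1"
    then have "GDERIV (\<lambda>x. flux_fun y x t) z :> flux_fun_grad y z t" using r(2) by (intro flux_fun_GDERIV) auto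
    then show "((\<lambda>x. flux_fun y x t) has_derivative blinfun_apply (?fx z t)) (at z within ball 0 r)"
      unfolding gderiv_def blinfun_inner_left.rep_eq by (rule has_derivative_at_withinI)
  next
    fix z :: 'a assume "z \<in> ball 0 r"
    then show "flux_fun y z integrable_on cbox 0 1" using r(2) flux_fun_integrable[of z y] by simp
  qed (use r(1) in \<open>auto simp: case_prod_unfold\<close>)
  then have "(flux_int y has_derivative blinfun_apply (integral {0..1} (?fx x))) (at x)"
    using r(1) at_within_open[of x "ball 0 r"] by (simp add: flux_int_def[abs_def])
  moreover have "blinfun_apply (integral {0..1} (?fx x)) = (\<lambda>h. h \<bullet> flux_int_grad y x)"
  proof
    fix h
    have "integral {0..1} (?fx x) = blinfun_inner_left (flux_int_grad y x)"
      unfolding flux_int_grad_def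
      using integral_linear[OF flux_fun_grad_integrable[OF assms] bounded_linear_blinfun_inner_left]
      by (simp add: o_def)
    then show "blinfun_apply (integral {0..1} (?fx x)) h = h \<bullet> flux_int_grad y x" by simp
  qed
  ultimately show ?thesis by (simp add: gderiv_def)
qed

lemma flux_int_grad_has_derivative:
  fixes x y :: "'a::euclidean_space"
  assumes "norm x * norm y < 1"
  shows "(flux_int_grad y has_derivative flux_int_hess y x) (at x)"
proof -
  obtain r where r: "x \<in> ball 0 r" "\<forall>z\<in>ball (0::'a) r. norm z * norm y < 1"
    using ex_ball_prod_less_1[OF assms] by blast
  \<comment> \<open>The Leibniz rule takes derivatives as bounded linear maps; in finite dimension
    their continuity can be checked componentwise.\<close>
  let ?fx = "\<lambda>x t. Blinfun (flux_fun_hess y x t)"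
  have app: "blinfun_apply (?fx z t) = flux_fun_hess y z t" if "norm z * norm y < 1" "t \<in> {0..1}" for z t
    using flux_fun_grad_has_derivative[OF that] has_derivative_bounded_linear bounded_linear_Blinfun_apply by blast
  have "continuous_on (ball 0 r \<times> cbox 0 1) (\<lambda>w. ?fx (fst w) (snd w))"
  proof (rule continuous_on_blinfun_componentwise)
    fix i :: 'a
    have "continuous_on (ball 0 r \<times> cbox 0 1) (\<lambda>w. flux_fun_hess y (fst w) (snd w) i)"
      using continuous_on_flux_fun_hess[of "ball 0 r" y i] r(2) by (auto simp: case_prod_unfold)
    then show "continuous_on (ball 0 r \<times> cbox 0 1) (\<lambda>w. blinfun_apply (?fx (fst w) (snd w)) i)"
      by (rule continuous_on_eq) (use app r(2) in auto)
  qed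
  then have c: "continuous_on (ball 0 r \<times> cbox 0 1) (\<lambda>(x, t). ?fx x t)"
    by (simp add: case_prod_unfold)
  have "((\<lambda>x. integral (cbox 0 1) (flux_fun_grad y x)) has_derivative blinfun_apply (integral (cbox 0 1) (?fx x)))
      (at x within ball 0 r)"
  proof (intro leibniz_rule[where fx = ?fx])
    fix z :: 'a and t assume zt: "z \<in> ball 0 r" "t \<in> cbox (0::real) 1"
    then have "((\<lambda>x. flux_fun_grad y x t) has_derivative flux_fun_hess y z t) (at z)"
      using r(2) by (intro flux_fun_grad_has_derivative) auto
    moreover have "blinfun_apply (?fx z t) = flux_fun_hess y z t" using r(2) zt by (intro app) auto
    ultimately show "((\<lambda>x. flux_fun_grad y x t) has_derivative blinfun_apply (?fx z t)) (at z within ball 0 r)"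
      by (simp add: has_derivative_at_withinI)
  next
    fix z :: 'a assume "z \<in> ball 0 r"
    then show "flux_fun_grad y z integrable_on cbox 0 1" using r(2) flux_fun_grad_integrable[of z y] by simp
  qed (use r(1) c in auto)
  then have D: "(flux_int_grad y has_derivative blinfun_apply (integral {0..1} (?fx x))) (at x)"
    using r(1) at_within_open[of x "ball 0 r"] by (simp add: flux_int_grad_def[abs_def])
  have int: "?fx x integrable_on {0..1}"
    by (intro integrable_continuous_real continuous_on_slice[OF c[simplified] r(1)])
  have "blinfun_apply (integral {0..1} (?fx x)) v = flux_int_hess y x v" for v
  proof -
    have "blinfun_apply (integral {0..1} (?fx x)) v = integral {0..1} (\<lambda>t. blinfun_apply (?fx x t) v)"
      using int by (rule blinfun_apply_integral)
    also have "\<dots> = flux_int_hess y x v"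
      unfolding flux_int_hess_def by (rule integral_cong) (use app assms in auto)
    finally show ?thesis .
  qed
  then have "blinfun_apply (integral {0..1} (?fx x)) = flux_int_hess y x" by (rule ext)
  then show ?thesis using D by simp
qed

lemma continuous_on_flux_int_hess:
  assumes "\<And>x. x \<in> U \<Longrightarrow> norm x * norm y < 1"
  shows "continuous_on U (\<lambda>x. flux_int_hess y x v)"
  unfolding flux_int_hess_def
  using integral_continuous_on_param[of U 0 "1::real" "\<lambda>x t. flux_fun_hess y x t v"] continuous_on_flux_fun_hess[OF assms]
  by simp

lemma trace_flux_int_hess:
  assumes "norm x * norm y < 1"
  shows "(\<Sum>b\<in>Basis. flux_int_hess y x b \<bullet> b) = 0"
proof -
  have "flux_int_hess y x b \<bullet> b = integral {0..1} (\<lambda>t. flux_fun_hess y x t b \<bullet> b)" for b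
    unfolding flux_int_hess_def
    using integral_linear[OF flux_fun_hess_integrable[OF assms, of b] bounded_linear_inner_left[of b]]
    by (simp add: o_def)
  then have "(\<Sum>b\<in>Basis. flux_int_hess y x b \<bullet> b) = (\<Sum>b\<in>Basis. integral {0..1} (\<lambda>t. flux_fun_hess y x t b \<bullet> b))" by simp
  also have "\<dots> = integral {0..1} (\<lambda>t. \<Sum>b\<in>Basis. flux_fun_hess y x t b \<bullet> b)"
    using integrable_linear[OF flux_fun_hess_integrable[OF assms] bounded_linear_inner_left]
    by (intro integral_sum[symmetric]) (auto simp: o_def)
  also have "\<dots> = integral {0..1} (\<lambda>t::real. 0::real)"
    by (rule integral_cong) (use trace_flux_fun_hess[OF assms] in auto)
  finally show ?thesis by simp
qed

text \<open>The radial derivative of the integrand in \<open>x\<close> is the derivative of \<open>kelvin (t *\<^sub>R y) x\<close> in \<open>t\<close>.\<close>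

lemma inner_flux_int_grad:
  fixes x y :: "'a::euclidean_space"
  assumes "norm x * norm y < 1"
  shows "x \<bullet> flux_int_grad y x = kelvin y x - 1"
proof -
  have d: "((\<lambda>t. kelvin (t *\<^sub>R y) x) has_vector_derivative x \<bullet> flux_fun_grad y x t) (at t within {0..1})"
    if "t \<in> {0..1}" for t
  proof -
    have "((\<lambda>t. flux_base y x t) has_real_derivative (2 * t * (y \<bullet> y) * (x \<bullet> x) - 2 * (x \<bullet> y))) (at t)"
      unfolding flux_base_def qf_def by (auto intro!: derivative_eq_intros simp: inner_commute)
    then have "((\<lambda>t. flux_base y x t powr (1 - real DIM('a) / 2)) has_real_derivative
        (1 - real DIM('a) / 2) * flux_base y x t powr (1 - real DIM('a) / 2 - 1) * (2 * t * (y \<bullet> y) * (x \<bullet> x) - 2 * (x \<bullet> y))) (at t)"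
      using has_real_derivative_powr[OF flux_base_pos[OF assms that]] by (rule DERIV_chain2[rotated])
    moreover have "(1 - real DIM('a) / 2) * flux_base y x t powr (1 - real DIM('a) / 2 - 1) * (2 * t * (y \<bullet> y) * (x \<bullet> x) - 2 * (x \<bullet> y)) = x \<bullet> flux_fun_grad y x t"
    proof -
      have "x \<bullet> flux_fun_grad y x t = (2 - real DIM('a)) * flux_base y x t powr (- (real DIM('a) / 2)) *
          (t * (y \<bullet> y) * (x \<bullet> x) - x \<bullet> y)"
        by (simp add: flux_fun_grad_def inner_diff_right)
      then show ?thesis by (simp add: field_simps)
    qed
    ultimately show ?thesis
      by (simp add: kelvin_def qpow_def flux_base_eq has_real_derivative_iff_has_vector_derivative
          has_vector_derivative_at_within)
  qed
  have "((\<lambda>t. x \<bullet> flux_fun_grad y x t) has_integral (kelvin (1 *\<^sub>R y) x - kelvin (0 *\<^sub>R y) x)) {0..1}"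
    by (intro fundamental_theorem_of_calculus d) auto
  moreover have "((\<lambda>t. x \<bullet> flux_fun_grad y x t) has_integral (x \<bullet> flux_int_grad y x)) {0..1}"
    using has_integral_linear[OF integrable_integral[OF flux_fun_grad_integrable[OF assms]] bounded_linear_inner_right[of x]]
    by (simp add: o_def flux_int_grad_def)
  ultimately have "x \<bullet> flux_int_grad y x = kelvin (1 *\<^sub>R y) x - kelvin (0 *\<^sub>R y) x"
    by (rule has_integral_unique[symmetric])
  then show ?thesis by (simp add: kelvin_def qpow_def qf_def)
qed

section \<open>The regular part: harmonicity and boundary flux\<close>

definition regpart_grad :: "'a::euclidean_space \<Rightarrow> 'a \<Rightarrow> 'a" where
  "regpart_grad y x = qgrad (y \<bullet> y) (- y) 1 x + (real DIM('a) - 2) *\<^sub>R flux_int_grad y x"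

definition regpart_hess :: "'a::euclidean_space \<Rightarrow> 'a \<Rightarrow> 'a \<Rightarrow> 'a" where
  "regpart_hess y x v = qhess (y \<bullet> y) (- y) 1 x v + (real DIM('a) - 2) *\<^sub>R flux_int_hess y x v"

lemma regpart_GDERIV:
  assumes "norm x * norm y < 1"
  shows "GDERIV (regpart y) x :> regpart_grad y x"
  unfolding regpart_def[abs_def] regpart_grad_def kelvin_def
  using assms by (intro GDERIV_add GDERIV_cmult GDERIV_qpow flux_int_GDERIV kelvin_base_pos)

lemma regpart_grad_has_derivative:
  assumes "norm x * norm y < 1"
  shows "(regpart_grad y has_derivative regpart_hess y x) (at x)"
  unfolding regpart_grad_def[abs_def] regpart_hess_def[abs_def]
  using assms
  by (intro has_derivative_add has_derivative_scaleR_right qgrad_has_derivative flux_int_grad_has_derivative kelvin_base_pos)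

lemma continuous_on_qhess:
  assumes "\<And>x. x \<in> U \<Longrightarrow> qf p l c x > 0"
  shows "continuous_on U (\<lambda>x. qhess p l c x v)"
  unfolding qhess_def using assms by (intro continuous_intros) (auto simp: less_imp_neq[symmetric])

lemma continuous_on_regpart_hess:
  assumes "\<And>x. x \<in> U \<Longrightarrow> norm x * norm y < 1"
  shows "continuous_on U (\<lambda>x. regpart_hess y x v)"
  unfolding regpart_hess_def using assms kelvin_base_pos
  by (intro continuous_intros continuous_on_flux_int_hess continuous_on_qhess) auto

lemma trace_regpart_hess:
  assumes "norm x * norm y < 1"
  shows "(\<Sum>b\<in>Basis. regpart_hess y x b \<bullet> b) = 0"
proof -
  have "(\<Sum>b\<in>Basis. regpart_hess y x b \<bullet> b) =
      (\<Sum>b\<in>Basis. qhess (y \<bullet> y) (- y) 1 x b \<bullet> b) + (real DIM('a) - 2) * (\<Sum>b\<in>Basis. flux_int_hess y x b \<bullet> b)"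
    by (simp add: regpart_hess_def inner_add_left sum.distrib sum_distrib_left)
  then show ?thesis
    using trace_flux_int_hess[OF assms] trace_qhess[OF kelvin_base_pos[OF assms]] by simp
qed

lemma eventually_prod_less_1:
  assumes "norm (x::'a::euclidean_space) * norm (y::'a) < 1"
  shows "\<forall>\<^sub>F z in nhds x. norm z * norm y < 1"
proof -
  obtain r where r: "x \<in> ball 0 r" "\<forall>z\<in>ball (0::'a) r. norm z * norm y < 1"
    using ex_ball_prod_less_1[OF assms] by blast
  have "\<forall>\<^sub>F z in nhds x. z \<in> ball 0 r" using r by (intro eventually_nhds_in_open) auto
  then show ?thesis by eventually_elim (use r in auto)
qed

lemma has_lap_regpart:
  assumes "norm x * norm y < 1"
  shows "has_lap (regpart y) x 0"
proof -
  have "\<forall>\<^sub>F z in nhds x. GDERIV (regpart y) z :> regpart_grad y z"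
    using eventually_prod_less_1[OF assms] by eventually_elim (rule regpart_GDERIV)
  then show ?thesis
    unfolding has_lap_def using regpart_grad_has_derivative[OF assms] trace_regpart_hess[OF assms]
    by (intro exI[of _ "regpart_grad y"] exI[of _ "regpart_hess y x"]) auto
qed

lemma has_lap_qpow:
  fixes x :: "'a::euclidean_space"
  assumes "qf p l c x > 0"
  shows "has_lap (qpow p l c) x (real DIM('a) * (real DIM('a) - 2) *
           qf p l c x powr (- (real DIM('a) / 2) - 1) * (l \<bullet> l - p * c))"
proof -
  have "\<forall>\<^sub>F z in nhds x. GDERIV (qpow p l c) z :> qgrad p l c z"
    using eventually_qf_pos[OF assms] by eventually_elim (rule GDERIV_qpow)
  then show ?thesis
    unfolding has_lap_def using qgrad_has_derivative[OF assms] trace_qhess[OF assms]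
    by (intro exI[of _ "qgrad p l c"] exI[of _ "qhess p l c x"]) auto
qed

text \<open>The discriminant is \<open>- \<theta>\<close>: for \<open>\<theta> > 0\<close> smoothing
  makes the kernel superharmonic, while \<open>\<theta> = 0\<close> leaves it harmonic off the
  pole.\<close>

lemma has_lap_newton:
  fixes x y :: "'a::euclidean_space"
  assumes "(norm (x - y))\<^sup>2 + \<theta> > 0"
  shows "has_lap (newton \<theta> y) x (- (\<theta> * (real DIM('a) * (real DIM('a) - 2) *
           ((norm (x - y))\<^sup>2 + \<theta>) powr (- (real DIM('a) / 2) - 1))))"
proof -
  have "(- y) \<bullet> (- y) - 1 * (y \<bullet> y + \<theta>) = - \<theta>" by simp
  then show ?thesis
    using has_lap_qpow[of 1 "- y" "y \<bullet> y + \<theta>" x] assms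
    unfolding newton_base newton_def by (simp only: mult_ac mult_minus_right mult_minus_left)
qed

text \<open>On the sphere the Kelvin base equals the squared distance to \<open>y\<close>, so image
  and Newton kernel share the factor \<open>e\<close>. The term with this factor is the negative of
  the flux of \<open>newton 0 y\<close>; adding the two leaves the constant flux
  \<open>n - 2\<close>.\<close>

lemma inward_deriv_regpart:
  fixes x y :: "'a::euclidean_space"
  assumes "norm x = 1" "norm y < 1"
  shows "inward_deriv (regpart y) x ((real DIM('a) - 2) * (1 - ((norm (x - y))\<^sup>2) powr (- (real DIM('a) / 2)) * (1 - x \<bullet> y)))"
proof -
  have p: "norm x * norm y < 1" using assms by simp
  have Q: "qf (y \<bullet> y) (- y) 1 x = (norm (x - y))\<^sup>2"
    using assms by (simp add: qf_def power2_norm_eq_inner algebra_simps inner_commute norm_eq_1)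
  have xx: "x \<bullet> x = 1" using assms by (simp add: norm_eq_1)
  define d where "d = (norm (x - y))\<^sup>2"
  define e where "e = d powr (- (real DIM('a) / 2))"
  have "d > 0" using assms by (auto simp: d_def)
  then have "d powr (1 - real DIM('a) / 2) = e * d"
    using powr_add[of d "- (real DIM('a) / 2)" 1] by (simp add: e_def)
  then have im: "kelvin y x = e * d"
    unfolding kelvin_def qpow_def Q d_def[symmetric] .
  have dd: "d = 1 - 2 * (x \<bullet> y) + y \<bullet> y"
    using xx by (simp add: d_def power2_norm_eq_inner algebra_simps inner_commute)
  have "x \<bullet> regpart_grad y x = (2 - real DIM('a)) * e * (y \<bullet> y - x \<bullet> y) + (real DIM('a) - 2) * (e * d - 1)"
    unfolding regpart_grad_def qgrad_def Q d_def[symmetric] e_def[symmetric]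
    by (simp add: inner_add_right inner_diff_right inner_flux_int_grad[OF p] xx im)
  also have "\<dots> = - ((real DIM('a) - 2) * (1 - e * (1 - x \<bullet> y)))"
    unfolding dd by (simp add: algebra_simps)
  finally show ?thesis using GDERIV_imp_inward_deriv[OF regpart_GDERIV[OF p]] by (simp add: e_def d_def)
qed

lemma inward_deriv_newton:
  fixes x y :: "'a::euclidean_space"
  assumes "norm x = 1" "(norm (x - y))\<^sup>2 + \<theta> > 0"
  shows "inward_deriv (newton \<theta> y) x ((real DIM('a) - 2) * (((norm (x - y))\<^sup>2 + \<theta>) powr (- (real DIM('a) / 2)) * (1 - x \<bullet> y)))"
proof -
  have Q: "qf 1 (- y) (y \<bullet> y + \<theta>) x > 0" using assms by (simp add: newton_base)
  have "x \<bullet> x = 1" using assms by (simp add: norm_eq_1)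
  then have "x \<bullet> qgrad 1 (- y) (y \<bullet> y + \<theta>) x =
      - ((real DIM('a) - 2) * (((norm (x - y))\<^sup>2 + \<theta>) powr (- (real DIM('a) / 2)) * (1 - x \<bullet> y)))"
    unfolding qgrad_def newton_base by (simp add: algebra_simps)
  then show ?thesis using GDERIV_imp_inward_deriv[OF GDERIV_qpow[OF Q]] by (simp add: newton_def)
qed

section \<open>Sweeping to finitely supported measures\<close>

text \<open>Finitely supported probability measures on \<open>K\<close>. They replace swept
  measures, so that integrals against these become finite sums.\<close>

definition weights :: "'b set \<Rightarrow> 'b set \<Rightarrow> ('b \<Rightarrow> real) \<Rightarrow> bool" where
  "weights K S p \<longleftrightarrow> finite S \<and> S \<subseteq> K \<and> (\<forall>x\<in>S. 0 \<le> p x) \<and> sum p S = 1"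

definition avg :: "'b set \<Rightarrow> ('b \<Rightarrow> real) \<Rightarrow> ('b \<Rightarrow> real) \<Rightarrow> real" where
  "avg S p f = (\<Sum>x\<in>S. p x * f x)"

lemma avg_add: "avg S p (\<lambda>x. f x + g x) = avg S p f + avg S p g"
  by (simp add: avg_def distrib_left sum.distrib)

lemma avg_diff: "avg S p (\<lambda>x. f x - g x) = avg S p f - avg S p g"
  by (simp add: avg_def right_diff_distrib sum_subtractf)

lemma avg_cmult: "avg S p (\<lambda>x. c * f x) = c * avg S p f"
  by (simp add: avg_def sum_distrib_left mult_ac)

lemma avg_const: "weights K S p \<Longrightarrow> avg S p (\<lambda>x. c) = c"
  by (simp add: avg_def weights_def sum_distrib_right[symmetric])

lemma avg_mono:
  assumes "weights K S p" "\<And>x. x \<in> K \<Longrightarrow> f x \<le> g x"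
  shows "avg S p f \<le> avg S p g"
  unfolding avg_def using assms by (intro sum_mono mult_left_mono) (auto simp: weights_def)

lemma weights_mix:
  assumes w: "weights K S p" and x: "x \<in> K" and t: "0 \<le> t" "t \<le> 1"
  shows "\<exists>S' p'. weights K S' p' \<and> (\<forall>f. avg S' p' f = (1 - t) * avg S p f + t * f x)"
proof -
  \<comment> \<open>If \<open>x\<close> already lies in \<open>S\<close>, both summands
    contribute.\<close>
  define p' where "p' z = (1 - t) * (if z \<in> S then p z else 0) + (if z = x then t else 0)" for z
  have fin: "finite S" using w by (simp add: weights_def)
  have av: "avg (insert x S) p' f = (1 - t) * avg S p f + t * f x" for f
  proof -
    have "avg (insert x S) p' f = (\<Sum>z\<in>insert x S. (1 - t) * ((if z \<in> S then p z else 0) * f z)) +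
        (\<Sum>z\<in>insert x S. if z = x then t * f x else 0)"
      unfolding avg_def p'_def sum.distrib[symmetric] by (rule sum.cong) (auto simp: algebra_simps)
    also have "(\<Sum>z\<in>insert x S. (1 - t) * ((if z \<in> S then p z else 0) * f z)) =
        (\<Sum>z\<in>S. (1 - t) * (p z * f z))"
      using fin by (intro sum.mono_neutral_cong_right) auto
    also have "(\<Sum>z\<in>insert x S. if z = x then t * f x else 0) = t * f x"
      using fin by simp
    finally show ?thesis by (simp add: avg_def sum_distrib_left)
  qed
  have "sum p' (insert x S) = 1"
    using av[of "\<lambda>_. 1"] avg_const[OF w, of 1] by (simp add: avg_def)
  then have "weights K (insert x S) p'"
    using w x t by (auto simp: weights_def p'_def)
  then show ?thesis using av by blast
qed

text \<open>Frank--Wolfe descent for the sum of the squared violations: at a near-minimiser with positive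
  value, the violations themselves are the weights for which the hypothesis yields a descent direction.\<close>

lemma finite_minimax:
  fixes H :: "('b \<Rightarrow> real) set"
  assumes fin: "finite H" and B: "\<And>h x. h \<in> H \<Longrightarrow> x \<in> K \<Longrightarrow> \<bar>h x - \<beta> h\<bar> \<le> B"
    and c: "\<And>c. (\<And>h. h \<in> H \<Longrightarrow> 0 \<le> c h) \<Longrightarrow> \<exists>x\<in>K. (\<Sum>h\<in>H. c h * (h x - \<beta> h)) \<le> 0"
    and \<epsilon>: "\<epsilon> > 0"
  shows "\<exists>S p. weights K S p \<and> (\<forall>h\<in>H. avg S p h \<le> \<beta> h + \<epsilon>)"
proof (rule ccontr)
  assume contra: "\<not> ?thesis"
  \<comment> \<open>Only excesses are penalised; being nonnegative, they can be inserted as the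
    coefficients \<open>c\<close> of the hypothesis.\<close>
  define e where "e S p h = max 0 (avg S p h - \<beta> h)" for S p h
  define \<Phi> where "\<Phi> S p = (\<Sum>h\<in>H. (e S p h)\<^sup>2)" for S p
  define V where "V = {\<Phi> S p | S p. weights K S p}"
  have big: "\<Phi> S p \<ge> \<epsilon>\<^sup>2" if w: "weights K S p" for S p
  proof -
    obtain h where h: "h \<in> H" "avg S p h > \<beta> h + \<epsilon>" using contra w by force
    then have "e S p h \<ge> \<epsilon>" by (simp add: e_def)
    then have "(e S p h)\<^sup>2 \<ge> \<epsilon>\<^sup>2" using \<epsilon> by (simp add: power_mono)
    also have "(e S p h)\<^sup>2 \<le> \<Phi> S p" unfolding \<Phi>_def using fin h(1) by (intro member_le_sum) auto
    finally show ?thesis .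
  qed
  obtain x0 where x0: "x0 \<in> K" using c[of "\<lambda>_. 0"] by auto
  have "weights K {x0} (\<lambda>_. 1)" using x0 by (simp add: weights_def)
  then have Vne: "V \<noteq> {}" unfolding V_def by blast
  have bdd: "bdd_below V" using big unfolding V_def by (auto intro!: bdd_belowI[of _ "\<epsilon>\<^sup>2"])
  define I where "I = Inf V"
  have I: "I \<ge> \<epsilon>\<^sup>2" unfolding I_def using big Vne by (intro cInf_greatest) (auto simp: V_def)
  have I0: "I > 0" using I \<epsilon> by (smt (verit) zero_less_power)
  have eB: "(e S p h)\<^sup>2 \<le> B\<^sup>2" if w: "weights K S p" and h: "h \<in> H" for S p h
  proof -
    have "avg S p h \<le> avg S p (\<lambda>_. \<beta> h + B)"
      using B[OF h] by (intro avg_mono[OF w]) (force simp: abs_le_iff)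
    then have "avg S p h - \<beta> h \<le> B" by (simp add: avg_const[OF w])
    moreover have "0 \<le> B" using B[OF h x0] by simp
    ultimately have "0 \<le> e S p h" "e S p h \<le> B" by (auto simp: e_def)
    then show ?thesis by (simp add: power_mono)
  qed
  \<comment> \<open>\<open>C / 2\<close> bounds both \<open>\<Phi>\<close> and the quadratic error
    of a step; together they produce the term \<open>t\<^sup>2 * C\<close>.\<close>
  define C where "C = 2 * (real (card H) * B\<^sup>2)"
  have \<Phi>C: "\<Phi> S p \<le> C / 2" if "weights K S p" for S p
    using sum_bounded_above[of H "\<lambda>h. (e S p h)\<^sup>2" "B\<^sup>2"] eB[OF that] by (simp add: \<Phi>_def C_def)
  \<comment> \<open>The gap \<open>I\<^sup>2 / C\<close> is the gain guaranteed for the step below,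
    so a single step from such a near-minimiser falls under the infimum.\<close>
  have "\<exists>v\<in>V. v < I + I\<^sup>2 / C" 
  proof (rule cInf_lessD[OF Vne])
    have "C > 0" using \<Phi>C[of "{x0}" "\<lambda>_. 1"] big[of "{x0}" "\<lambda>_. 1"] x0 \<epsilon>
      by (simp add: weights_def) (smt (verit) zero_less_power)
    then show "Inf V < I + I\<^sup>2 / C" using I0 by (simp add: I_def)
  qed
  then obtain S p where w: "weights K S p" and near: "\<Phi> S p < I + I\<^sup>2 / C" unfolding V_def by blast
  have IP: "I \<le> \<Phi> S p" unfolding I_def using w bdd by (intro cInf_lower) (auto simp: V_def)
  have C0: "C > 0" using I0 IP \<Phi>C[OF w] by simp
  obtain x where x: "x \<in> K" "(\<Sum>h\<in>H. e S p h * (h x - \<beta> h)) \<le> 0"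
    using c[of "e S p"] by (auto simp: e_def)
  \<comment> \<open>This value minimises \<open>- 2 * t * I + t\<^sup>2 * C\<close>, with minimum
    \<open>- I\<^sup>2 / C\<close>.\<close>
  define t where "t = I / C"
  have t: "0 < t" "t \<le> 1" using I0 C0 IP \<Phi>C[OF w] by (auto simp: t_def)
  obtain S' p' where w': "weights K S' p'" and av: "\<And>f. avg S' p' f = (1 - t) * avg S p f + t * f x"
    using weights_mix[OF w x(1), of t] t by auto
  have step: "(e S' p' h)\<^sup>2 \<le> (1 - t)\<^sup>2 * (e S p h)\<^sup>2 + 2 * t * (1 - t) * (e S p h * (h x - \<beta> h)) + t\<^sup>2 * B\<^sup>2"
    if h: "h \<in> H" for h
  proof -
    let ?u = "(1 - t) * e S p h + t * (h x - \<beta> h)"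
    have "avg S' p' h - \<beta> h = (1 - t) * (avg S p h - \<beta> h) + t * (h x - \<beta> h)"
      by (simp add: av algebra_simps)
    also have "\<dots> \<le> ?u" using t by (intro add_right_mono mult_left_mono) (auto simp: e_def)
    finally have "e S' p' h \<le> max 0 ?u" by (simp add: e_def)
    then have "(e S' p' h)\<^sup>2 \<le> (max 0 ?u)\<^sup>2" by (intro power_mono) (auto simp: e_def)
    also have "\<dots> \<le> ?u\<^sup>2" by (simp add: max_def)
    also have "?u\<^sup>2 = (1 - t)\<^sup>2 * (e S p h)\<^sup>2 + 2 * t * (1 - t) * (e S p h * (h x - \<beta> h)) + t\<^sup>2 * (h x - \<beta> h)\<^sup>2"
      by (simp add: power2_eq_square algebra_simps)
    also have "(h x - \<beta> h)\<^sup>2 \<le> B\<^sup>2" using B[OF h x(1)] by (metis abs_ge_zero power2_abs power_mono)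
    finally show ?thesis by (simp add: mult_left_mono)
  qed
  have "\<Phi> S' p' \<le> (\<Sum>h\<in>H. (1 - t)\<^sup>2 * (e S p h)\<^sup>2 + 2 * t * (1 - t) * (e S p h * (h x - \<beta> h)) + t\<^sup>2 * B\<^sup>2)"
    unfolding \<Phi>_def by (intro sum_mono step)
  also have "\<dots> = (1 - t)\<^sup>2 * \<Phi> S p + 2 * t * (1 - t) * (\<Sum>h\<in>H. e S p h * (h x - \<beta> h)) + t\<^sup>2 * (C / 2)"
    by (simp add: sum.distrib sum_distrib_left \<Phi>_def C_def mult_ac)
  also have "\<dots> \<le> (1 - t)\<^sup>2 * \<Phi> S p + t\<^sup>2 * (C / 2)"
    using t x(2) by (simp add: mult_nonneg_nonpos)
  also have "\<dots> = \<Phi> S p - 2 * t * \<Phi> S p + t\<^sup>2 * \<Phi> S p + t\<^sup>2 * (C / 2)"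
    by (simp add: power2_eq_square algebra_simps)
  also have "\<dots> \<le> \<Phi> S p - 2 * t * I + t\<^sup>2 * (C / 2) + t\<^sup>2 * (C / 2)"
    using IP \<Phi>C[OF w] t by (intro add_mono diff_mono mult_left_mono) auto
  also have "\<dots> = \<Phi> S p - I\<^sup>2 / C"
    using C0 by (simp add: t_def power2_eq_square field_simps)
  also have "\<dots> < I" using near by simp
  finally have "\<Phi> S' p' < I" .
  moreover have "I \<le> \<Phi> S' p'" unfolding I_def using w' bdd by (intro cInf_lower) (auto simp: V_def)
  ultimately show False by simp
qed

section \<open>Sweeping a point mass against finite and totally bounded families\<close>

lemma finite_uniform_bound:
  assumes "finite H" "compact C" "\<And>h. h \<in> H \<Longrightarrow> continuous_on C h"
  shows "\<exists>B. \<forall>h\<in>H. \<forall>x\<in>C. \<bar>h x\<bar> \<le> (B::real)"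
  using assms(1,3)
proof (induction H rule: finite_induct)
  case (insert h H)
  then obtain B where B: "\<forall>h\<in>H. \<forall>x\<in>C. \<bar>h x\<bar> \<le> B" by auto
  have "bounded (h ` C)" using insert.prems assms(2) by (intro compact_imp_bounded compact_continuous_image) auto
  then obtain A where "\<forall>x\<in>C. \<bar>h x\<bar> \<le> A" unfolding bounded_iff by auto
  then show ?case using B by (intro exI[of _ "max A B"]) (auto simp: le_max_iff_disj)
qed auto

text \<open>A nonnegative combination \<open>f\<close> of the functions \<open>h x - h a\<close> is
  a supersolution vanishing at \<open>a\<close>. Were it positive on the compact set
  \<open>K\<close>, the minimum principle would make it positive at \<open>a\<close>. This is the
  hypothesis of \<open>finite_minimax\<close>.\<close>

lemma sweep_finite:
  assumes cell: "cell C K a" and P: "barrier C K a P" and a: "a \<in> C"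
    and H: "finite H" "\<And>h. h \<in> H \<Longrightarrow> supersol C K a h" and \<epsilon>: "\<epsilon> > 0"
  shows "\<exists>S p. weights K S p \<and> (\<forall>h\<in>H. avg S p h \<le> h a + \<epsilon>)"
proof -
  have C: "compact C" "compact K" "K \<subseteq> C" using cell by (auto simp: cell_def)
  have cont: "continuous_on C h" if "h \<in> H" for h using H(2)[OF that] by (simp add: supersol_def)
  obtain B where B: "\<And>h x. h \<in> H \<Longrightarrow> x \<in> C \<Longrightarrow> \<bar>h x\<bar> \<le> B"
    using finite_uniform_bound[OF H(1) C(1) cont] by blast
  show ?thesis
  proof (rule finite_minimax[where B = "2 * B", OF H(1) _ _ \<epsilon>])
    fix h x assume "h \<in> H" "x \<in> K"
    then have "\<bar>h x\<bar> \<le> B" "\<bar>h a\<bar> \<le> B" using B a C by auto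
    then show "\<bar>h x - h a\<bar> \<le> 2 * B" by (simp add: abs_le_iff)
  next
    fix c :: "('a \<Rightarrow> real) \<Rightarrow> real" assume c: "\<And>h. h \<in> H \<Longrightarrow> 0 \<le> c h"
    define f where "f x = (\<Sum>h\<in>H. c h * h x + c h * (- h a))" for x
    have f: "supersol C K a f"
      unfolding f_def using c H(2) by (intro supersol_sum supersol_add supersol_cmult supersol_const) auto
    have f_eq: "f x = (\<Sum>h\<in>H. c h * (h x - h a))" for x by (simp add: f_def algebra_simps)
    show "\<exists>x\<in>K. (\<Sum>h\<in>H. c h * (h x - h a)) \<le> 0"
    proof (rule ccontr)
      assume "\<not> ?thesis"
      then have pos: "f x > 0" if "x \<in> K" for x using that f_eq by force
      have "continuous_on K f" using f C by (auto simp: supersol_def intro: continuous_on_subset)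
      \<comment> \<open>For \<open>K = {}\<close> any \<open>m > 0\<close> is vacuously a lower
        bound, and the minimum principle gives the same contradiction.\<close>
      then have "\<exists>m>0. \<forall>x\<in>K. f x \<ge> m"
        using continuous_attains_inf[OF C(2), of f] pos by (cases "K = {}") (auto intro: exI[of _ 1])
      then obtain m where m: "m > 0" "\<And>x. x \<in> K \<Longrightarrow> f x \<ge> m" by blast
      have "f a \<ge> m" by (rule minimum_principle[OF cell f P m(2) a])
      then show False using m(1) by (simp add: f_eq)
    qed
  qed
qed

text \<open>Total boundedness in the uniform norm on \<open>C\<close>: the form of compactness that
  lets one measure serve all poles of a kernel at once.\<close>

definition tot_bdd :: "'b set \<Rightarrow> ('b \<Rightarrow> real) set \<Rightarrow> bool" where
  "tot_bdd C H \<longleftrightarrow> (\<forall>\<epsilon>>0. \<exists>F. finite F \<and> F \<subseteq> H \<and> (\<forall>h\<in>H. \<exists>f\<in>F. \<forall>x\<in>C. \<bar>h x - f x\<bar> \<le> \<epsilon>))"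

lemma tot_bddD:
  assumes "tot_bdd C H" "\<epsilon> > 0"
  shows "\<exists>F. finite F \<and> F \<subseteq> H \<and> (\<forall>h\<in>H. \<exists>f\<in>F. \<forall>x\<in>C. \<bar>h x - f x\<bar> \<le> \<epsilon>)"
  using assms unfolding tot_bdd_def by simp

lemma tot_bdd_finite: "finite H \<Longrightarrow> tot_bdd C H"
  unfolding tot_bdd_def by (intro allI impI exI[of _ H]) force

lemma tot_bdd_Un:
  assumes "tot_bdd C H" "tot_bdd C H'"
  shows "tot_bdd C (H \<union> H')"
  unfolding tot_bdd_def
proof (intro allI impI)
  fix \<epsilon> :: real assume \<epsilon>: "\<epsilon> > 0"
  obtain F where F: "finite F" "F \<subseteq> H" "\<forall>h\<in>H. \<exists>f\<in>F. \<forall>x\<in>C. \<bar>h x - f x\<bar> \<le> \<epsilon>"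
    using tot_bddD[OF assms(1) \<epsilon>] by blast
  obtain F' where "finite F'" "F' \<subseteq> H'" "\<forall>h\<in>H'. \<exists>f\<in>F'. \<forall>x\<in>C. \<bar>h x - f x\<bar> \<le> \<epsilon>"
    using tot_bddD[OF assms(2) \<epsilon>] by blast
  with F show "\<exists>F. finite F \<and> F \<subseteq> H \<union> H' \<and> (\<forall>h\<in>H \<union> H'. \<exists>f\<in>F. \<forall>x\<in>C. \<bar>h x - f x\<bar> \<le> \<epsilon>)"
    by (intro exI[of _ "F \<union> F'"]) blast
qed

lemma tot_bdd_family:
  fixes F :: "'b::metric_space \<Rightarrow> 'c::metric_space \<Rightarrow> real"
  assumes C: "compact C" and Y: "compact Y" and cont: "continuous_on (C \<times> Y) (\<lambda>w. F (fst w) (snd w))"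
  shows "tot_bdd C ((\<lambda>y x. F x y) ` Y)"
  unfolding tot_bdd_def
proof (intro allI impI)
  fix \<epsilon> :: real assume \<epsilon>: "\<epsilon> > 0"
  have "uniformly_continuous_on (C \<times> Y) (\<lambda>w. F (fst w) (snd w))"
    using C Y by (intro compact_uniformly_continuous[OF cont] compact_Times)
  then obtain d where d: "d > 0" "\<And>w w'. w \<in> C \<times> Y \<Longrightarrow> w' \<in> C \<times> Y \<Longrightarrow> dist w' w < d \<Longrightarrow>
      dist (F (fst w') (snd w')) (F (fst w) (snd w)) < \<epsilon>"
    using \<epsilon> unfolding uniformly_continuous_on_def by metis
  obtain k where k: "finite k" "k \<subseteq> Y" "Y \<subseteq> (\<Union>y\<in>k. ball y d)"
    using seq_compact_imp_totally_bounded[of Y] Y d(1) by (auto simp: compact_eq_seq_compact_metric)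
  show "\<exists>G. finite G \<and> G \<subseteq> (\<lambda>y x. F x y) ` Y \<and> (\<forall>h\<in>(\<lambda>y x. F x y) ` Y. \<exists>f\<in>G. \<forall>x\<in>C. \<bar>h x - f x\<bar> \<le> \<epsilon>)"
  proof (intro exI[of _ "(\<lambda>y x. F x y) ` k"] conjI ballI)
    fix h assume "h \<in> (\<lambda>y x. F x y) ` Y"
    then obtain y where y: "y \<in> Y" "h = (\<lambda>x. F x y)" by blast
    then obtain z where z: "z \<in> k" "dist z y < d" using k(3) by auto
    have "\<bar>h x - F x z\<bar> \<le> \<epsilon>" if "x \<in> C" for x
      using d(2)[of "(x, z)" "(x, y)"] that y z k(2) by (auto simp: dist_Pair_Pair dist_commute dist_real_def)
    then show "\<exists>f\<in>(\<lambda>y x. F x y) ` k. \<forall>x\<in>C. \<bar>h x - f x\<bar> \<le> \<epsilon>" using z(1) by (intro bexI[of _ "\<lambda>x. F x z"]) auto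
  qed (use k in auto)
qed

text \<open>A finite net of mesh \<open>\<epsilon> / 3\<close> reduces this to the finite case. One
  third is spent there, the other two on replacing \<open>h\<close> by a member of the net under the
  average and at \<open>a\<close>.\<close>

lemma sweep:
  assumes cell: "cell C K a" and P: "barrier C K a P" and a: "a \<in> C"
    and H: "tot_bdd C H" "\<And>h. h \<in> H \<Longrightarrow> supersol C K a h" and \<epsilon>: "\<epsilon> > 0"
  shows "\<exists>S p. weights K S p \<and> (\<forall>h\<in>H. avg S p h \<le> h a + \<epsilon>)"
proof -
  have C: "K \<subseteq> C" using cell by (auto simp: cell_def)
  obtain F where F: "finite F" "F \<subseteq> H" "\<forall>h\<in>H. \<exists>f\<in>F. \<forall>x\<in>C. \<bar>h x - f x\<bar> \<le> \<epsilon> / 3"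
    using tot_bddD[OF H(1), of "\<epsilon> / 3"] \<epsilon> by auto
  obtain S p where S: "weights K S p" "\<forall>f\<in>F. avg S p f \<le> f a + \<epsilon> / 3"
    using sweep_finite[OF cell P a F(1), of "\<epsilon> / 3"] F(2) H(2) \<epsilon> by auto
  have "avg S p h \<le> h a + \<epsilon>" if "h \<in> H" for h
  proof -
    obtain f where f: "f \<in> F" "\<forall>x\<in>C. \<bar>h x - f x\<bar> \<le> \<epsilon> / 3" using F(3) \<open>h \<in> H\<close> by blast
    have "avg S p h \<le> avg S p (\<lambda>x. f x + \<epsilon> / 3)"
    proof (rule avg_mono[OF S(1)])
      fix x assume "x \<in> K"
      then have "\<bar>h x - f x\<bar> \<le> \<epsilon> / 3" using f(2) C by blast
      then show "h x \<le> f x + \<epsilon> / 3" by linarith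
    qed
    also have "\<dots> = avg S p f + \<epsilon> / 3" by (simp add: avg_add avg_const[OF S(1)])
    also have "\<dots> \<le> f a + \<epsilon> / 3 + \<epsilon> / 3" using bspec[OF S(2) f(1)] by linarith
    also have "f a \<le> h a + \<epsilon> / 3" using f(2)[rule_format, OF a] by linarith
    finally show ?thesis by simp
  qed
  then show ?thesis using S(1) by blast
qed

section \<open>Positive definiteness\<close>

definition qform :: "'b set \<Rightarrow> ('b \<Rightarrow> real) \<Rightarrow> ('b \<Rightarrow> 'b \<Rightarrow> real) \<Rightarrow> real" where
  "qform T c K = (\<Sum>x\<in>T. \<Sum>y\<in>T. c x * c y * K x y)"

lemma qform_cong: "(\<And>x y. x \<in> T \<Longrightarrow> y \<in> T \<Longrightarrow> K x y = L x y) \<Longrightarrow> qform T c K = qform T c L"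
  by (simp add: qform_def)

lemma qform_add: "qform T c (\<lambda>x y. K x y + L x y) = qform T c K + qform T c L"
  by (simp add: qform_def distrib_left sum.distrib)

lemma qform_diff: "qform T c (\<lambda>x y. K x y - L x y) = qform T c K - qform T c L"
  by (simp add: qform_def right_diff_distrib sum_subtractf)

lemma qform_cmult: "qform T c (\<lambda>x y. a * K x y) = a * qform T c K"
  by (simp add: qform_def sum_distrib_left mult_ac)

lemma qform_sum: "qform T c (\<lambda>x y. \<Sum>i\<in>I. K i x y) = (\<Sum>i\<in>I. qform T c (K i))"
proof (induction I rule: infinite_finite_induct)
  case (insert i I)
  then show ?case by (simp add: qform_add)
qed (simp_all add: qform_def)

lemma qform_const: "qform T c (\<lambda>x y. a) = a * (sum c T)\<^sup>2"
  by (simp add: qform_def power2_eq_square sum_product sum_distrib_left mult_ac)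

lemma qform_scale: "qform T c (\<lambda>x y. g x * g y * K x y) = qform T (\<lambda>x. c x * g x) K"
  by (simp add: qform_def mult_ac)

text \<open>A case of the Schur product theorem: one factor \<open>x \<bullet> y\<close> is split
  over the basis into rank-one kernels, which are absorbed into the coefficients. Hence the
  induction is over arbitrary \<open>c\<close>.\<close>

lemma qform_inner_power_nonneg:
  fixes T :: "'a::euclidean_space set"
  shows "0 \<le> qform T c (\<lambda>x y. (x \<bullet> y) ^ k)"
proof (induction k arbitrary: c)
  case 0
  show ?case by (simp add: qform_const)
next
  case (Suc k)
  have "qform T c (\<lambda>x y. (x \<bullet> y) ^ Suc k) =
      qform T c (\<lambda>x y. \<Sum>b\<in>Basis. (x \<bullet> b) * (y \<bullet> b) * (x \<bullet> y) ^ k)"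
    by (intro qform_cong) (simp add: euclidean_inner[symmetric] sum_distrib_right[symmetric])
  also have "\<dots> = (\<Sum>b\<in>Basis. qform T (\<lambda>x. c x * (x \<bullet> b)) (\<lambda>x y. (x \<bullet> y) ^ k))"
    by (simp add: qform_sum qform_scale)
  also have "\<dots> \<ge> 0" by (intro sum_nonneg Suc)
  finally show ?case .
qed

text \<open>The exponential series has nonnegative coefficients, and a limit of nonnegative forms is
  nonnegative.\<close>

lemma qform_exp_inner_nonneg:
  fixes T :: "'a::euclidean_space set"
  assumes "\<kappa> \<ge> 0"
  shows "0 \<le> qform T c (\<lambda>x y. exp (\<kappa> * (x \<bullet> y)))"
proof (rule LIMSEQ_le_const)
  show "(\<lambda>m. qform T c (\<lambda>x y. \<Sum>k<m. (\<kappa> ^ k / fact k) * (x \<bullet> y) ^ k)) \<longlonglongrightarrow>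
      qform T c (\<lambda>x y. exp (\<kappa> * (x \<bullet> y)))"
    unfolding qform_def
  proof (intro tendsto_intros)
    fix x y :: 'a
    show "(\<lambda>m. \<Sum>k<m. (\<kappa> ^ k / fact k) * (x \<bullet> y) ^ k) \<longlonglongrightarrow> exp (\<kappa> * (x \<bullet> y))"
      using exp_converges[of "\<kappa> * (x \<bullet> y)"]
      by (simp add: sums_def power_mult_distrib divide_inverse mult_ac)
  qed
  have "0 \<le> qform T c (\<lambda>x y. \<Sum>k<m. (\<kappa> ^ k / fact k) * (x \<bullet> y) ^ k)" for m
    unfolding qform_sum qform_cmult
    using assms by (intro sum_nonneg mult_nonneg_nonneg qform_inner_power_nonneg) auto
  then show "\<exists>N. \<forall>m\<ge>N. 0 \<le> qform T c (\<lambda>x y. \<Sum>k<m. (\<kappa> ^ k / fact k) * (x \<bullet> y) ^ k)" by blast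
qed

section \<open>Negative powers as integrals of positive definite exponentials\<close>

lemma qform_integral_nonneg:
  assumes "finite T" "\<And>x y. x \<in> T \<Longrightarrow> y \<in> T \<Longrightarrow> ((\<lambda>t. k t x y) has_integral K x y) A"
    and "\<And>t. t \<in> A \<Longrightarrow> 0 \<le> qform T c (k t)"
  shows "0 \<le> qform T c K"
proof (rule has_integral_nonneg)
  show "((\<lambda>t. qform T c (k t)) has_integral qform T c K) A"
    unfolding qform_def using assms(1,2) by (intro has_integral_sum has_integral_mult_right) auto
qed (use assms(3) in auto)

text \<open>The substitution of \<open>E * t\<close> for \<open>t\<close> in the Gamma integral. It
  exhibits a negative power of \<open>E\<close> as a superposition of exponentials in
  \<open>E\<close>.\<close>

lemma Gamma_integral_scaled:
  assumes \<alpha>: "\<alpha> > 0" and E: "E > (0::real)"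
  shows "((\<lambda>t. t powr (\<alpha> - 1) * exp (- (t * E))) has_integral Gamma \<alpha> * E powr (- \<alpha>)) {0..}"
proof -
  let ?f = "\<lambda>t::real. t powr (\<alpha> - 1) / exp t"
  have f: "(?f has_integral Gamma \<alpha>) {0..}" by (rule Gamma_integral_real[OF \<alpha>])
  have abs: "?f absolutely_integrable_on {0..}"
    using f by (intro nonnegative_absolutely_integrable_1) (auto simp: integrable_on_def)
  have kelvin: "(\<lambda>t. E * t) ` {0..} = {0..}"
  proof
    show "{0..} \<subseteq> (\<lambda>t. E * t) ` {0..}"
    proof
      fix y :: real assume "y \<in> {0..}"
      then show "y \<in> (\<lambda>t. E * t) ` {0..}" using E by (intro image_eqI[of _ _ "y / E"]) auto
    qed
  qed (use E in auto)
  have "(\<lambda>x. \<bar>E\<bar> * ?f (E * x)) absolutely_integrable_on {0..} \<and>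
      integral {0..} (\<lambda>x. \<bar>E\<bar> * ?f (E * x)) = Gamma \<alpha>"
  proof (subst has_absolute_integral_change_of_variables_1'[where g = "\<lambda>t. E * t"])
    show "?f absolutely_integrable_on (\<lambda>t. E * t) ` {0..} \<and> integral ((\<lambda>t. E * t) ` {0..}) ?f = Gamma \<alpha>"
      unfolding kelvin using abs f by (simp add: integral_unique)
  qed (use E in \<open>auto intro!: derivative_eq_intros simp: inj_on_def\<close>)
  then have "((\<lambda>x. \<bar>E\<bar> * ?f (E * x)) has_integral Gamma \<alpha>) {0..}"
    using absolutely_integrable_on_def has_integral_iff by blast
  then have "((\<lambda>x. E powr (- \<alpha>) * (\<bar>E\<bar> * ?f (E * x))) has_integral E powr (- \<alpha>) * Gamma \<alpha>) {0..}"
    by (rule has_integral_mult_right)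
  moreover have "E powr (- \<alpha>) * (\<bar>E\<bar> * ?f (E * x)) = x powr (\<alpha> - 1) * exp (- (x * E))" if "x \<in> {0..}" for x
  proof -
    have "E powr (- \<alpha>) * E * E powr (\<alpha> - 1) = 1"
      using E powr_add[of E "- \<alpha>" 1] powr_add[of E "- \<alpha> + 1" "\<alpha> - 1"] by simp
    then have "E powr (- \<alpha>) * (E * (E powr (\<alpha> - 1) * z)) = z" for z
      by (metis mult.assoc mult.left_neutral)
    then show ?thesis using E that by (simp add: powr_mult exp_minus field_simps)
  qed
  ultimately have "((\<lambda>x. x powr (\<alpha> - 1) * exp (- (x * E))) has_integral E powr (- \<alpha>) * Gamma \<alpha>) {0..}"
    by (rule has_integral_eq[rotated])
  then show ?thesis by (simp only: mult.commute)
qed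

text \<open>Under the Gamma integral each exponential of the base splits into a function of
  \<open>x\<close>, the same function of \<open>y\<close> and
  \<open>exp (2 * t * \<kappa> * (x \<bullet> y))\<close>. The first two go into the coefficients,
  and the last is positive definite.\<close>

lemma qform_powr_nonneg:
  fixes u :: "'a::euclidean_space \<Rightarrow> real"
  assumes fin: "finite T" and \<alpha>: "\<alpha> > 0" and \<kappa>: "\<kappa> \<ge> 0"
    and pos: "\<And>x y. x \<in> T \<Longrightarrow> y \<in> T \<Longrightarrow> u x + u y - 2 * \<kappa> * (x \<bullet> y) > 0"
  shows "0 \<le> qform T c (\<lambda>x y. (u x + u y - 2 * \<kappa> * (x \<bullet> y)) powr (- \<alpha>))"
proof -
  have "0 \<le> qform T c (\<lambda>x y. Gamma \<alpha> * (u x + u y - 2 * \<kappa> * (x \<bullet> y)) powr (- \<alpha>))"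
  proof (rule qform_integral_nonneg[OF fin Gamma_integral_scaled[OF \<alpha> pos]])
    fix t :: real assume t: "t \<in> {0..}"
    have "qform T c (\<lambda>x y. t powr (\<alpha> - 1) * exp (- (t * (u x + u y - 2 * \<kappa> * (x \<bullet> y))))) =
        qform T c (\<lambda>x y. t powr (\<alpha> - 1) * (exp (- t * u x) * exp (- t * u y) * exp (2 * t * \<kappa> * (x \<bullet> y))))"
      by (intro qform_cong) (simp add: exp_add[symmetric] algebra_simps)
    also have "\<dots> = t powr (\<alpha> - 1) * qform T (\<lambda>x. c x * exp (- t * u x)) (\<lambda>x y. exp (2 * t * \<kappa> * (x \<bullet> y)))"
      by (simp add: qform_cmult qform_scale)
    also have "\<dots> \<ge> 0" using t \<kappa> by (intro mult_nonneg_nonneg qform_exp_inner_nonneg) auto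
    finally show "0 \<le> qform T c (\<lambda>x y. t powr (\<alpha> - 1) * exp (- (t * (u x + u y - 2 * \<kappa> * (x \<bullet> y)))))" .
  qed
  then show ?thesis
    using Gamma_real_pos[OF \<alpha>] by (simp add: qform_cmult zero_le_mult_iff)
qed

lemma qform_newton_nonneg:
  fixes T :: "'a::euclidean_space set"
  assumes n: "DIM('a) \<ge> 3" and "finite T" "\<theta> > 0"
  shows "0 \<le> qform T c (\<lambda>x y. newton \<theta> y x)"
proof -
  \<comment> \<open>Splitting \<open>\<theta>\<close> evenly brings the base into the symmetric form
    \<open>u x + u y - 2 * \<kappa> * (x \<bullet> y)\<close> with
    \<open>\<kappa> = 1\<close>.\<close>
  have eq: "(x \<bullet> x + \<theta> / 2) + (y \<bullet> y + \<theta> / 2) - 2 * 1 * (x \<bullet> y) = (norm (x - y))\<^sup>2 + \<theta>" for x y :: 'a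
    by (simp add: power2_norm_eq_inner algebra_simps inner_commute)
  have "0 \<le> qform T c (\<lambda>x y. ((x \<bullet> x + \<theta> / 2) + (y \<bullet> y + \<theta> / 2) - 2 * 1 * (x \<bullet> y)) powr (- (real DIM('a) / 2 - 1)))"
  proof (intro qform_powr_nonneg)
    fix x y :: 'a
    show "(x \<bullet> x + \<theta> / 2) + (y \<bullet> y + \<theta> / 2) - 2 * 1 * (x \<bullet> y) > 0"
      unfolding eq using assms by (simp add: add_nonneg_pos)
  qed (use assms in auto)
  then show ?thesis unfolding eq by (simp add: newton_def qpow_def newton_base)
qed

text \<open>In general the base contains the product of the two squared norms, which is not of the
  form \<open>u x + u y\<close>. On the sphere this product is constant.\<close>

lemma qform_kelvin_sphere_nonneg:
  fixes T :: "'a::euclidean_space set"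
  assumes n: "DIM('a) \<ge> 3" and "finite T" "T \<subseteq> sphere 0 1" "0 \<le> s" "s < 1"
  shows "0 \<le> qform T c (\<lambda>x y. kelvin (s *\<^sub>R y) x)"
proof -
  have eq: "qf ((s *\<^sub>R y) \<bullet> (s *\<^sub>R y)) (- (s *\<^sub>R y)) 1 x = (1 + s\<^sup>2) / 2 + (1 + s\<^sup>2) / 2 - 2 * s * (x \<bullet> y)"
    if "x \<in> T" "y \<in> T" for x y
  proof -
    have "x \<bullet> x = 1" "y \<bullet> y = 1" using that assms by (auto simp: norm_eq_1)
    then show ?thesis by (simp add: qf_def power2_eq_square inner_commute)
  qed
  have "0 \<le> qform T c (\<lambda>x y. ((1 + s\<^sup>2) / 2 + (1 + s\<^sup>2) / 2 - 2 * s * (x \<bullet> y)) powr (- (real DIM('a) / 2 - 1)))"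
  proof (intro qform_powr_nonneg)
    fix x y assume xy: "x \<in> T" "y \<in> T"
    then have "norm x = 1" "norm y = 1" using assms by auto
    then have "norm x * norm (s *\<^sub>R y) < 1" using assms by simp
    from kelvin_base_pos[OF this] show "(1 + s\<^sup>2) / 2 + (1 + s\<^sup>2) / 2 - 2 * s * (x \<bullet> y) > 0"
      by (simp only: eq[OF xy])
  qed (use assms in auto)
  also have "qform T c (\<lambda>x y. ((1 + s\<^sup>2) / 2 + (1 + s\<^sup>2) / 2 - 2 * s * (x \<bullet> y)) powr (- (real DIM('a) / 2 - 1))) =
      qform T c (\<lambda>x y. kelvin (s *\<^sub>R y) x)"
    by (intro qform_cong) (simp only: kelvin_def qpow_def eq, simp)
  finally show ?thesis .
qed

section \<open>Sweeping from the ball to the sphere\<close>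

lemma newton_0_eq:
  fixes x :: "'a::euclidean_space"
  shows "newton 0 a x = norm (x - a) powr (2 - real DIM('a))"
proof -
  have "newton 0 a x = ((norm (x - a))\<^sup>2) powr (1 - real DIM('a) / 2)"
    unfolding newton_def qpow_def newton_base by simp
  also have "\<dots> = (norm (x - a) powr 2) powr (1 - real DIM('a) / 2)" by (simp add: powr_numeral)
  also have "\<dots> = norm (x - a) powr (2 - real DIM('a))" unfolding powr_powr by (simp add: algebra_simps)
  finally show ?thesis .
qed

lemma filterlim_newton_0:
  fixes a :: "'a::euclidean_space"
  assumes n: "DIM('a) \<ge> 3"
  shows "filterlim (newton 0 a) at_top (at a)"
  unfolding filterlim_at_top
proof
  fix Z :: real
  define Y where "Y = max Z 1"
  define r where "r = Y powr (1 / (2 - real DIM('a)))"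
  have Y: "Y > 0" "Z \<le> Y" by (auto simp: Y_def)
  have r: "r > 0" using Y by (simp add: r_def)
  have "Z \<le> newton 0 a x" if "x \<noteq> a" "dist x a < r" for x
  proof -
    have "r powr (2 - real DIM('a)) \<le> norm (x - a) powr (2 - real DIM('a))"
      using that n by (intro powr_mono2') (auto simp: dist_norm)
    moreover have "r powr (2 - real DIM('a)) = Y" using n Y by (simp add: r_def powr_powr)
    ultimately show ?thesis using Y by (simp add: newton_0_eq)
  qed
  then show "\<forall>\<^sub>F x in at a. Z \<le> newton 0 a x"
    unfolding eventually_at using r by auto
qed

lemma has_lap_normsq: "has_lap (\<lambda>x. x \<bullet> x) (x::'a::euclidean_space) (2 * real DIM('a))"
  unfolding has_lap_def
proof (intro exI[of _ "\<lambda>x. 2 *\<^sub>R x"] exI[of _ "\<lambda>v. 2 *\<^sub>R v"] conjI)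
  show "\<forall>\<^sub>F y in nhds x. GDERIV (\<lambda>x. x \<bullet> x) y :> 2 *\<^sub>R y"
    unfolding gderiv_def by (intro always_eventually allI) (auto intro!: derivative_eq_intros simp: inner_commute)
qed (auto intro!: derivative_eq_intros simp: inner_Basis)

lemma continuous_on_newton:
  assumes "\<And>x. x \<in> S \<Longrightarrow> (norm (f x - g x))\<^sup>2 + h x > 0"
    and "continuous_on S f" "continuous_on S g" "continuous_on S h"
  shows "continuous_on S (\<lambda>x. newton (h x) (g x) (f x))"
proof -
  have "(norm (f x - g x))\<^sup>2 + h x \<noteq> 0" if "x \<in> S" for x using assms(1)[OF that] by simp
  then show ?thesis
    unfolding newton_def qpow_def newton_base by (intro continuous_intros assms) auto
qed

lemma has_lap_newton_0:
  fixes x :: "'a::euclidean_space"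
  assumes "x \<noteq> a"
  shows "has_lap (newton 0 a) x 0"
  using has_lap_newton[of x a 0] assms by simp

lemma cell_ball: "norm a < 1 \<Longrightarrow> cell (cball 0 1) (sphere 0 1) (a::'a::euclidean_space)"
  unfolding cell_def by (auto intro: exI[of _ 1])

text \<open>With the whole sphere as \<open>K\<close> no flux condition remains. The Newton kernel
  supplies the pole and \<open>- (x \<bullet> x)\<close> the strict inequality.\<close>

lemma barrier_ball:
  fixes a :: "'a::euclidean_space"
  assumes n: "DIM('a) \<ge> 3"
  shows "barrier (cball 0 1) (sphere 0 1) a (\<lambda>x. newton 0 a x + (- 1) * (x \<bullet> x))"
  unfolding barrier_def
proof (intro conjI ballI impI)
  show "continuous_on (cball 0 1 - {a}) (\<lambda>x. newton 0 a x + (- 1) * (x \<bullet> x))"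
    by (intro continuous_intros continuous_on_newton) auto
next
  fix x assume x: "x \<noteq> a"
  have "has_lap (\<lambda>x. newton 0 a x + (- 1) * (x \<bullet> x)) x (0 + (- 1) * (2 * real DIM('a)))"
    by (intro has_lap_add has_lap_cmult has_lap_normsq has_lap_newton_0 x)
  moreover have "0 + (- 1) * (2 * real DIM('a)) < 0" by simp
  ultimately show "\<exists>L<0. has_lap (\<lambda>x. newton 0 a x + (- 1) * (x \<bullet> x)) x L" by blast
next
  have "((\<lambda>x. (- 1) * (x \<bullet> x)) \<longlongrightarrow> (- 1) * (a \<bullet> a)) (at a)" by (intro tendsto_intros)
  from filterlim_tendsto_add_at_top[OF this filterlim_newton_0[OF n]]
  show "filterlim (\<lambda>x. newton 0 a x + (- 1) * (x \<bullet> x)) at_top (at a)"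
    by (simp add: add.commute)
qed auto


lemma prod_scaled_less_1:
  assumes "norm x \<le> 1" "norm y \<le> 1" "0 \<le> s" "s < (1::real)"
  shows "norm x * norm (s *\<^sub>R y) < 1"
proof -
  have "norm x * norm (s *\<^sub>R y) \<le> 1 * s"
    using assms by (intro mult_mono) (auto simp: mult_left_le)
  then show ?thesis using assms by simp
qed

lemma continuous_on_kelvin_scaled:
  assumes "0 \<le> s" "s < 1"
  shows "continuous_on (cball 0 1 \<times> cball 0 1) (\<lambda>w. kelvin (s *\<^sub>R snd w) (fst w))"
  using prod_scaled_less_1[OF _ _ assms]
  by (intro continuous_on_compose2[OF continuous_on_kelvin, where f = "\<lambda>w. (s *\<^sub>R snd w, fst w)", simplified]
      continuous_intros) auto

text \<open>The scaled Kelvin kernel is harmonic in the ball, so \<open>c\<close> may have either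
  sign. Sweeping with \<open>c = 1\<close> and \<open>c = - 1\<close> together gives a two-sided
  estimate.\<close>

lemma supersol_kelvin:
  fixes y :: "'a::euclidean_space"
  assumes y: "y \<in> cball 0 1" and s: "0 \<le> s" "s < 1"
  shows "supersol (cball 0 1) (sphere 0 1) a (\<lambda>w. c * kelvin (s *\<^sub>R y) w)"
  unfolding supersol_def
proof (intro conjI ballI impI)
  have "continuous_on (cball 0 1) (\<lambda>w. (\<lambda>w. kelvin (s *\<^sub>R snd w) (fst w)) (w, y))"
    by (rule continuous_on_compose2[OF continuous_on_kelvin_scaled[OF s]]) (use y in \<open>auto intro!: continuous_intros\<close>)
  then have "continuous_on (cball 0 1) (\<lambda>w. kelvin (s *\<^sub>R y) w)" by simp
  then show "continuous_on (cball 0 1) (\<lambda>w. c * kelvin (s *\<^sub>R y) w)" by (intro continuous_intros)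
next
  fix x :: 'a assume "norm x < 1"
  then have "norm x * norm (s *\<^sub>R y) < 1" using y s by (intro prod_scaled_less_1) auto
  from has_lap_qpow[OF kelvin_base_pos[OF this]] have "has_lap (kelvin (s *\<^sub>R y)) x 0"
    by (simp add: kelvin_def)
  then have "has_lap (\<lambda>w. c * kelvin (s *\<^sub>R y) w) x (c * 0)" by (rule has_lap_cmult)
  then show "\<exists>L\<le>0. has_lap (\<lambda>w. c * kelvin (s *\<^sub>R y) w) x L" by (intro exI[of _ 0]) simp
qed auto

text \<open>Both signs of the kernel, for all poles \<open>z\<close> at once, form a totally bounded
  family to which \<open>sweep\<close> applies. A point already on the sphere is its own point
  mass.\<close>

lemma sweep_kelvin_to_sphere:
  fixes x :: "'a::euclidean_space"
  assumes n: "DIM('a) \<ge> 3" and x: "x \<in> cball 0 1" and s: "0 \<le> s" "s < 1" and \<epsilon>: "\<epsilon> > 0"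
  shows "\<exists>S p. weights (sphere 0 1) S p \<and>
    (\<forall>z\<in>cball 0 1. \<bar>avg S p (kelvin (s *\<^sub>R z)) - kelvin (s *\<^sub>R z) x\<bar> \<le> \<epsilon>)"
proof (cases "norm x < 1")
  case True
  define F where "F c w z = c * kelvin (s *\<^sub>R z) w" for c :: real and w z :: 'a
  define H where "H = (\<lambda>z w. F 1 w z) ` cball 0 1 \<union> (\<lambda>z w. F (- 1) w z) ` cball 0 1"
  have "tot_bdd (cball 0 1) ((\<lambda>z w. F c w z) ` cball 0 1)" for c
    unfolding F_def by (intro tot_bdd_family compact_cball continuous_on_mult_left continuous_on_kelvin_scaled s)
  then have "tot_bdd (cball 0 1) H" unfolding H_def by (intro tot_bdd_Un)
  moreover have "supersol (cball 0 1) (sphere 0 1) x h" if "h \<in> H" for h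
    using that supersol_kelvin[OF _ s] unfolding H_def F_def by blast
  ultimately obtain S p where S: "weights (sphere 0 1) S p" "\<forall>h\<in>H. avg S p h \<le> h x + \<epsilon>"
    using sweep[OF cell_ball[OF True] barrier_ball[OF n] x _ _ \<epsilon>] by blast
  have "\<bar>avg S p (kelvin (s *\<^sub>R z)) - kelvin (s *\<^sub>R z) x\<bar> \<le> \<epsilon>" if z: "z \<in> cball 0 1" for z
  proof -
    have "(\<lambda>w. F 1 w z) \<in> H" "(\<lambda>w. F (- 1) w z) \<in> H" using z by (auto simp: H_def)
    then have "avg S p (\<lambda>w. F 1 w z) \<le> F 1 x z + \<epsilon>" "avg S p (\<lambda>w. F (- 1) w z) \<le> F (- 1) x z + \<epsilon>"
      using S(2) by blast+
    then show ?thesis unfolding F_def avg_cmult by (simp add: abs_le_iff)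
  qed
  then show ?thesis using S(1) by blast
next
  case False
  then have "weights (sphere 0 1) {x} (\<lambda>_. 1)" using x by (simp add: weights_def)
  then show ?thesis using \<epsilon> by (intro exI[of _ "{x}"] exI[of _ "\<lambda>_. 1"]) (simp add: avg_def)
qed

text \<open>Since the kernel is harmonic in each variable, every point of the ball may be swept to the sphere,
  where the base of the power is \<open>1 + s\<^sup>2 - 2 * s * (x \<bullet> y)\<close> and the Gamma integral applies.\<close>

lemma qform_kelvin_nonneg:
  fixes T :: "'a::euclidean_space set"
  assumes n: "DIM('a) \<ge> 3" and T: "finite T" "T \<subseteq> cball 0 1" and s: "0 \<le> s" "s < 1"
  shows "0 \<le> qform T c (\<lambda>x y. kelvin (s *\<^sub>R y) x)"
proof -
  define A where "A = (\<Sum>x\<in>T. \<Sum>y\<in>T. \<bar>c x\<bar> * \<bar>c y\<bar>)"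
  have main: "qform T c (\<lambda>x y. kelvin (s *\<^sub>R y) x) \<ge> - (2 * A) * \<epsilon>" if \<epsilon>: "\<epsilon> > 0" for \<epsilon>
  proof -
    have "\<forall>x\<in>T. \<exists>S p. weights (sphere 0 1) S p \<and>
        (\<forall>z\<in>cball 0 1. \<bar>avg S p (kelvin (s *\<^sub>R z)) - kelvin (s *\<^sub>R z) x\<bar> \<le> \<epsilon>)"
      using sweep_kelvin_to_sphere[OF n _ s \<epsilon>] T(2) by blast
    then obtain S p where S: "\<And>x. x \<in> T \<Longrightarrow> weights (sphere 0 1) (S x) (p x)"
      and close: "\<And>x z. x \<in> T \<Longrightarrow> z \<in> cball 0 1 \<Longrightarrow>
        \<bar>avg (S x) (p x) (kelvin (s *\<^sub>R z)) - kelvin (s *\<^sub>R z) x\<bar> \<le> \<epsilon>"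
      by metis
    define W where "W = (\<Union>x\<in>T. S x)"
    \<comment> \<open>Extension by zero to the common finite support \<open>W\<close>, so that all
      swept measures can be added.\<close>
    define q where "q x w = (if w \<in> S x then p x w else 0)" for x w
    \<comment> \<open>Both arguments of the kernel are swept; the resulting form is one on the
      sphere, with swept coefficients.\<close>
    define E where "E x y = avg (S x) (p x) (\<lambda>w. avg (S y) (p y) (\<lambda>z. kelvin (s *\<^sub>R z) w))" for x y
    have W: "finite W" "W \<subseteq> sphere 0 1" using S T(1) by (auto simp: W_def weights_def)
    have avg_eq: "avg (S x) (p x) f = (\<Sum>w\<in>W. q x w * f w)" if "x \<in> T" for x f
      unfolding avg_def q_def using W(1) that
      by (intro sum.mono_neutral_cong_left) (auto simp: W_def)
    have E_eq: "E x y = (\<Sum>w\<in>W. \<Sum>z\<in>W. q x w * q y z * kelvin (s *\<^sub>R z) w)" if "x \<in> T" "y \<in> T" for x y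
      unfolding E_def avg_eq[OF that(1)] avg_eq[OF that(2)] by (simp add: sum_distrib_left mult_ac)
    have "qform T c E = (\<Sum>x\<in>T. \<Sum>y\<in>T. \<Sum>w\<in>W. \<Sum>z\<in>W. c x * c y * (q x w * q y z * kelvin (s *\<^sub>R z) w))"
      unfolding qform_def by (intro sum.cong refl) (simp add: E_eq sum_distrib_left)
    also have "\<dots> = (\<Sum>w\<in>W. \<Sum>z\<in>W. \<Sum>x\<in>T. \<Sum>y\<in>T. c x * c y * (q x w * q y z * kelvin (s *\<^sub>R z) w))"
      by (subst sum.swap, subst (2) sum.swap, subst (3) sum.swap, subst sum.swap) (simp add: sum.swap[of _ W T])
    also have "\<dots> = qform W (\<lambda>w. \<Sum>x\<in>T. c x * q x w) (\<lambda>w z. kelvin (s *\<^sub>R z) w)"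
      unfolding qform_def unfolding sum_product sum_distrib_right by (intro sum.cong refl) (simp add: mult_ac sum_distrib_left)
    also have "\<dots> \<ge> 0" by (rule qform_kelvin_sphere_nonneg[OF n W s])
    finally have E0: "qform T c E \<ge> 0" .
    have near: "\<bar>E x y - kelvin (s *\<^sub>R y) x\<bar> \<le> 2 * \<epsilon>" if "x \<in> T" "y \<in> T" for x y
    proof -
      \<comment> \<open>Here the pole is averaged, whereas \<open>close\<close> averages the point;
        \<open>kelvin_scale\<close> exchanges the two. Each of the two sweepings costs one
        \<open>\<epsilon>\<close>.\<close>
      have "\<bar>avg (S y) (p y) (\<lambda>z. kelvin (s *\<^sub>R z) w) - kelvin (s *\<^sub>R y) w\<bar> \<le> \<epsilon>" if "w \<in> sphere 0 1" for w
        using close[OF \<open>y \<in> T\<close>, of w] that by (simp add: kelvin_scale[of s _ w])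
      then have "E x y \<le> avg (S x) (p x) (\<lambda>w. kelvin (s *\<^sub>R y) w + \<epsilon>)"
          "E x y \<ge> avg (S x) (p x) (\<lambda>w. kelvin (s *\<^sub>R y) w - \<epsilon>)"
        unfolding E_def by (intro avg_mono[OF S[OF that(1)]]; fastforce simp: abs_le_iff)+
      then have "\<bar>E x y - avg (S x) (p x) (kelvin (s *\<^sub>R y))\<bar> \<le> \<epsilon>"
        by (simp add: avg_add avg_diff avg_const[OF S[OF that(1)]] abs_le_iff)
      moreover have "\<bar>avg (S x) (p x) (kelvin (s *\<^sub>R y)) - kelvin (s *\<^sub>R y) x\<bar> \<le> \<epsilon>"
        using close[of x y] that T(2) by auto
      ultimately show ?thesis by linarith
    qed
    have "qform T c E - qform T c (\<lambda>x y. kelvin (s *\<^sub>R y) x) \<le> (\<Sum>x\<in>T. \<Sum>y\<in>T. \<bar>c x\<bar> * \<bar>c y\<bar> * (2 * \<epsilon>))"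
      unfolding qform_diff[symmetric] unfolding qform_def
    proof (intro sum_mono)
      fix x y assume xy: "x \<in> T" "y \<in> T"
      have "c x * c y * (E x y - kelvin (s *\<^sub>R y) x) \<le> \<bar>c x * c y\<bar> * \<bar>E x y - kelvin (s *\<^sub>R y) x\<bar>"
        by (metis abs_ge_self abs_mult)
      also have "\<dots> \<le> \<bar>c x * c y\<bar> * (2 * \<epsilon>)" by (intro mult_left_mono near xy) auto
      finally show "c x * c y * (E x y - kelvin (s *\<^sub>R y) x) \<le> \<bar>c x\<bar> * \<bar>c y\<bar> * (2 * \<epsilon>)" by (simp add: abs_mult)
    qed
    also have "\<dots> = 2 * A * \<epsilon>" by (simp add: A_def sum_distrib_right[symmetric])
    finally show ?thesis using E0 by simp
  qed
  have "((\<lambda>\<epsilon>. - (2 * A) * \<epsilon>) \<longlongrightarrow> - (2 * A) * 0) (at_right 0)" by (intro tendsto_intros)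
  then have "- (2 * A) * 0 \<le> qform T c (\<lambda>x y. kelvin (s *\<^sub>R y) x)"
    by (rule tendsto_upperbound) (use main in \<open>auto simp: eventually_at_right_less intro!: eventually_at_rightI[of 0 1]\<close>)
  then show ?thesis by simp
qed

text \<open>The flux integrand is \<open>kelvin\<close> minus a constant, divided by
  \<open>t\<close>; the constant drops out because the total mass is zero. At \<open>t = 0\<close>
  the integrand is a nonnegative multiple of the inner product.\<close>

lemma qform_regpart_nonneg:
  fixes T :: "'a::euclidean_space set"
  assumes n: "DIM('a) \<ge> 3" and T: "finite T" "T \<subseteq> cball 0 1" and s: "0 \<le> s" "s < 1" and c: "sum c T = 0"
  shows "0 \<le> qform T c (\<lambda>x y. regpart (s *\<^sub>R y) x)"
proof -
  have "0 \<le> qform T c (\<lambda>x y. flux_int (s *\<^sub>R y) x)"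
  proof (rule qform_integral_nonneg[OF T(1)])
    fix x y assume "x \<in> T" "y \<in> T"
    then have "norm x * norm (s *\<^sub>R y) < 1" using T s by (intro prod_scaled_less_1) auto
    then show "((\<lambda>t. flux_fun (s *\<^sub>R y) x t) has_integral flux_int (s *\<^sub>R y) x) {0..1}"
      unfolding flux_int_def by (intro integrable_integral flux_fun_integrable)
  next
    fix t :: real assume t: "t \<in> {0..1}"
    show "0 \<le> qform T c (\<lambda>x y. flux_fun (s *\<^sub>R y) x t)"
    proof (cases "t = 0")
      case True
      have "qform T c (\<lambda>x y. flux_fun (s *\<^sub>R y) x t) = qform T c (\<lambda>x y. ((real DIM('a) - 2) * s) * (x \<bullet> y) ^ 1)"
        using True by (intro qform_cong) (simp add: flux_fun_def)
      also have "\<dots> \<ge> 0"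
        unfolding qform_cmult using n s by (intro mult_nonneg_nonneg qform_inner_power_nonneg) auto
      finally show ?thesis .
    next
      case False
      have "qform T c (\<lambda>x y. flux_fun (s *\<^sub>R y) x t) = qform T c (\<lambda>x y. (1 / t) * (kelvin ((t * s) *\<^sub>R y) x - 1))"
        using False by (intro qform_cong) (simp add: flux_fun_def)
      also have "\<dots> = (1 / t) * qform T c (\<lambda>x y. kelvin ((t * s) *\<^sub>R y) x)"
        unfolding qform_cmult qform_diff qform_const c by simp
      also have "\<dots> \<ge> 0"
      proof (intro mult_nonneg_nonneg qform_kelvin_nonneg[OF n T])
        have "t * s \<le> 1 * s" using t s by (intro mult_right_mono) auto
        then show "t * s < 1" using s by simp
      qed (use t s in auto)
      finally show ?thesis .
    qed
  qed
  moreover have "qform T c (\<lambda>x y. regpart (s *\<^sub>R y) x) =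
      qform T c (\<lambda>x y. kelvin (s *\<^sub>R y) x) + (real DIM('a) - 2) * qform T c (\<lambda>x y. flux_int (s *\<^sub>R y) x)"
    unfolding regpart_def qform_add qform_cmult ..
  ultimately show ?thesis using qform_kelvin_nonneg[OF n T s] n by simp
qed

section \<open>Robin functions\<close>

definition neumann :: "'a::euclidean_space \<Rightarrow> 'a \<Rightarrow> real" where
  "neumann y x = newton 0 y x + regpart y x"

lemma neumann_commute: "neumann y x = neumann x y"
  by (simp add: neumann_def newton_commute regpart_commute)

text \<open>A power of 0 is 0, so at the pole only the regular part is left. This agrees with the
  convention that a Robin function takes its constant term there.\<close>

lemma neumann_diag: "neumann a a = regpart a a"
  by (simp add: neumann_def newton_0_eq)

lemma prod_less_1: "norm x \<le> 1 \<Longrightarrow> norm y < 1 \<Longrightarrow> norm x * norm y < 1"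
  by (metis less_eq_real_def mult_le_one mult_less_cancel_right1 norm_ge_zero not_le nle_le order.strict_trans2)

lemma continuous_on_regpart_fixed:
  assumes "norm y < 1"
  shows "continuous_on (cball 0 1) (regpart y)"
proof -
  have "continuous_on (cball 0 1) (\<lambda>x. (\<lambda>z. regpart (fst z) (snd z)) (y, x))"
    by (rule continuous_on_compose2[OF continuous_on_regpart])
       (use prod_less_1[OF _ assms] in \<open>auto intro!: continuous_intros\<close>)
  then show ?thesis by simp
qed

lemma continuous_on_neumann:
  assumes "norm y < 1"
  shows "continuous_on (cball 0 1 - {y}) (neumann y)"
  unfolding neumann_def[abs_def]
  by (intro continuous_on_add continuous_on_newton continuous_intros
      continuous_on_subset[OF continuous_on_regpart_fixed[OF assms]]) auto

lemma has_lap_neumann: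
  fixes x y :: "'a::euclidean_space"
  assumes "norm y < 1" "norm x \<le> 1" "x \<noteq> y"
  shows "has_lap (neumann y) x 0"
  unfolding neumann_def[abs_def]
  using has_lap_add[OF has_lap_newton_0[OF assms(3)] has_lap_regpart[OF prod_less_1[OF assms(2,1)]]] by simp

lemma inward_deriv_neumann:
  fixes x y :: "'a::euclidean_space"
  assumes "norm y < 1" "norm x = 1"
  shows "inward_deriv (neumann y) x (real DIM('a) - 2)"
proof -
  have "x \<noteq> y" using assms by auto
  then have p: "(norm (x - y))\<^sup>2 + 0 > 0" by simp
  from inward_deriv_add[OF inward_deriv_newton[OF assms(2) p] inward_deriv_regpart[OF assms(2,1)]]
  show ?thesis unfolding neumann_def[abs_def] by (simp add: algebra_simps)
qed

lemma inward_deriv_normsq: "norm x = 1 \<Longrightarrow> inward_deriv (\<lambda>x. x \<bullet> x) x (- 2)"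
proof -
  assume x: "norm x = 1"
  have "GDERIV (\<lambda>x. x \<bullet> x) x :> 2 *\<^sub>R x"
    unfolding gderiv_def by (auto intro!: derivative_eq_intros simp: inner_commute)
  from GDERIV_imp_inward_deriv[OF this] show ?thesis using x by (simp add: norm_eq_1)
qed

text \<open>The pole at \<open>a\<close> comes with flux \<open>n - 2\<close> of the wrong sign.
  Twice the Neumann function with pole \<open>b\<close> outside \<open>C\<close> overcompensates it.
  The quadratic term makes the Laplacian \<open>- n / 2\<close> and adds \<open>1 / 2\<close> to the
  flux; the total \<open>1 / 2 - (n - 2)\<close> is negative for \<open>n \<ge> 3\<close>.\<close>

lemma barrier_neumann:
  fixes a b :: "'a::euclidean_space"
  assumes n: "DIM('a) \<ge> 3" and cell: "cell C K a" and b: "b \<notin> C" "norm b < 1"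
  shows "barrier C K a (\<lambda>x. neumann a x + (- 2) * neumann b x + (- 1 / 4) * (x \<bullet> x))"
  unfolding barrier_def
proof (intro conjI ballI impI)
  have C: "C \<subseteq> cball 0 1" and a: "norm a < 1" using cell by (auto simp: cell_def)
  show "continuous_on (C - {a}) (\<lambda>x. neumann a x + (- 2) * neumann b x + (- 1 / 4) * (x \<bullet> x))"
    using C b a by (intro continuous_intros continuous_on_subset[OF continuous_on_neumann]) auto
  show "\<exists>L<0. has_lap (\<lambda>x. neumann a x + (- 2) * neumann b x + (- 1 / 4) * (x \<bullet> x)) x L"
    if x: "x \<in> C - K" "x \<noteq> a" "norm x < 1" for x
  proof -
    have "x \<noteq> b" using x b by auto
    then have "has_lap (\<lambda>x. neumann a x + (- 2) * neumann b x + (- 1 / 4) * (x \<bullet> x)) x (0 + (- 2) * 0 + (- 1 / 4) * (2 * real DIM('a)))"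
      using x a b by (intro has_lap_add has_lap_cmult has_lap_normsq has_lap_neumann) auto
    moreover have "0 + (- 2) * 0 + (- 1 / 4) * (2 * real DIM('a)) < 0" by simp
    ultimately show ?thesis by blast
  qed
  show "\<exists>L<0. inward_deriv (\<lambda>x. neumann a x + (- 2) * neumann b x + (- 1 / 4) * (x \<bullet> x)) x L"
    if x: "x \<in> C - K" "norm x = 1" for x
  proof -
    have "inward_deriv (\<lambda>x. neumann a x + (- 2) * neumann b x + (- 1 / 4) * (x \<bullet> x)) x
        ((real DIM('a) - 2) + (- 2) * (real DIM('a) - 2) + (- 1 / 4) * (- 2))"
      using x a b by (intro inward_deriv_add inward_deriv_cmult inward_deriv_neumann inward_deriv_normsq) auto
    moreover have "(real DIM('a) - 2) + (- 2) * (real DIM('a) - 2) + (- 1 / 4) * (- 2) < 0" using n by simp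
    ultimately show ?thesis by blast
  qed
  show "filterlim (\<lambda>x. neumann a x + (- 2) * neumann b x + (- 1 / 4) * (x \<bullet> x)) at_top (at a)" if aC: "a \<in> C"
  proof -
    have "a \<in> interior (cball 0 1 - {b})"
    proof (rule interiorI)
      show "open (ball 0 1 - {b})" by auto
    qed (use a b aC in auto)
    then have "isCont (neumann b) a" using continuous_on_interior[OF continuous_on_neumann[OF b(2)]] by blast
    moreover have "isCont (regpart a) a"
      using continuous_on_interior[OF continuous_on_regpart_fixed[OF a], of a] a by simp
    ultimately have "((\<lambda>x. regpart a x + (- 2) * neumann b x + (- 1 / 4) * (x \<bullet> x)) \<longlongrightarrow>
        regpart a a + (- 2) * neumann b a + (- 1 / 4) * (a \<bullet> a)) (at a)"
      unfolding isCont_def by (intro tendsto_intros)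
    from filterlim_tendsto_add_at_top[OF this filterlim_newton_0[OF n]]
    show ?thesis by (simp add: neumann_def algebra_simps)
  qed
qed

section \<open>Constants, normals and boundary points of domains in the ball\<close>

lemma sphere_area_pos: "n > 0 \<Longrightarrow> sphere_area n > 0"
  unfolding sphere_area_def by (intro divide_pos_pos mult_pos_pos Gamma_real_pos) auto

lemma lam_pos: "n \<ge> 3 \<Longrightarrow> lam n > 0"
  unfolding lam_def using sphere_area_pos[of n] by simp

text \<open>For \<open>\<nu> \<noteq> - z\<close> the vector \<open>v = \<nu> + z\<close> has the
  same positive inner product \<open>1 + \<nu> \<bullet> z\<close> with \<open>\<nu>\<close> and
  with \<open>z\<close>. Moving from \<open>z\<close> along \<open>v\<close> then leads into
  \<open>D\<close> and out of the unit ball at the same time.\<close>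

lemma inward_unit_normal_locally_ball:
  fixes z :: "'a::euclidean_space"
  assumes z: "norm z = 1" and D: "D \<subseteq> ball 0 1" and \<nu>: "inward_unit_normal D z \<nu>"
  shows "\<nu> = - z"
proof (rule ccontr)
  assume ne: "\<nu> \<noteq> - z"
  obtain V \<phi> G where V: "open V" "z \<in> V" "GDERIV \<phi> z :> G z" "D \<inter> V = {x \<in> V. \<phi> x > 0}" "\<phi> z = 0"
    "G z \<noteq> 0" "\<nu> = G z /\<^sub>R norm (G z)"
    using \<nu> unfolding inward_unit_normal_def by blast
  have \<nu>1: "\<nu> \<bullet> \<nu> = 1" and zz: "z \<bullet> z = 1" proof -
    have "norm \<nu> = 1" using V(6,7) by simp
    then show "\<nu> \<bullet> \<nu> = 1" "z \<bullet> z = 1" using z by (simp_all only: norm_eq_1)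
  qed
  define v where "v = \<nu> + z"
  have "v \<bullet> v > 0" using ne by (simp add: v_def eq_neg_iff_add_eq_0)
  then have pos: "1 + \<nu> \<bullet> z > 0"
    using \<nu>1 zz by (simp add: v_def algebra_simps inner_commute)
  have "v \<bullet> G z = norm (G z) * (v \<bullet> \<nu>)" using V(6,7) by simp
  also have "v \<bullet> \<nu> = 1 + \<nu> \<bullet> z" using \<nu>1 by (simp add: v_def algebra_simps inner_commute)
  finally have flux_int_grad: "v \<bullet> G z > 0" using pos V(6) by simp
  have "(\<phi> has_derivative (\<lambda>h. h \<bullet> G z)) (at (z + 0 *\<^sub>R v))" using V(3) by (simp add: gderiv_def)
  moreover have "((\<lambda>t::real. z + t *\<^sub>R v) has_derivative (\<lambda>h. h *\<^sub>R v)) (at 0)"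
    by (auto intro!: derivative_eq_intros)
  ultimately have "((\<phi> \<circ> (\<lambda>t. z + t *\<^sub>R v)) has_derivative ((\<lambda>h. h \<bullet> G z) \<circ> (\<lambda>h. h *\<^sub>R v))) (at 0)"
    by (intro diff_chain_at)
  then have "((\<lambda>t. \<phi> (z + t *\<^sub>R v)) has_real_derivative v \<bullet> G z) (at 0)"
    unfolding has_field_derivative_def o_def by (rule has_derivative_eq_rhs) (simp add: fun_eq_iff)
  then obtain d where d: "d > 0" "\<And>h. 0 < h \<Longrightarrow> h < d \<Longrightarrow> \<phi> (z + 0 *\<^sub>R v) < \<phi> (z + (0 + h) *\<^sub>R v)"
    using DERIV_pos_inc_right[OF _ flux_int_grad] by blast
  have "((\<lambda>t. z + t *\<^sub>R v) \<longlongrightarrow> z + 0 *\<^sub>R v) (at_right 0)" by (intro tendsto_intros)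
  then have "\<forall>\<^sub>F t in at_right 0. z + t *\<^sub>R v \<in> V" using V(1,2) by (intro topological_tendstoD) auto
  moreover have "\<forall>\<^sub>F t in at_right 0. t \<in> {0<..<d}" using d(1) by (rule eventually_at_rightI[of 0 d, rotated]) auto
  ultimately have "\<forall>\<^sub>F t in at_right 0. z + t *\<^sub>R v \<in> V \<and> t \<in> {0<..<d}"
    by (rule eventually_conj)
  then obtain t where t: "z + t *\<^sub>R v \<in> V" "0 < t" "t < d"
    using eventually_happens'[OF trivial_limit_at_right_real] by (auto simp: greaterThanLessThan_iff)
  then have "\<phi> (z + t *\<^sub>R v) > 0" using d(2)[of t] V(5) by simp
  then have "z + t *\<^sub>R v \<in> D" using t V(4) by blast
  then have "(z + t *\<^sub>R v) \<bullet> (z + t *\<^sub>R v) < 1"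
    using D by (auto simp: norm_eq_sqrt_inner)
  then have "2 * t * (1 + \<nu> \<bullet> z) + t\<^sup>2 * (v \<bullet> v) < 0"
    using zz by (simp add: v_def algebra_simps inner_commute power2_eq_square)
  moreover have "2 * t * (1 + \<nu> \<bullet> z) > 0" "t\<^sup>2 * (v \<bullet> v) \<ge> 0" using t pos by auto
  ultimately show False by simp
qed

lemma has_inward_normal_deriv_imp_inward_deriv:
  assumes "norm z = 1" "D \<subseteq> ball 0 1" "has_inward_normal_deriv g D z d"
  shows "inward_deriv g z d"
proof -
  obtain \<nu> where \<nu>: "inward_unit_normal D z \<nu>"
    "((\<lambda>t. g (z + t *\<^sub>R \<nu>)) has_real_derivative d) (at_right 0)"
    using assms(3) unfolding has_inward_normal_deriv_def by blast
  have "\<nu> = - z" by (rule inward_unit_normal_locally_ball[OF assms(1,2) \<nu>(1)])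
  then show ?thesis using \<nu>(2) by (simp add: inward_deriv_def)
qed

text \<open>The intersection of two balls is convex, hence connected. For a small radius it meets
  \<open>D\<close> but not the frontier of \<open>D\<close>, so it lies in \<open>D\<close>.\<close>

lemma frontier_locally_ball:
  fixes D :: "'a::euclidean_space set"
  assumes D: "open D" "D \<subseteq> ball 0 1" and \<Gamma>: "closed \<Gamma>" "frontier D \<inter> ball 0 1 \<subseteq> \<Gamma>"
    and x: "x \<in> frontier D - \<Gamma>"
  shows "norm x = 1" "\<exists>r>0. ball 0 1 \<inter> ball x r \<subseteq> D"
proof -
  have xc: "x \<in> closure D" using x by (simp add: frontier_def)
  have "closure D \<subseteq> cball 0 1" using D(2) by (metis closed_cball closure_minimal ball_subset_cball order_trans)
  then show "norm x = 1" using x xc \<Gamma>(2) by force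
  have "open (- \<Gamma>)" "x \<in> - \<Gamma>" using \<Gamma>(1) x by auto
  then obtain r where r: "r > 0" "ball x r \<subseteq> - \<Gamma>" using open_contains_ball by blast
  let ?S = "ball 0 1 \<inter> ball x r"
  have "frontier D \<inter> ?S = {}" using \<Gamma>(2) r(2) by auto
  moreover have "connected ?S" by (intro convex_connected convex_Int convex_ball)
  moreover have "?S \<inter> D \<noteq> {}"
  proof -
    have "x \<in> ball x r" using r(1) by simp
    then have "ball x r \<inter> D \<noteq> {}" using xc open_Int_closure_eq_empty[of "ball x r" D] by blast
    then show ?thesis using D(2) by auto
  qed
  ultimately have "?S - D = {}" using connected_Int_frontier[of ?S D] by auto
  then show "\<exists>r>0. ball 0 1 \<inter> ball x r \<subseteq> D" using r(1) by auto
qed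

lemma cball_subset_closure:
  fixes D :: "'a::euclidean_space set"
  assumes "ball 0 1 \<inter> ball x r \<subseteq> D"
  shows "cball 0 1 \<inter> ball x r \<subseteq> closure D"
proof -
  have "ball x r \<inter> closure (ball 0 1) \<subseteq> closure (ball x r \<inter> ball 0 1)"
    by (rule open_Int_closure_subset) simp
  also have "\<dots> \<subseteq> closure D" using assms by (intro closure_mono) auto
  finally show ?thesis by auto
qed

lemma closure_rel_open:
  fixes D :: "'a::euclidean_space set"
  assumes D: "open D" "D \<subseteq> ball 0 1" and \<Gamma>: "closed \<Gamma>" "frontier D \<inter> ball 0 1 \<subseteq> \<Gamma>"
    and x: "x \<in> closure D - \<Gamma>"
  shows "\<exists>r>0. cball 0 1 \<inter> ball x r \<subseteq> closure D"
proof (cases "x \<in> D")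
  case True
  then obtain r where "r > 0" "ball x r \<subseteq> D" using D(1) open_contains_ball by blast
  then show ?thesis using closure_subset by (intro exI[of _ r]) blast
next
  case False
  then have "x \<in> frontier D - \<Gamma>" using x D(1) by (simp add: frontier_def interior_open)
  from frontier_locally_ball(2)[OF D \<Gamma> this] show ?thesis using cball_subset_closure by blast
qed

lemma closure_subset_cball: "D \<subseteq> ball 0 1 \<Longrightarrow> closure D \<subseteq> cball (0::'a::euclidean_space) 1"
  by (metis closed_cball closure_minimal ball_subset_cball order_trans)

section \<open>Differences of Robin functions and uniqueness of the Robin radius\<close>

lemma continuous_on_insert_limit:
  fixes f :: "'a::euclidean_space \<Rightarrow> real"
  assumes "continuous_on (S - {a}) f" "(f \<longlongrightarrow> f a) (at a)"
  shows "continuous_on S f"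
  unfolding continuous_on_def
proof
  fix x assume x: "x \<in> S"
  show "(f \<longlongrightarrow> f x) (at x within S)"
  proof (cases "x = a")
    case True
    then show ?thesis using assms(2) by (auto intro: tendsto_within_subset)
  next
    case False
    then have "(f \<longlongrightarrow> f x) (at x within (S - {a}))" using assms(1) x by (auto simp: continuous_on_def)
    moreover have "at x within (S - {a}) = at x within S"
      using False by (intro at_within_nhd[of x "- {a}"]) auto
    ultimately show ?thesis by simp
  qed
qed

lemma robin_regular_part:
  fixes a :: "'a::euclidean_space"
  assumes n: "DIM('a) \<ge> 3" and g: "is_robin_function D \<Gamma> a r g"
  shows "((\<lambda>x. newton 0 a x - g x / lam DIM('a)) \<longlongrightarrow> - (g a / lam DIM('a))) (at a)"
proof -
  have l: "lam DIM('a) > 0" using lam_pos[OF n] .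
  have "((\<lambda>z. g z / lam DIM('a) - (norm (z - a) powr (2 - real DIM('a)) - r spowr (2 - real DIM('a)))) \<longlongrightarrow> 0) (at a)"
    and ga: "g a = - lam DIM('a) * r spowr (2 - real DIM('a))"
    using g by (auto simp: is_robin_function_def)
  then have "((\<lambda>z. r spowr (2 - real DIM('a)) - (g z / lam DIM('a) - (norm (z - a) powr (2 - real DIM('a)) - r spowr (2 - real DIM('a)))))
      \<longlongrightarrow> r spowr (2 - real DIM('a)) - 0) (at a)"
    by (intro tendsto_intros)
  then show ?thesis using l by (simp add: ga newton_0_eq)
qed

lemma robin_filterlim:
  fixes a :: "'a::euclidean_space"
  assumes n: "DIM('a) \<ge> 3" and g: "is_robin_function D \<Gamma> a r g"
  shows "filterlim g at_top (at a)"
proof -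
  have l: "lam DIM('a) > 0" using lam_pos[OF n] .
  have "((\<lambda>x. - (newton 0 a x - g x / lam DIM('a))) \<longlongrightarrow> - (- (g a / lam DIM('a)))) (at a)"
    by (intro tendsto_minus robin_regular_part[OF n g])
  from filterlim_tendsto_add_at_top[OF this filterlim_newton_0[OF n]]
  have "filterlim (\<lambda>x. g x / lam DIM('a)) at_top (at a)" by simp
  then have "filterlim (\<lambda>x. lam DIM('a) * (g x / lam DIM('a))) at_top (at a)"
    by (intro filterlim_tendsto_pos_mult_at_top[OF tendsto_const]) (use l in auto)
  then show ?thesis using l by simp
qed

lemma robin_diff_tendsto:
  fixes a :: "'a::euclidean_space"
  assumes n: "DIM('a) \<ge> 3" and g: "is_robin_function D \<Gamma> a r g" "is_robin_function D \<Gamma> a r' g'"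
  shows "((\<lambda>x. g x - g' x) \<longlongrightarrow> g a - g' a) (at a)"
proof -
  have l: "lam DIM('a) > 0" using lam_pos[OF n] .
  have "((\<lambda>x. lam DIM('a) * ((newton 0 a x - g' x / lam DIM('a)) - (newton 0 a x - g x / lam DIM('a)))) \<longlongrightarrow>
      lam DIM('a) * (- (g' a / lam DIM('a)) - - (g a / lam DIM('a)))) (at a)"
    by (intro tendsto_intros robin_regular_part[OF n g(1)] robin_regular_part[OF n g(2)])
  then show ?thesis using l by (simp add: right_diff_distrib)
qed

lemma robin_inward_deriv:
  fixes a :: "'a::euclidean_space"
  assumes D: "open D" "D \<subseteq> ball 0 1" and \<Gamma>: "closed \<Gamma>" "frontier D \<inter> ball 0 1 \<subseteq> \<Gamma>"
    and g: "is_robin_function D \<Gamma> a r g" and x: "x \<in> frontier D - \<Gamma>"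
  shows "inward_deriv g x (if \<Gamma> = {} then 1 / surface_area (frontier D) else 0)"
  using g x by (intro has_inward_normal_deriv_imp_inward_deriv[OF frontier_locally_ball(1)[OF D \<Gamma> x] D(2)])
    (auto simp: is_robin_function_def)

text \<open>The singularities at \<open>a\<close> cancel, and so do the fluxes, also the constant
  one for \<open>\<Gamma> = {}\<close>. \<open>C\<close> and \<open>K\<close> are left general to
  serve both subdomains and the ball with a small ball removed.\<close>

lemma supersol_robin_diff:
  fixes a :: "'a::euclidean_space"
  assumes n: "DIM('a) \<ge> 3" and D: "open D" "D \<subseteq> ball 0 1" and \<Gamma>: "closed \<Gamma>" "frontier D \<inter> ball 0 1 \<subseteq> \<Gamma>"
    and g: "is_robin_function D \<Gamma> a r g" "is_robin_function D \<Gamma> a r' g'"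
    and C: "C \<subseteq> closure D" "C - K \<subseteq> closure D - \<Gamma>"
  shows "supersol C K a (\<lambda>x. g x - g' x)"
  unfolding supersol_def
proof (intro conjI ballI impI)
  have "continuous_on (closure D - {a}) (\<lambda>x. g x - g' x)"
    using g by (intro continuous_intros) (auto simp: is_robin_function_def)
  then have "continuous_on (closure D) (\<lambda>x. g x - g' x)"
    by (rule continuous_on_insert_limit) (rule robin_diff_tendsto[OF n g])
  then show "continuous_on C (\<lambda>x. g x - g' x)" using C(1) by (rule continuous_on_subset)
next
  fix x assume x: "x \<in> C - K" "x \<noteq> a" "norm x < 1"
  have "x \<in> D"
  proof (rule ccontr)
    assume "x \<notin> D"
    then have "x \<in> frontier D - \<Gamma>" using x C D(1) by (auto simp: frontier_def interior_open)
    then show False using \<Gamma>(2) x(3) by auto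
  qed
  then have "has_lap (\<lambda>x. g x + (- 1) * g' x) x (0 + (- 1) * 0)"
    using g x(2) by (intro has_lap_add has_lap_cmult harmonic_on_has_lap[where S = "D - {a}"]) (auto simp: is_robin_function_def)
  then show "\<exists>L\<le>0. has_lap (\<lambda>x. g x - g' x) x L" by auto
next
  fix x assume x: "x \<in> C - K" "norm x = 1"
  then have xf: "x \<in> frontier D - \<Gamma>" using C D by (auto simp: frontier_def interior_open)
  have "inward_deriv (\<lambda>x. g x + (- 1) * g' x) x ((if \<Gamma> = {} then 1 / surface_area (frontier D) else 0) +
      (- 1) * (if \<Gamma> = {} then 1 / surface_area (frontier D) else 0))"
    by (intro inward_deriv_add inward_deriv_cmult robin_inward_deriv[OF D \<Gamma> g(1) xf] robin_inward_deriv[OF D \<Gamma> g(2) xf])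
  then show "\<exists>d\<le>0. inward_deriv (\<lambda>x. g x - g' x) x d" by auto
qed

text \<open>The minimum principle with \<open>K = \<Gamma>\<close>, where both functions vanish. The
  point \<open>b\<close> is the second pole of the barrier. Exchanging \<open>g\<close> and
  \<open>g'\<close> gives equality.\<close>

lemma robin_pole_value_unique:
  fixes a b :: "'a::euclidean_space"
  assumes n: "DIM('a) \<ge> 3" and D: "open D" "D \<subseteq> ball 0 1" and a: "a \<in> D"
    and \<Gamma>: "closed \<Gamma>" "frontier D \<inter> ball 0 1 \<subseteq> \<Gamma>" "\<Gamma> \<subseteq> frontier D"
    and b: "b \<notin> closure D" "norm b < 1"
    and g: "is_robin_function D \<Gamma> a r g" "is_robin_function D \<Gamma> a r' g'"
  shows "g a \<le> g' a"
proof -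
  have comp: "compact (closure D)" using D(2) bounded_subset[OF bounded_ball] by (auto simp: compact_closure)
  have sub: "\<Gamma> \<subseteq> closure D" using \<Gamma>(3) by (auto simp: frontier_def)
  have aG: "a \<notin> \<Gamma>" using a D(1) \<Gamma>(3) by (auto simp: frontier_def interior_open)
  have cell: "cell (closure D) \<Gamma> a"
    unfolding cell_def
  proof (intro conjI)
    show "compact \<Gamma>" using compact_Int_closed[OF comp \<Gamma>(1)] sub by (simp add: Int_absorb1)
    show "\<forall>x\<in>closure D - \<Gamma>. \<exists>r>0. cball 0 1 \<inter> ball x r \<subseteq> closure D"
      using closure_rel_open[OF D \<Gamma>(1,2)] by blast
    show "norm a < 1" using a D(2) by auto
  qed (use comp sub aG closure_subset_cball[OF D(2)] in auto)
  have "g' a - g a \<ge> 0"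
  proof (rule minimum_principle[OF cell supersol_robin_diff[OF n D \<Gamma>(1,2) g(2,1)] barrier_neumann[OF n cell b]])
    fix x assume "x \<in> \<Gamma>"
    then show "0 \<le> g' x - g x" using g by (simp add: is_robin_function_def)
  qed (use a closure_subset in auto)
  then show ?thesis by simp
qed

text \<open>The value at the pole fixes the signed power of the radius, hence the radius, so the
  definite description in \<open>robin_radius\<close> denotes the given \<open>r\<close>.\<close>

lemma robin_radius_value:
  fixes a b :: "'a::euclidean_space"
  assumes n: "DIM('a) \<ge> 3" and D: "open D" "D \<subseteq> ball 0 1" and a: "a \<in> D"
    and \<Gamma>: "closed \<Gamma>" "frontier D \<inter> ball 0 1 \<subseteq> \<Gamma>" "\<Gamma> \<subseteq> frontier D"
    and b: "b \<notin> closure D" "norm b < 1"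
    and g: "is_robin_function D \<Gamma> a r g"
  shows "- lam DIM('a) * robin_radius D a \<Gamma> spowr (2 - real DIM('a)) = g a"
proof -
  have l: "lam DIM('a) > 0" using lam_pos[OF n] .
  have "robin_radius D a \<Gamma> = r"
    unfolding robin_radius_def
  proof (rule the_equality)
    fix r' assume "\<exists>g. is_robin_function D \<Gamma> a r' g"
    then obtain g' where g': "is_robin_function D \<Gamma> a r' g'" by blast
    have "g' a = g a"
      using robin_pole_value_unique[OF n D a \<Gamma> b g g'] robin_pole_value_unique[OF n D a \<Gamma> b g' g] by simp
    then have "r' spowr (2 - real DIM('a)) = r spowr (2 - real DIM('a))"
      using g g' l by (simp add: is_robin_function_def)
    moreover have "2 - real DIM('a) \<noteq> 0" using n by simp
    ultimately show "r' = r" using spowr_ex1 by blast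
  qed (use g in blast)
  then show ?thesis using g by (simp add: is_robin_function_def)
qed

section \<open>The Neumann function of the ball and the reduced modulus\<close>

lemma inward_unit_normal_ball:
  fixes z :: "'a::euclidean_space"
  assumes "norm z = 1"
  shows "inward_unit_normal (ball 0 1) z (- z)"
  unfolding inward_unit_normal_def
proof (intro exI[of _ UNIV] exI[of _ "\<lambda>x. 1 - x \<bullet> x"] exI[of _ "\<lambda>x. - (2 *\<^sub>R x)"] conjI ballI)
  show "GDERIV (\<lambda>x. 1 - x \<bullet> x) x :> - (2 *\<^sub>R x)" for x :: 'a
    unfolding gderiv_def by (auto intro!: derivative_eq_intros simp: inner_commute)
  show "ball 0 1 \<inter> UNIV = {x \<in> UNIV. 0 < 1 - x \<bullet> (x::'a)}"
    by (auto simp: norm_eq_sqrt_inner)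
  show "- (2 *\<^sub>R z) \<noteq> 0" using assms by auto
qed (use assms in \<open>auto simp: norm_eq_1[symmetric] intro!: continuous_intros\<close>)

lemma is_robin_function_neumann:
  fixes y :: "'a::euclidean_space"
  assumes n: "DIM('a) \<ge> 3" and y: "norm y < 1"
  shows "\<exists>r. is_robin_function (ball 0 1) {} y r (\<lambda>x. lam DIM('a) * neumann y x)"
proof -
  have l: "lam DIM('a) > 0" using lam_pos[OF n] .
  \<comment> \<open>\<open>regpart y y\<close> is positive, so in this normalisation the signed
    power is negative and so is \<open>r\<close>.\<close>
  obtain r where r: "r spowr (2 - real DIM('a)) = - regpart y y"
    using spowr_ex1[of "2 - real DIM('a)" "- regpart y y"] n by auto
  let ?g = "\<lambda>x. lam DIM('a) * neumann y x"
  have harm: "?g harmonic_on (ball 0 1 - {y})"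
    unfolding harmonic_on_def
  proof (intro conjI exI[of _ "\<lambda>x. lam DIM('a) *\<^sub>R (qgrad 1 (- y) (y \<bullet> y + 0) x + regpart_grad y x)"]
      exI[of _ "\<lambda>x v. lam DIM('a) *\<^sub>R (qhess 1 (- y) (y \<bullet> y + 0) x v + regpart_hess y x v)"] ballI allI)
    have p: "qf 1 (- y) (y \<bullet> y + 0) x > 0" "norm x * norm y < 1" if "x \<in> ball 0 1 - {y}" for x
      using that prod_less_1[OF _ y, of x] unfolding newton_base by auto
    show "GDERIV ?g x :> lam DIM('a) *\<^sub>R (qgrad 1 (- y) (y \<bullet> y + 0) x + regpart_grad y x)" if "x \<in> ball 0 1 - {y}" for x
      unfolding neumann_def newton_def using p[OF that]
      by (intro GDERIV_cmult GDERIV_add GDERIV_qpow regpart_GDERIV)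
    show "((\<lambda>x. lam DIM('a) *\<^sub>R (qgrad 1 (- y) (y \<bullet> y + 0) x + regpart_grad y x)) has_derivative
        (\<lambda>v. lam DIM('a) *\<^sub>R (qhess 1 (- y) (y \<bullet> y + 0) x v + regpart_hess y x v))) (at x)" if "x \<in> ball 0 1 - {y}" for x
      using p[OF that] by (intro has_derivative_scaleR_right has_derivative_add qgrad_has_derivative regpart_grad_has_derivative)
    show "continuous_on (ball 0 1 - {y}) (\<lambda>x. lam DIM('a) *\<^sub>R (qhess 1 (- y) (y \<bullet> y + 0) x v + regpart_hess y x v))" for v
      using p by (intro continuous_intros continuous_on_qhess continuous_on_regpart_hess)
    show "(\<Sum>b\<in>Basis. lam DIM('a) *\<^sub>R (qhess 1 (- y) (y \<bullet> y + 0) x b + regpart_hess y x b) \<bullet> b) = 0" if "x \<in> ball 0 1 - {y}" for x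
    proof -
      have "(\<Sum>b\<in>Basis. lam DIM('a) *\<^sub>R (qhess 1 (- y) (y \<bullet> y + 0) x b + regpart_hess y x b) \<bullet> b) =
          lam DIM('a) * ((\<Sum>b\<in>Basis. qhess 1 (- y) (y \<bullet> y + 0) x b \<bullet> b) + (\<Sum>b\<in>Basis. regpart_hess y x b \<bullet> b))"
        by (simp add: sum_distrib_left[symmetric] sum.distrib inner_add_left)
      then show ?thesis unfolding trace_qhess[OF p(1)[OF that]] trace_regpart_hess[OF p(2)[OF that]] by simp
    qed
  qed auto
  have cont: "continuous_on (closure (ball 0 1) - {y}) ?g"
    using continuous_on_neumann[OF y] by (intro continuous_intros) simp
  have bd: "has_inward_normal_deriv ?g (ball 0 1) z (1 / surface_area (frontier (ball (0::'a) 1)))"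
    if z: "z \<in> frontier (ball 0 1) - {}" for z
  proof -
    have nz: "norm z = 1" using z by simp
    have "inward_deriv ?g z (lam DIM('a) * (real DIM('a) - 2))" by (intro inward_deriv_cmult inward_deriv_neumann y nz)
    moreover have "lam DIM('a) * (real DIM('a) - 2) = 1 / surface_area (frontier (ball (0::'a) 1))"
      using n by (simp add: lam_def surface_area_unit_sphere)
    ultimately show ?thesis
      unfolding has_inward_normal_deriv_def using inward_unit_normal_ball[OF nz]
      by (intro exI[of _ "- z"]) (simp add: inward_deriv_def)
  qed
  have lim: "((\<lambda>z. ?g z / lam DIM('a) - (norm (z - y) powr (2 - real DIM('a)) - r spowr (2 - real DIM('a)))) \<longlongrightarrow> 0) (at y)"
  proof -
    have "isCont (regpart y) y"
      using continuous_on_interior[OF continuous_on_regpart_fixed[OF y], of y] y by simp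
    then have "((\<lambda>z. regpart y z - regpart y y) \<longlongrightarrow> regpart y y - regpart y y) (at y)"
      unfolding isCont_def by (intro tendsto_intros)
    then show ?thesis using l by (simp add: neumann_def newton_0_eq r)
  qed
  have "is_robin_function (ball 0 1) {} y r ?g"
    unfolding is_robin_function_def using harm cont bd lim by (simp add: r neumann_diag)
  then show ?thesis by blast
qed

text \<open>On the whole ball with \<open>\<Gamma> = {}\<close> there is neither a set
  \<open>K\<close> nor a point outside the cell for the barrier. Removing a small ball about
  \<open>b\<close> provides both: \<open>b\<close> becomes the second pole, and on the small sphere
  the difference \<open>h\<close> is within \<open>e\<close> of \<open>h b\<close>. Thus
  \<open>h b \<le> h x\<close> for all distinct \<open>b\<close> and \<open>x\<close> off the pole,
  so \<open>h\<close> is constant there, and continuity covers the pole.\<close>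

lemma robin_ball_unique:
  fixes y :: "'a::euclidean_space"
  assumes n: "DIM('a) \<ge> 3" and y: "norm y < 1"
    and g: "is_robin_function (ball 0 1) {} y r g" "is_robin_function (ball 0 1) {} y r' g'"
  shows "\<exists>c. \<forall>x\<in>ball 0 1. g x - g' x = c"
proof -
  define h where "h x = g x - g' x" for x
  have D: "open (ball 0 (1::real) :: 'a set)" "ball (0::'a) 1 \<subseteq> ball 0 1"
    "closed ({}::'a set)" by auto
  have fr: "frontier (ball (0::'a) 1) \<inter> ball 0 1 \<subseteq> {}" by auto
  have hc: "continuous_on (cball 0 1) h"
  proof -
    have "supersol (closure (ball 0 1)) {} y h"
      unfolding h_def[abs_def] by (rule supersol_robin_diff[OF n D fr g]) auto
    then show ?thesis by (simp add: supersol_def)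
  qed
  have le: "h b \<le> h x" if b: "b \<in> ball 0 1" "b \<noteq> y" and x: "x \<in> ball 0 1" "x \<noteq> b" "x \<noteq> y" for b x
  proof (rule field_le_epsilon)
    fix e :: real assume e: "e > 0"
    have "continuous_on (ball 0 1) h" using hc by (rule continuous_on_subset) auto
    then have "isCont h b" using b by (simp add: continuous_on_eq_continuous_at)
    then obtain d where d: "d > 0" "\<And>z. dist z b < d \<Longrightarrow> dist (h z) (h b) < e"
      using e unfolding continuous_at_eps_delta by blast
    \<comment> \<open>Besides the continuity radius \<open>d\<close>, the bounds keep
      \<open>y\<close> and \<open>x\<close> outside the removed ball and the small sphere inside the
      unit ball.\<close>
    have "0 < min (min d (dist b y)) (min (dist x b) (1 - norm b))" using d(1) b x by simp
    then obtain \<rho> where "0 < \<rho>" "\<rho> < min (min d (dist b y)) (min (dist x b) (1 - norm b))"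
      using dense by blast
    then have \<rho>: "\<rho> > 0" "\<rho> < d" "\<rho> < dist b y" "\<rho> < dist x b" "\<rho> < 1 - norm b" by simp_all
    define C where "C = cball 0 1 - ball b \<rho>"
    have sph: "sphere b \<rho> \<subseteq> C"
    proof
      fix z assume z: "z \<in> sphere b \<rho>"
      have "norm z \<le> norm b + dist b z" using norm_triangle_ineq2[of z b] by (simp add: dist_norm norm_minus_commute)
      then show "z \<in> C" using z \<rho> by (auto simp: C_def)
    qed
    have cell: "cell C (sphere b \<rho>) y"
      unfolding cell_def
    proof (intro conjI ballI)
      show "compact C" unfolding C_def by (intro compact_diff) auto
      fix z assume "z \<in> C - sphere b \<rho>"
      then have z: "z \<in> cball 0 1" "dist b z > \<rho>" by (auto simp: C_def)
      have "ball z (dist b z - \<rho>) \<inter> ball b \<rho> = {}"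
        by (rule disjoint_ballI) (simp add: dist_commute)
      then show "\<exists>r>0. cball 0 1 \<inter> ball z r \<subseteq> C"
        using z(2) by (intro exI[of _ "dist b z - \<rho>"]) (auto simp: C_def)
    qed (use y \<rho> sph in \<open>auto simp: C_def\<close>)
    have bC: "b \<notin> C" using \<rho>(1) by (simp add: C_def)
    have bn: "norm b < 1" using b(1) by simp
    have "supersol C (sphere b \<rho>) y h"
      unfolding h_def[abs_def] by (rule supersol_robin_diff[OF n D fr g]) (auto simp: C_def)
    then have "h b - e \<le> h x"
    proof (rule minimum_principle[OF cell _ barrier_neumann[OF n cell bC bn]])
      fix z assume "z \<in> sphere b \<rho>"
      then have "dist (h z) (h b) < e" using \<rho>(2) by (intro d(2)) (simp add: dist_commute)
      then show "h b - e \<le> h z" by (simp add: dist_real_def abs_less_iff)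
    next
      show "x \<in> C" using x \<rho>(4) by (simp add: C_def dist_commute)
    qed
    then show "h b \<le> h x + e" by simp
  qed
  \<comment> \<open>Of two opposite points at least one differs from the pole.\<close>
  obtain b where b: "b \<in> ball 0 1" "b \<noteq> y"
  proof -
    obtain u :: 'a where u: "u \<in> Basis" using nonempty_Basis by blast
    have "norm (u /\<^sub>R 2) < 1" "norm (- (u /\<^sub>R 2)) < 1" "u /\<^sub>R 2 \<noteq> - (u /\<^sub>R 2)"
      using u nonzero_Basis[OF u] by (auto simp: eq_neg_iff_add_eq_0 scaleR_add_left[symmetric])
    then show ?thesis using that[of "u /\<^sub>R 2"] that[of "- (u /\<^sub>R 2)"] by (cases "u /\<^sub>R 2 = y") auto
  qed
  have eq: "h x = h b" if "x \<in> ball 0 1" "x \<noteq> y" for x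
    using le[OF b that(1) _ that(2)] le[OF that b(1) _ b(2)] by (cases "x = b") auto
  have "h y = h b"
  proof -
    have "continuous_on (ball 0 1) h" using hc by (rule continuous_on_subset) auto
    then have "isCont h y" using y by (simp add: continuous_on_eq_continuous_at)
    then have 1: "(h \<longlongrightarrow> h y) (at y)" by (simp add: isCont_def)
    have "\<forall>\<^sub>F x in nhds y. x \<in> ball 0 1" using y by (intro eventually_nhds_in_open) auto
    then have "\<forall>\<^sub>F x in at y. h b = h x" unfolding eventually_at_filter
      by eventually_elim (use eq in auto)
    then have 2: "(h \<longlongrightarrow> h b) (at y)" by (rule tendsto_eventually[OF eventually_mono]) auto
    show ?thesis by (rule tendsto_unique[OF _ 1 2]) (simp add: trivial_limit_at)
  qed
  then show ?thesis using eq unfolding h_def by (metis (no_types, lifting))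
qed

text \<open>The choice operator may pick any Robin function of the ball; by uniqueness it differs
  from the explicit one by a constant.\<close>

lemma robin_function_ball:
  fixes y :: "'a::euclidean_space"
  assumes n: "DIM('a) \<ge> 3" and y: "norm y < 1"
  shows "\<exists>c. \<forall>x\<in>ball 0 1. robin_function {} x y (ball 0 1) = lam DIM('a) * neumann y x + c"
proof -
  obtain r where r: "is_robin_function (ball 0 1) {} y r (\<lambda>x. lam DIM('a) * neumann y x)"
    using is_robin_function_neumann[OF n y] by blast
  define g where "g = (SOME g. \<exists>r. is_robin_function (ball 0 1) {} y r g)"
  have "\<exists>r. is_robin_function (ball 0 1) {} y r g"
    unfolding g_def using r by (intro someI_ex[of "\<lambda>g. \<exists>r. is_robin_function (ball 0 1) {} y r g"]) blast
  then obtain r' where r': "is_robin_function (ball 0 1) {} y r' g" by blast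
  obtain c where "\<forall>x\<in>ball 0 1. g x - lam DIM('a) * neumann y x = c"
    using robin_ball_unique[OF n y r' r] by blast
  then show ?thesis
    unfolding robin_function_def g_def[symmetric] by (intro exI[of _ c]) (auto simp: algebra_simps)
qed

text \<open>Each additive constant is multiplied by the sum of the coefficients 1 and -1 and
  disappears.\<close>

lemma reduced_modulus_ball:
  fixes a\<^sub>1 a\<^sub>2 :: "'a::euclidean_space"
  assumes n: "DIM('a) \<ge> 3" and a: "norm a\<^sub>1 < 1" "norm a\<^sub>2 < 1"
  shows "reduced_modulus (ball 0 1) {} [a\<^sub>1, a\<^sub>2] [1, - 1] =
    lam DIM('a) * (regpart a\<^sub>1 a\<^sub>1 + regpart a\<^sub>2 a\<^sub>2 - 2 * neumann a\<^sub>1 a\<^sub>2)"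
proof -
  obtain c\<^sub>1 c\<^sub>2 where
    "\<forall>x\<in>ball 0 1. robin_function {} x a\<^sub>1 (ball 0 1) = lam DIM('a) * neumann a\<^sub>1 x + c\<^sub>1"
    "\<forall>x\<in>ball 0 1. robin_function {} x a\<^sub>2 (ball 0 1) = lam DIM('a) * neumann a\<^sub>2 x + c\<^sub>2"
    using robin_function_ball[OF n a(1)] robin_function_ball[OF n a(2)] by blast
  then show ?thesis
    using a by (simp add: reduced_modulus_def lessThan_Suc numeral_2_eq_2 neumann_diag neumann_commute[of a\<^sub>2 a\<^sub>1] algebra_simps)
qed

section \<open>Level sets of Robin functions\<close>

text \<open>The pole is added by hand because \<open>g a\<close> is only the constant term of the
  expansion and may lie below \<open>\<delta>\<close>. Near \<open>a\<close> the function exceeds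
  \<open>\<delta>\<close>, so \<open>C\<close> is closed at the pole and \<open>K\<close> stays away
  from it. As \<open>g\<close> vanishes on \<open>\<Gamma>\<close>, a positive level keeps
  \<open>C\<close> off \<open>\<Gamma>\<close>.\<close>

lemma robin_cell:
  fixes a :: "'a::euclidean_space"
  assumes n: "DIM('a) \<ge> 3" and D: "open D" "D \<subseteq> ball 0 1" and a: "a \<in> D"
    and \<Gamma>: "closed \<Gamma>" "frontier D \<inter> ball 0 1 \<subseteq> \<Gamma>" "\<Gamma> \<subseteq> frontier D"
    and g: "is_robin_function D \<Gamma> a r g" and \<delta>: "\<delta> > 0"
    and C: "C = {x \<in> closure D. x = a \<or> \<delta> \<le> g x}" and K: "K = {x \<in> closure D. x \<noteq> a \<and> g x = \<delta>}"
  shows "cell C K a" "C \<subseteq> closure D - \<Gamma>"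
proof -
  have gc: "continuous_on (closure D - {a}) g" and g0: "\<And>x. x \<in> \<Gamma> \<Longrightarrow> g x = 0"
    using g by (auto simp: is_robin_function_def)
  have aG: "a \<notin> \<Gamma>" using a D(1) \<Gamma>(3) by (auto simp: frontier_def interior_open)
  show sub: "C \<subseteq> closure D - \<Gamma>" using aG g0 \<delta> by (force simp: C)
  have comp: "compact (closure D)" using D(2) bounded_subset[OF bounded_ball] by (auto simp: compact_closure)
  have "\<forall>\<^sub>F x in at a. \<delta> < g x"
    using robin_filterlim[OF n g] by (simp add: filterlim_at_top_dense)
  then obtain \<rho>1 where \<rho>1: "\<rho>1 > 0" "\<And>x. x \<noteq> a \<Longrightarrow> dist x a < \<rho>1 \<Longrightarrow> \<delta> < g x"
    unfolding eventually_at by auto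
  obtain \<rho>2 where \<rho>2: "\<rho>2 > 0" "ball a \<rho>2 \<subseteq> D" using D(1) a open_contains_ball by blast
  define \<rho> where "\<rho> = min \<rho>1 \<rho>2"
  have \<rho>: "\<rho> > 0" "\<And>x. x \<noteq> a \<Longrightarrow> dist x a < \<rho> \<Longrightarrow> \<delta> < g x" "ball a \<rho> \<subseteq> closure D"
    using \<rho>1 \<rho>2 closure_subset[of D] by (auto simp: \<rho>_def)
  \<comment> \<open>Outside this ball \<open>g\<close> is continuous on a compact set; half the
    radius leaves room inside the region where \<open>g\<close> exceeds
    \<open>\<delta>\<close>.\<close>
  define S where "S = closure D - ball a (\<rho> / 2)"
  have S: "compact S" "closed S" "S \<subseteq> closure D - {a}"
    unfolding S_def using comp \<rho>(1) by (auto intro: compact_diff compact_imp_closed)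
  have gS: "continuous_on S g" using gc S(3) by (rule continuous_on_subset)
  have cl: "closed {x \<in> S. \<delta> \<le> g x}" "closed {x \<in> S. g x \<le> \<delta>}"
    using S(2) gS by (intro continuous_on_closed_Collect_le continuous_on_const; simp)+
  have C_eq: "C = {x \<in> S. \<delta> \<le> g x} \<union> cball a (\<rho> / 2)"
  proof
    show "C \<subseteq> {x \<in> S. \<delta> \<le> g x} \<union> cball a (\<rho> / 2)" using \<rho>(1) by (auto simp: C S_def)
    show "{x \<in> S. \<delta> \<le> g x} \<union> cball a (\<rho> / 2) \<subseteq> C"
    proof
      fix x assume "x \<in> {x \<in> S. \<delta> \<le> g x} \<union> cball a (\<rho> / 2)"
      then consider "x \<in> S" "\<delta> \<le> g x" | "dist x a < \<rho>" using \<rho>(1) by (force simp: dist_commute)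
      then show "x \<in> C"
      proof cases
        case 1
        then show ?thesis using S(3) by (auto simp: C)
      next
        case 2
        then have "x \<in> closure D" using \<rho>(3) by (auto simp: dist_commute)
        then show ?thesis using \<rho>(2)[of x, OF _ 2] by (cases "x = a") (auto simp: C)
      qed
    qed
  qed
  have K_eq: "K = S \<inter> ({x \<in> S. \<delta> \<le> g x} \<inter> {x \<in> S. g x \<le> \<delta>})"
  proof
    show "K \<subseteq> S \<inter> ({x \<in> S. \<delta> \<le> g x} \<inter> {x \<in> S. g x \<le> \<delta>})"
    proof
      fix x assume x: "x \<in> K"
      then have "\<not> dist x a < \<rho>" using \<rho>(2)[of x] by (auto simp: K)
      then show "x \<in> S \<inter> ({x \<in> S. \<delta> \<le> g x} \<inter> {x \<in> S. g x \<le> \<delta>})"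
        using x \<rho>(1) by (auto simp: K S_def dist_commute)
    qed
    show "S \<inter> ({x \<in> S. \<delta> \<le> g x} \<inter> {x \<in> S. g x \<le> \<delta>}) \<subseteq> K" using S(3) by (auto simp: K)
  qed
  show "cell C K a"
    unfolding cell_def
  proof (intro conjI ballI)
    have "{x \<in> S. \<delta> \<le> g x} = S \<inter> {x \<in> S. \<delta> \<le> g x}" by auto
    then have "compact {x \<in> S. \<delta> \<le> g x}" using compact_Int_closed[OF S(1) cl(1)] by simp
    then show "compact C" unfolding C_eq by (intro compact_Un) auto
    show "compact K" unfolding K_eq by (rule compact_Int_closed[OF S(1) closed_Int[OF cl]])
    show "C \<subseteq> cball 0 1" using closure_subset_cball[OF D(2)] by (auto simp: C)
    show "K \<subseteq> C" "a \<notin> K" by (auto simp: C K)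
    show "norm a < 1" using a D(2) by auto
  next
    fix x assume x: "x \<in> C - K"
    show "\<exists>r>0. cball 0 1 \<inter> ball x r \<subseteq> C"
    proof (cases "x = a")
      case True
      have "ball a \<rho> \<subseteq> C" using \<rho>(2,3) by (force simp: C dist_commute)
      then show ?thesis using True \<rho>(1) by (intro exI[of _ \<rho>]) auto
    next
      case False
      then have gx: "g x > \<delta>" and xc: "x \<in> closure D - {a}" using x by (auto simp: C K)
      obtain r where r: "r > 0" "cball 0 1 \<inter> ball x r \<subseteq> closure D"
        using closure_rel_open[OF D \<Gamma>(1,2), of x] x sub by blast
      obtain d where d: "d > 0" "\<And>y. y \<in> closure D - {a} \<Longrightarrow> dist y x < d \<Longrightarrow> dist (g y) (g x) < g x - \<delta>"
        using gc xc gx unfolding continuous_on_iff by (metis diff_gt_0_iff_gt)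
      have "cball 0 1 \<inter> ball x (min r d) \<subseteq> C"
      proof
        fix y assume y: "y \<in> cball 0 1 \<inter> ball x (min r d)"
        then have yc: "y \<in> closure D" using r(2) by auto
        show "y \<in> C"
        proof (cases "y = a")
          case False
          then have "dist (g y) (g x) < g x - \<delta>" using d(2)[of y] yc y by (auto simp: dist_commute)
          then show ?thesis using yc by (auto simp: C dist_real_def)
        qed (use yc in \<open>auto simp: C\<close>)
      qed
      then show ?thesis using r(1) d(1) by (intro exI[of _ "min r d"]) auto
    qed
  qed
qed

text \<open>Near a point of \<open>closure D1 - \<Gamma>\<close> the domain \<open>D1\<close> fills
  the ball and leaves no room for \<open>D2\<close>. This separates the level set of one domain from
  the cell of the other.\<close>

lemma closure_off_Gamma_disjoint:
  fixes D1 :: "'a::euclidean_space set"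
  assumes D: "open D1" "D1 \<subseteq> ball 0 1" and \<Gamma>: "closed \<Gamma>" "frontier D1 \<inter> ball 0 1 \<subseteq> \<Gamma>"
    and D2: "D2 \<subseteq> ball 0 1" "D1 \<inter> D2 = {}"
  shows "(closure D1 - \<Gamma>) \<inter> closure D2 = {}"
proof (rule ccontr)
  assume "(closure D1 - \<Gamma>) \<inter> closure D2 \<noteq> {}"
  then obtain x where x: "x \<in> closure D1 - \<Gamma>" "x \<in> closure D2" by blast
  have "\<exists>r>0. ball 0 1 \<inter> ball x r \<subseteq> D1"
  proof (cases "x \<in> D1")
    case True
    then obtain r where "r > 0" "ball x r \<subseteq> D1" using D(1) open_contains_ball by blast
    then show ?thesis by (intro exI[of _ r]) auto
  next
    case False
    then have "x \<in> frontier D1 - \<Gamma>" using x D(1) by (simp add: frontier_def interior_open)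
    then show ?thesis by (rule frontier_locally_ball(2)[OF D \<Gamma>])
  qed
  then obtain r where r: "r > 0" "ball 0 1 \<inter> ball x r \<subseteq> D1" by blast
  have "x \<in> ball x r" using r(1) by simp
  then have "ball x r \<inter> D2 \<noteq> {}" using x(2) open_Int_closure_eq_empty[of "ball x r" D2] by blast
  then show False using r(2) D2 by blast
qed

section \<open>The regularised Neumann kernel\<close>

text \<open>
  A bounded substitute for the Neumann function, superharmonic in each variable and positive definite on masses of
  total zero.  Moving the pole of the regular part inwards by the factor \<open>1 - \<theta> / 4\<close> gives the inward derivative
  the sign required of a supersolution (\<open>flux_excess_nonneg\<close>).
\<close>

definition reg_kernel :: "real \<Rightarrow> 'a::euclidean_space \<Rightarrow> 'a \<Rightarrow> real" where
  "reg_kernel \<theta> y x = newton \<theta> y x + regpart ((1 - \<theta> / 4) *\<^sub>R y) x"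

text \<open>The amount by which the flux of \<open>reg_kernel\<close> falls short of the flux
  \<open>n - 2\<close> of the Neumann function, divided by \<open>n - 2\<close>.\<close>

definition flux_excess :: "real \<Rightarrow> 'a::euclidean_space \<Rightarrow> 'a \<Rightarrow> real" where
  "flux_excess \<theta> y x = ((norm (x - (1 - \<theta> / 4) *\<^sub>R y))\<^sup>2) powr (- (real DIM('a) / 2)) * (1 - x \<bullet> ((1 - \<theta> / 4) *\<^sub>R y)) -
     ((norm (x - y))\<^sup>2 + \<theta>) powr (- (real DIM('a) / 2)) * (1 - x \<bullet> y)"

lemma reg_kernel_commute: "reg_kernel \<theta> y x = reg_kernel \<theta> x y"
  by (simp add: reg_kernel_def newton_commute regpart_scale_commute)

lemma qform_reg_kernel_nonneg:
  fixes T :: "'a::euclidean_space set"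
  assumes n: "DIM('a) \<ge> 3" and T: "finite T" "T \<subseteq> cball 0 1" and \<theta>: "0 < \<theta>" "\<theta> < 1" and c: "sum c T = 0"
  shows "0 \<le> qform T c (\<lambda>x y. reg_kernel \<theta> y x)"
  unfolding reg_kernel_def qform_add
  using qform_newton_nonneg[OF n T(1) \<theta>(1)] qform_regpart_nonneg[OF n T _ _ c, of "1 - \<theta> / 4"] \<theta> by simp

lemma norm_scaled_less_1:
  assumes "norm y \<le> 1" "0 < \<theta>" "\<theta> < (1::real)"
  shows "norm ((1 - \<theta> / 4) *\<^sub>R y) < 1"
  using prod_scaled_less_1[of y y "1 - \<theta> / 4"] prod_scaled_less_1[of "y /\<^sub>R norm y" y "1 - \<theta> / 4"] assms
  by (cases "y = 0") auto

lemma has_lap_reg_kernel: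
  fixes x y :: "'a::euclidean_space"
  assumes "norm x \<le> 1" "norm y \<le> 1" "0 < \<theta>" "\<theta> < 1"
  shows "has_lap (reg_kernel \<theta> y) x (- (\<theta> * (real DIM('a) * (real DIM('a) - 2) *
           ((norm (x - y))\<^sup>2 + \<theta>) powr (- (real DIM('a) / 2) - 1))))"
proof -
  have p: "(norm (x - y))\<^sup>2 + \<theta> > 0" using assms(3) by (simp add: add_nonneg_pos)
  have "norm x * norm ((1 - \<theta> / 4) *\<^sub>R y) < 1" using assms by (intro prod_scaled_less_1) auto
  from has_lap_add[OF has_lap_newton[OF p] has_lap_regpart[OF this]]
  show ?thesis unfolding reg_kernel_def[abs_def] by simp
qed

lemma inward_deriv_reg_kernel:
  fixes x y :: "'a::euclidean_space"
  assumes "norm x = 1" "norm y \<le> 1" "0 < \<theta>" "\<theta> < 1"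
  shows "inward_deriv (reg_kernel \<theta> y) x ((real DIM('a) - 2) * (1 - flux_excess \<theta> y x))"
proof -
  have p: "(norm (x - y))\<^sup>2 + \<theta> > 0" using assms(3) by (simp add: add_nonneg_pos)
  from inward_deriv_add[OF inward_deriv_newton[OF assms(1) p] inward_deriv_regpart[OF assms(1) norm_scaled_less_1[OF assms(2-4)]]]
  show ?thesis unfolding reg_kernel_def[abs_def] flux_excess_def by (simp add: algebra_simps)
qed

text \<open>The bases satisfy \<open>B \<le> A\<close>. For \<open>q \<ge> 0\<close> the two factors
  compare separately. For \<open>q < 0\<close> the factor \<open>1 - s * q\<close> is the smaller
  one and a power of the base has to pay: \<open>(1 - q) * B \<le> (1 - s * q) * A\<close>. The gain
  is at least \<open>\<theta>\<close>, since \<open>A - B \<ge> \<theta>\<close>; the loss is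
  \<open>(\<theta> / 4) * (- q) * B\<close>, at most \<open>\<theta>\<close> because
  \<open>B \<le> 4\<close> for two points of the closed unit ball. This is the origin of the factor
  \<open>1 - \<theta> / 4\<close>.\<close>

lemma flux_excess_nonneg:
  fixes x y :: "'a::euclidean_space"
  assumes n: "DIM('a) \<ge> 3" and x: "norm x = 1" and y: "norm y \<le> 1" and \<theta>: "0 < \<theta>" "\<theta> < 1"
  shows "flux_excess \<theta> y x \<ge> 0"
proof -
  define s where "s = 1 - \<theta> / 4"
  define q where "q = x \<bullet> y"
  define p where "p = y \<bullet> y"
  define A where "A = (norm (x - y))\<^sup>2 + \<theta>"
  define B where "B = (norm (x - s *\<^sub>R y))\<^sup>2"
  define m where "m = real DIM('a) / 2"
  have m: "m \<ge> 1" using n by (simp add: m_def)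
  have s: "0 < s" "s < 1" using \<theta> by (auto simp: s_def)
  have xx: "x \<bullet> x = 1" using x by (simp add: norm_eq_1)
  have p: "0 \<le> p" using y by (simp add: p_def)
  have qa: "\<bar>q\<bar> \<le> 1" using Cauchy_Schwarz_ineq2[of x y] x y by (simp add: q_def)
  have A: "A = 1 - 2 * q + p + \<theta>"
    using xx by (simp add: A_def q_def p_def power2_norm_eq_inner algebra_simps inner_commute)
  have B: "B = 1 - 2 * s * q + s\<^sup>2 * p"
    unfolding B_def q_def p_def power2_norm_eq_inner using xx
    by (simp add: algebra_simps inner_commute power2_eq_square)
  have sy: "norm (s *\<^sub>R y) < 1" unfolding s_def by (rule norm_scaled_less_1[OF y \<theta>])
  have B0: "B > 0" using sy x by (auto simp: B_def)
  have B4: "B \<le> 4"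
  proof -
    have "norm (x - s *\<^sub>R y) \<le> 2" using norm_triangle_ineq4[of x "s *\<^sub>R y"] x sy by simp
    then have "B \<le> 2\<^sup>2" unfolding B_def by (intro power_mono) auto
    then show ?thesis by simp
  qed
  have "s\<^sup>2 \<le> 1" using s by (simp add: power_le_one)
  then have sp: "s\<^sup>2 * p \<le> p" using p by (simp add: mult_left_le_one_le)
  have AB: "A - B = \<theta> - (\<theta> / 2) * q + (p - s\<^sup>2 * p)"
    unfolding A B s_def by (simp add: algebra_simps)
  have tq: "\<theta> * q \<le> \<theta>" using qa \<theta> by (simp add: mult_left_le)
  have BA: "B \<le> A" using AB sp tq \<theta> by linarith
  have A0: "A > 0" using BA B0 by simp
  have "A powr (- m) * (1 - q) \<le> B powr (- m) * (1 - s * q)"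
  proof (cases "q \<ge> 0")
    case True
    have "s * q \<le> q" using True s by (simp add: mult_left_le_one_le)
    moreover have "A powr (- m) \<le> B powr (- m)" using BA B0 m by (intro powr_mono2') auto
    ultimately show ?thesis using qa by (intro mult_mono) auto
  next
    case False
    have key: "(1 - q) * B \<le> (1 - s * q) * A"
    proof -
      have "\<theta> \<le> A - B" using AB sp False \<theta> mult_pos_neg[of \<theta> q] by simp
      moreover have "1 \<le> 1 - s * q" using False s by (simp add: mult_le_0_iff)
      ultimately have 1: "\<theta> \<le> (1 - s * q) * (A - B)"
        using \<theta> mult_mono[of 1 "1 - s * q" \<theta> "A - B"] by simp
      have "(- q) * B \<le> 1 * 4" using qa B4 B0 False by (intro mult_mono) auto
      then have 2: "(\<theta> / 4) * ((- q) * B) \<le> (\<theta> / 4) * 4" using \<theta> by (intro mult_left_mono) auto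
      have "(1 - s * q) * A - (1 - q) * B = (1 - s * q) * (A - B) - (\<theta> / 4) * ((- q) * B)"
        by (simp add: s_def field_simps)
      then show ?thesis using 1 2 by simp
    qed
    have e: "z powr (- m) = z powr (1 - m) / z" if "z > 0" for z
      using that powr_diff[of z "1 - m" 1] by simp
    have "A powr (- m) * (1 - q) = A powr (1 - m) * ((1 - q) / A)" by (simp add: e[OF A0])
    also have "\<dots> \<le> A powr (1 - m) * ((1 - s * q) / B)"
      using key A0 B0 by (intro mult_left_mono) (auto simp: field_simps)
    also have "\<dots> \<le> B powr (1 - m) * ((1 - s * q) / B)"
    proof (intro mult_right_mono)
      show "A powr (1 - m) \<le> B powr (1 - m)" using BA B0 m by (intro powr_mono2') auto
      show "0 \<le> (1 - s * q) / B" using mult_pos_neg[of s q] False s B0 by simp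
    qed
    also have "\<dots> = B powr (- m) * (1 - s * q)" by (simp add: e[OF B0])
    finally show ?thesis .
  qed
  then show ?thesis
    by (simp add: flux_excess_def s_def[symmetric] A_def[symmetric] B_def[symmetric] m_def[symmetric] q_def[symmetric])
qed

text \<open>Uniform continuity on the closed parameter interval, which includes 0, compares
  \<open>f \<theta> y\<close> with \<open>f 0 y\<close>.\<close>

lemma eventually_uniformly_small:
  fixes f :: "real \<Rightarrow> 'b::metric_space \<Rightarrow> real"
  assumes Y: "compact Y" and cont: "continuous_on ({0..c} \<times> Y) (\<lambda>w. f (fst w) (snd w))"
    and f0: "\<And>y. y \<in> Y \<Longrightarrow> f 0 y = 0" and e: "e > 0" and c: "c > 0"
  shows "\<forall>\<^sub>F \<theta> in at_right 0. \<forall>y\<in>Y. \<bar>f \<theta> y\<bar> \<le> e"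
proof -
  have "uniformly_continuous_on ({0..c} \<times> Y) (\<lambda>w. f (fst w) (snd w))"
    using Y by (intro compact_uniformly_continuous[OF cont] compact_Times) auto
  then obtain d where d: "d > 0" "\<And>w w'. w \<in> {0..c} \<times> Y \<Longrightarrow> w' \<in> {0..c} \<times> Y \<Longrightarrow> dist w' w < d \<Longrightarrow>
      dist (f (fst w') (snd w')) (f (fst w) (snd w)) < e"
    using e unfolding uniformly_continuous_on_def by metis
  have "\<bar>f \<theta> y\<bar> \<le> e" if "0 < \<theta>" "\<theta> < min d c" "y \<in> Y" for \<theta> y
    using d(2)[of "(0, y)" "(\<theta>, y)"] that f0 by (auto simp: dist_Pair_Pair dist_real_def)
  then show ?thesis
    using d(1) c by (intro eventually_at_rightI[of 0 "min d c"]) auto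
qed

section \<open>Continuity of the regularised kernel and its limit for vanishing
  regularisation\<close>

lemma continuous_on_reg_kernel:
  assumes "0 < \<theta>" "\<theta> < 1"
  shows "continuous_on (cball 0 1 \<times> cball 0 1) (\<lambda>w. reg_kernel \<theta> (snd w) (fst w))"
  unfolding reg_kernel_def
proof (intro continuous_on_add)
  show "continuous_on (cball 0 1 \<times> cball 0 1) (\<lambda>w. newton \<theta> (snd w) (fst w))"
    using assms by (intro continuous_on_newton continuous_intros) (auto simp: add_nonneg_pos)
  have "continuous_on (cball 0 1 \<times> cball 0 1) (\<lambda>w. (\<lambda>z. regpart (fst z) (snd z)) ((1 - \<theta> / 4) *\<^sub>R snd w, fst w))"
  proof (rule continuous_on_compose2[OF continuous_on_regpart])
    show "(\<lambda>w. ((1 - \<theta> / 4) *\<^sub>R snd w, fst w)) ` (cball 0 1 \<times> cball 0 1) \<subseteq> {z. norm (snd z) * norm (fst z) < 1}"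
      using prod_scaled_less_1[of _ _ "1 - \<theta> / 4"] assms by auto
  qed (intro continuous_intros)
  then show "continuous_on (cball 0 1 \<times> cball 0 1) (\<lambda>w. regpart ((1 - \<theta> / 4) *\<^sub>R snd w) (fst w))" by simp
qed

lemma continuous_on_reg_kernel_fixed:
  assumes "0 < \<theta>" "\<theta> < 1" "norm y \<le> 1"
  shows "continuous_on (cball 0 1) (reg_kernel \<theta> y)"
proof -
  have "continuous_on (cball 0 1) (\<lambda>x. (\<lambda>w. reg_kernel \<theta> (snd w) (fst w)) (x, y))"
    by (rule continuous_on_compose2[OF continuous_on_reg_kernel[OF assms(1,2)]])
       (use assms(3) in \<open>auto intro!: continuous_intros\<close>)
  then show ?thesis by simp
qed

lemma norm_diff_sq_add_pos: "x \<noteq> y \<Longrightarrow> 0 \<le> t \<Longrightarrow> (norm (x - y))\<^sup>2 + t > 0"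
  by (simp add: add_pos_nonneg)

lemma eventually_reg_kernel_near_neumann:
  fixes a :: "'a::euclidean_space"
  assumes a: "norm a < 1" and Y: "compact Y" "Y \<subseteq> cball 0 1 - {a}" and e: "e > 0"
  shows "\<forall>\<^sub>F \<theta> in at_right 0. \<forall>y\<in>Y. \<bar>reg_kernel \<theta> y a - neumann y a\<bar> \<le> e"
proof (rule eventually_uniformly_small[OF Y(1) _ _ e, of "1 / 2"])
  let ?S = "{0..1 / 2::real} \<times> Y"
  have ne: "(norm (a - snd w))\<^sup>2 + fst w > 0" if "w \<in> ?S" for w
    using that Y(2) by (intro norm_diff_sq_add_pos) auto
  have "continuous_on ?S (\<lambda>w. newton (fst w) (snd w) a)"
    using ne by (intro continuous_on_newton continuous_intros)
  moreover have "continuous_on ?S (\<lambda>w. (\<lambda>z. regpart (fst z) (snd z)) ((1 - fst w / 4) *\<^sub>R snd w, a))"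
  proof (rule continuous_on_compose2[OF continuous_on_regpart])
    have "norm a * norm ((1 - t / 4) *\<^sub>R y) < 1" if t: "0 \<le> t" "t \<le> 1 / 2" and y: "norm y \<le> 1" for t and y :: 'a
    proof -
      have "norm ((1 - t / 4) *\<^sub>R y) \<le> 1 * 1" using t y unfolding norm_scaleR by (intro mult_mono) auto
      then have "norm ((1 - t / 4) *\<^sub>R y) \<le> 1" by simp
      from prod_less_1[OF this a] show ?thesis by (simp only: mult.commute)
    qed
    then show "(\<lambda>w. ((1 - fst w / 4) *\<^sub>R snd w, a)) ` ?S \<subseteq> {z. norm (snd z) * norm (fst z) < 1}"
      using Y(2) by auto
  qed (intro continuous_intros, auto)
  moreover have "continuous_on ?S (\<lambda>w. neumann (snd w) a)"
    unfolding neumann_commute[of _ a] using Y(2)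
    by (intro continuous_on_compose2[OF continuous_on_neumann[OF a]] continuous_intros) auto
  ultimately show "continuous_on ?S (\<lambda>w. reg_kernel (fst w) (snd w) a - neumann (snd w) a)"
    unfolding reg_kernel_def by (intro continuous_intros) simp_all
qed (auto simp: reg_kernel_def neumann_def)

text \<open>The flux of the kernel is at most \<open>n - 2\<close>. Subtracting a Neumann function
  with pole off \<open>C\<close> makes it nonpositive without changing the Laplacian.\<close>

lemma supersol_reg_kernel:
  fixes b y :: "'a::euclidean_space"
  assumes n: "DIM('a) \<ge> 3" and C: "C \<subseteq> cball 0 1" and b: "b \<notin> C" "norm b < 1"
    and y: "norm y \<le> 1" and \<theta>: "0 < \<theta>" "\<theta> < 1"
  shows "supersol C K a (\<lambda>x. reg_kernel \<theta> y x + (- 1) * neumann b x)"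
  unfolding supersol_def
proof (intro conjI ballI impI)
  show "continuous_on C (\<lambda>x. reg_kernel \<theta> y x + (- 1) * neumann b x)"
    using C b by (intro continuous_intros continuous_on_subset[OF continuous_on_reg_kernel_fixed[OF \<theta> y]]
        continuous_on_subset[OF continuous_on_neumann[OF b(2)]]) auto
next
  fix x assume x: "x \<in> C - K" "norm x < 1"
  have "has_lap (\<lambda>x. reg_kernel \<theta> y x + (- 1) * neumann b x) x (- (\<theta> * (real DIM('a) * (real DIM('a) - 2) *
           ((norm (x - y))\<^sup>2 + \<theta>) powr (- (real DIM('a) / 2) - 1))) + (- 1) * 0)"
    using x b y \<theta> by (intro has_lap_add has_lap_cmult has_lap_reg_kernel has_lap_neumann) auto
  moreover have "- (\<theta> * (real DIM('a) * (real DIM('a) - 2) *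
           ((norm (x - y))\<^sup>2 + \<theta>) powr (- (real DIM('a) / 2) - 1))) + (- 1) * 0 \<le> 0"
    using n \<theta> by simp
  ultimately show "\<exists>L\<le>0. has_lap (\<lambda>x. reg_kernel \<theta> y x + (- 1) * neumann b x) x L" by blast
next
  fix x assume x: "x \<in> C - K" "norm x = 1"
  have "inward_deriv (\<lambda>x. reg_kernel \<theta> y x + (- 1) * neumann b x) x ((real DIM('a) - 2) * (1 - flux_excess \<theta> y x) + (- 1) * (real DIM('a) - 2))"
    by (intro inward_deriv_add inward_deriv_cmult inward_deriv_reg_kernel inward_deriv_neumann x y \<theta> b)
  moreover have "(real DIM('a) - 2) * (1 - flux_excess \<theta> y x) + (- 1) * (real DIM('a) - 2) \<le> 0"
    using mult_nonneg_nonneg[OF _ flux_excess_nonneg[OF n x(2) y \<theta>], of "real DIM('a) - 2"] n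
    by (simp add: right_diff_distrib)
  ultimately show "\<exists>d\<le>0. inward_deriv (\<lambda>x. reg_kernel \<theta> y x + (- 1) * neumann b x) x d" by blast
qed

text \<open>Away from its pole the regularised kernel is nearly harmonic with nearly the right flux, so that a small
  multiple of a strict supersolution makes its negative a supersolution as well.\<close>

lemma eventually_supersol_minus_reg_kernel:
  fixes b :: "'a::euclidean_space"
  assumes n: "DIM('a) \<ge> 3" and C: "compact C" "C \<subseteq> cball 0 1" and b: "b \<notin> C" "norm b < 1"
    and Y: "compact Y" "Y \<subseteq> cball 0 1" "Y \<inter> C = {}" and \<kappa>: "\<kappa> > 0"
  shows "\<forall>\<^sub>F \<theta> in at_right 0. \<forall>y\<in>Y. supersol C K a
    (\<lambda>x. (- 1) * reg_kernel \<theta> y x + neumann b x + \<kappa> * ((- 1) * neumann b x + (- 1 / 4) * (x \<bullet> x)))"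
proof -
  let ?n = "real DIM('a)"
  define Cs where "Cs = C \<inter> sphere 0 1"
  have Cs: "compact Cs" using C(1) by (auto simp: Cs_def intro: compact_Int_closed)
  \<comment> \<open>The perturbation has Laplacian \<open>- (\<kappa> / 2 * n)\<close>, which is
    exactly the room granted here.\<close>
  have "\<forall>\<^sub>F \<theta> in at_right 0. \<forall>w\<in>Y \<times> C. \<bar>\<theta> * (?n * (?n - 2) *
      ((norm (snd w - fst w))\<^sup>2 + \<theta>) powr (- (?n / 2) - 1))\<bar> \<le> \<kappa> / 2 * ?n"
  proof (rule eventually_uniformly_small[of _ "1 / 2"])
    have "(norm (snd (snd w) - fst (snd w)))\<^sup>2 + fst w > 0" if "w \<in> {0..1 / 2} \<times> (Y \<times> C)" for w
      using that Y(3) by (intro norm_diff_sq_add_pos) auto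
    then show "continuous_on ({0..1 / 2} \<times> (Y \<times> C)) (\<lambda>w. fst w * (?n * (?n - 2) *
      ((norm (snd (snd w) - fst (snd w)))\<^sup>2 + fst w) powr (- (?n / 2) - 1)))"
      by (intro continuous_intros) (auto simp: less_imp_neq[symmetric])
  qed (use \<kappa> C Y in \<open>auto intro: compact_Times\<close>)
  \<comment> \<open>With this bound the excess contributes at most \<open>\<kappa> / 2\<close> to
    the flux and the perturbation \<open>\<kappa> * (5 / 2 - n)\<close>. The sum
    \<open>\<kappa> * (3 - n)\<close> is nonpositive for \<open>n \<ge> 3\<close>.\<close>
  moreover have "\<forall>\<^sub>F \<theta> in at_right 0. \<forall>w\<in>Y \<times> Cs. \<bar>flux_excess \<theta> (fst w) (snd w)\<bar> \<le> \<kappa> / (2 * ?n)"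
  proof (rule eventually_uniformly_small[of _ "1 / 2"])
    have 1: "(norm (snd (snd w) - fst (snd w)))\<^sup>2 + fst w > 0" if "w \<in> {0..1 / 2} \<times> (Y \<times> Cs)" for w
      using that Y(3) by (intro norm_diff_sq_add_pos) (auto simp: Cs_def)
    \<comment> \<open>At parameter 0 the pole is off \<open>C\<close>; for a positive parameter it
      is pulled strictly inside the ball while the point stays on the sphere.\<close>
    have 2: "(norm (snd (snd w) - (1 - fst w / 4) *\<^sub>R fst (snd w)))\<^sup>2 > 0" if w: "w \<in> {0..1 / 2} \<times> (Y \<times> Cs)" for w
    proof (cases "fst w = 0")
      case True
      then show ?thesis using 1[OF w] by simp
    next
      case False
      have "norm ((1 - fst w / 4) *\<^sub>R fst (snd w)) < 1" using w False Y(2) by (intro norm_scaled_less_1) auto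
      moreover have "norm (snd (snd w)) = 1" using w by (auto simp: Cs_def)
      ultimately show ?thesis by (metis eq_iff_diff_eq_0 less_irrefl norm_eq_zero zero_less_power2)
    qed
    show "continuous_on ({0..1 / 2} \<times> (Y \<times> Cs)) (\<lambda>w. flux_excess (fst w) (fst (snd w)) (snd (snd w)))"
      unfolding flux_excess_def
      by (intro continuous_intros ballI less_imp_neq[OF 1, symmetric] less_imp_neq[OF 2, symmetric]) auto
    show "flux_excess 0 (fst w) (snd w) = 0" for w :: "'a \<times> 'a" by (simp add: flux_excess_def)
  qed (use \<kappa> n Cs Y in \<open>auto intro: compact_Times\<close>)
  moreover have "\<forall>\<^sub>F \<theta> in at_right (0::real). \<theta> \<in> {0<..<1}" by (rule eventually_at_rightI[of 0 1]) auto
  ultimately show ?thesis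
  proof eventually_elim
    case (elim \<theta>)
    then have \<theta>: "0 < \<theta>" "\<theta> < 1" by auto
    show ?case
    proof
      fix y assume y: "y \<in> Y"
      then have ny: "norm y \<le> 1" using Y(2) by auto
      let ?h = "\<lambda>x. (- 1) * reg_kernel \<theta> y x + neumann b x + \<kappa> * ((- 1) * neumann b x + (- 1 / 4) * (x \<bullet> x))"
      show "supersol C K a ?h"
        unfolding supersol_def
      proof (intro conjI ballI impI)
        have "continuous_on C (reg_kernel \<theta> y)" "continuous_on C (neumann b)"
          using C(2) b by (auto intro: continuous_on_subset[OF continuous_on_reg_kernel_fixed[OF \<theta> ny]]
            continuous_on_subset[OF continuous_on_neumann[OF b(2)]])
        then show "continuous_on C ?h" by (intro continuous_intros)
      next
        fix x assume x: "x \<in> C - K" "norm x < 1"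
        let ?L = "\<theta> * (?n * (?n - 2) * ((norm (x - y))\<^sup>2 + \<theta>) powr (- (?n / 2) - 1))"
        have "has_lap ?h x ((- 1) * (- ?L) + 0 + \<kappa> * ((- 1) * 0 + (- 1 / 4) * (2 * ?n)))"
          using x b ny \<theta> by (intro has_lap_add has_lap_cmult has_lap_reg_kernel has_lap_neumann has_lap_normsq) auto
        moreover have "(- 1) * (- ?L) + 0 + \<kappa> * ((- 1) * 0 + (- 1 / 4) * (2 * ?n)) \<le> 0"
        proof -
          have yx: "(y, x) \<in> Y \<times> C" using x y by auto
          have "\<bar>?L\<bar> \<le> \<kappa> / 2 * ?n" using bspec[OF elim(1) yx] by (simp only: fst_conv snd_conv)
          then have "?L \<le> \<kappa> / 2 * ?n" by linarith
          moreover have "(- 1) * (- ?L) + 0 + \<kappa> * ((- 1) * 0 + (- 1 / 4) * (2 * ?n)) = ?L - \<kappa> / 2 * ?n"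
            by (simp add: field_simps)
          ultimately show ?thesis by linarith
        qed
        ultimately show "\<exists>L\<le>0. has_lap ?h x L" by blast
      next
        fix x assume x: "x \<in> C - K" "norm x = 1"
        have i: "inward_deriv ?h x ((- 1) * ((?n - 2) * (1 - flux_excess \<theta> y x)) + (?n - 2) + \<kappa> * ((- 1) * (?n - 2) + (- 1 / 4) * (- 2)))"
          by (intro inward_deriv_add inward_deriv_cmult inward_deriv_reg_kernel inward_deriv_neumann inward_deriv_normsq x ny \<theta> b)
        have "flux_excess \<theta> y x \<le> \<kappa> / (2 * ?n)"
          using elim(2)[rule_format, of "(y, x)"] x y by (simp add: abs_le_iff Cs_def)
        then have "(?n - 2) * flux_excess \<theta> y x \<le> (?n - 2) * (\<kappa> / (2 * ?n))" using n by (intro mult_left_mono) auto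
        also have "\<dots> \<le> ?n * (\<kappa> / (2 * ?n))" using n \<kappa> by (intro mult_right_mono) auto
        also have "\<dots> = \<kappa> / 2" using n by simp
        finally have "(?n - 2) * flux_excess \<theta> y x \<le> \<kappa> / 2" .
        moreover have "\<kappa> * ?n \<ge> \<kappa> * 3" using n \<kappa> by (intro mult_left_mono) auto
        ultimately have "(- 1) * ((?n - 2) * (1 - flux_excess \<theta> y x)) + (?n - 2) + \<kappa> * ((- 1) * (?n - 2) + (- 1 / 4) * (- 2)) \<le> 0"
          by (simp add: algebra_simps)
        with i show "\<exists>d\<le>0. inward_deriv ?h x d" by blast
      qed
    qed
  qed
qed

text \<open>At \<open>a\<close> the singularities of the Neumann and Robin functions cancel. The
  fluxes of the two Neumann functions cancel as well, and the Robin function has zero flux because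
  \<open>\<Gamma>\<close> is nonempty.\<close>

lemma supersol_robin:
  fixes a b :: "'a::euclidean_space"
  assumes n: "DIM('a) \<ge> 3" and D: "open D" "D \<subseteq> ball 0 1" and a: "a \<in> D"
    and \<Gamma>: "closed \<Gamma>" "frontier D \<inter> ball 0 1 \<subseteq> \<Gamma>" "\<Gamma> \<noteq> {}"
    and g: "is_robin_function D \<Gamma> a r g" and C: "C \<subseteq> closure D - \<Gamma>" and b: "b \<notin> closure D" "norm b < 1"
  shows "supersol C K a (\<lambda>x. neumann a x + (- 1) * neumann b x + (- 1 / lam DIM('a)) * g x)"
  unfolding supersol_def
proof (intro conjI ballI impI)
  let ?w = "\<lambda>x. neumann a x + (- 1) * neumann b x + (- 1 / lam DIM('a)) * g x"
  have an: "norm a < 1" using a D(2) by auto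
  have cb: "closure D \<subseteq> cball 0 1" by (rule closure_subset_cball[OF D(2)])
  have gc: "continuous_on (closure D - {a}) g" using g by (simp add: is_robin_function_def)
  have nfb: "continuous_on (closure D) (neumann b)"
    using cb b by (intro continuous_on_subset[OF continuous_on_neumann[OF b(2)]]) auto
  have 1: "continuous_on (closure D - {a}) ?w"
    using cb by (intro continuous_intros gc continuous_on_subset[OF nfb] continuous_on_subset[OF continuous_on_neumann[OF an]]) auto
  have "a \<in> interior (closure D)" using a D(1) interior_maximal[OF closure_subset D(1)] by auto
  then have "isCont (neumann b) a" using continuous_on_interior[OF nfb] by blast
  moreover have "isCont (regpart a) a"
    using continuous_on_interior[OF continuous_on_regpart_fixed[OF an], of a] an by simp
  ultimately have "((\<lambda>x. (newton 0 a x - g x / lam DIM('a)) + regpart a x - neumann b x) \<longlongrightarrow>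
      - (g a / lam DIM('a)) + regpart a a - neumann b a) (at a)"
    unfolding isCont_def by (intro tendsto_intros robin_regular_part[OF n g])
  then have 2: "(?w \<longlongrightarrow> ?w a) (at a)" by (simp add: neumann_diag) (simp add: neumann_def algebra_simps)
  have "continuous_on (closure D) ?w" by (rule continuous_on_insert_limit[OF 1 2])
  then show "continuous_on C ?w" using C by (auto intro: continuous_on_subset)
  fix x assume x: "x \<in> C - K"
  then have xD: "x \<in> closure D" and xb: "x \<noteq> b" using C b by auto
  show "\<exists>L\<le>0. has_lap ?w x L" if "x \<noteq> a" "norm x < 1"
  proof -
    have "x \<in> D"
    proof (rule ccontr)
      assume "x \<notin> D"
      then have "x \<in> frontier D - \<Gamma>" using x C D(1) by (auto simp: frontier_def interior_open)
      then show False using \<Gamma>(2) that by auto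
    qed
    then have "has_lap g x 0"
      using g that by (intro harmonic_on_has_lap[where S = "D - {a}"]) (auto simp: is_robin_function_def)
    then have "has_lap ?w x (0 + (- 1) * 0 + (- 1 / lam DIM('a)) * 0)"
      using that xb an b by (intro has_lap_add has_lap_cmult has_lap_neumann) auto
    then show ?thesis by auto
  qed
  show "\<exists>d\<le>0. inward_deriv ?w x d" if nx: "norm x = 1"
  proof -
    have "x \<in> frontier D - \<Gamma>" using x nx C D by (auto simp: frontier_def interior_open)
    from robin_inward_deriv[OF D \<Gamma>(1,2) g this] have "inward_deriv g x 0" using \<Gamma>(3) by simp
    then have "inward_deriv ?w x ((real DIM('a) - 2) + (- 1) * (real DIM('a) - 2) + (- 1 / lam DIM('a)) * 0)"
      by (intro inward_deriv_add inward_deriv_cmult inward_deriv_neumann an b nx)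
    then show ?thesis by auto
  qed
qed

section \<open>The energy inequality\<close>

text \<open>One measure has to serve three purposes: sweeping \<open>w\<close>, bounding the kernels
  with pole on \<open>K\<close> from above by superharmonicity, and bounding the kernels with pole
  in \<open>Y\<close> from below. In the last bound one \<open>\<epsilon>\<close> comes from the
  sweeping and two from the perturbation, at \<open>a\<close> and on average.\<close>

lemma sweep_domain:
  fixes a b :: "'a::euclidean_space"
  assumes n: "DIM('a) \<ge> 3" and cell: "cell C K a" and a: "a \<in> C" and b: "b \<notin> C" "norm b < 1"
    and \<theta>: "0 < \<theta>" "\<theta> < 1" and Y: "compact Y" "Y \<subseteq> cball 0 1"
    and neg: "\<And>y. y \<in> Y \<Longrightarrow> supersol C K a
      (\<lambda>x. (- 1) * reg_kernel \<theta> y x + neumann b x + \<kappa> * ((- 1) * neumann b x + (- 1 / 4) * (x \<bullet> x)))"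
    and w: "supersol C K a w"
    and \<kappa>: "\<And>x. x \<in> C \<Longrightarrow> \<bar>\<kappa> * ((- 1) * neumann b x + (- 1 / 4) * (x \<bullet> x))\<bar> \<le> \<epsilon>" and \<epsilon>: "\<epsilon> > 0"
  shows "\<exists>S p. weights K S p \<and> avg S p w \<le> w a + \<epsilon> \<and>
    (\<forall>y\<in>K. avg S p (reg_kernel \<theta> y) - avg S p (neumann b) \<le> reg_kernel \<theta> y a - neumann b a + \<epsilon>) \<and>
    (\<forall>y\<in>Y. avg S p (neumann b) - avg S p (reg_kernel \<theta> y) \<le> neumann b a - reg_kernel \<theta> y a + 3 * \<epsilon>)"
proof -
  have C: "compact C" "compact K" "C \<subseteq> cball 0 1" "K \<subseteq> C" using cell by (auto simp: cell_def)
  define P where "P x = (- 1) * neumann b x + (- 1 / 4) * (x \<bullet> x)" for x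
  define F where "F x y = reg_kernel \<theta> y x + (- 1) * neumann b x" for x y
  define G where "G x y = (- 1) * reg_kernel \<theta> y x + neumann b x + \<kappa> * P x" for x y
  define H where "H = {w} \<union> (\<lambda>y x. F x y) ` K \<union> (\<lambda>y x. G x y) ` Y"
  have nfc: "continuous_on C (neumann b)" using C b by (intro continuous_on_subset[OF continuous_on_neumann[OF b(2)]]) auto
  have nfc': "continuous_on (C \<times> Z) (\<lambda>w. neumann b (fst w))" for Z :: "'a set"
    by (rule continuous_on_compose2[OF nfc]) (auto intro!: continuous_intros)
  have rkc: "continuous_on (C \<times> Z) (\<lambda>w. reg_kernel \<theta> (snd w) (fst w))" if "Z \<subseteq> cball 0 1" for Z
    by (rule continuous_on_subset[OF continuous_on_reg_kernel[OF \<theta>]]) (use C that in auto)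
  have "continuous_on (C \<times> K) (\<lambda>w. F (fst w) (snd w))"
    unfolding F_def using C by (intro continuous_intros nfc' rkc) auto
  moreover have "continuous_on (C \<times> Y) (\<lambda>w. G (fst w) (snd w))"
    unfolding G_def P_def using Y by (intro continuous_intros nfc' rkc) auto
  ultimately have "tot_bdd C H"
    unfolding H_def using tot_bdd_family[OF C(1,2)] tot_bdd_family[OF C(1) Y(1)]
    by (intro tot_bdd_Un) (auto simp: tot_bdd_finite)
  moreover have "supersol C K a h" if "h \<in> H" for h
  proof -
    consider "h = w" | y where "y \<in> K" "h = (\<lambda>x. F x y)" | y where "y \<in> Y" "h = (\<lambda>x. G x y)"
      using \<open>h \<in> H\<close> unfolding H_def by blast
    then show ?thesis
    proof cases
      case 2
      then have "norm y \<le> 1" using C by auto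
      then show ?thesis unfolding 2(2) F_def by (rule supersol_reg_kernel[OF n C(3) b _ \<theta>])
    next
      case 3
      show ?thesis unfolding 3(2) G_def P_def by (rule neg[OF 3(1)])
    qed (use w in simp)
  qed
  ultimately obtain S p where S: "weights K S p" "\<forall>h\<in>H. avg S p h \<le> h a + \<epsilon>"
    using sweep[OF cell barrier_neumann[OF n cell b] a _ _ \<epsilon>] by blast
  have "avg S p w \<le> w a + \<epsilon>" using S(2) by (simp add: H_def)
  moreover have "avg S p (reg_kernel \<theta> y) - avg S p (neumann b) \<le> reg_kernel \<theta> y a - neumann b a + \<epsilon>" if "y \<in> K" for y
  proof -
    have "(\<lambda>x. F x y) \<in> H" using that by (auto simp: H_def)
    then have "avg S p (\<lambda>x. F x y) \<le> F a y + \<epsilon>" using S(2) by blast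
    then show ?thesis unfolding F_def avg_add avg_cmult by simp
  qed
  moreover have "avg S p (neumann b) - avg S p (reg_kernel \<theta> y) \<le> neumann b a - reg_kernel \<theta> y a + 3 * \<epsilon>" if "y \<in> Y" for y
  proof -
    have "(\<lambda>x. G x y) \<in> H" using that by (auto simp: H_def)
    then have "avg S p (\<lambda>x. G x y) \<le> G a y + \<epsilon>" using S(2) by blast
    then have 1: "- avg S p (reg_kernel \<theta> y) + avg S p (neumann b) + avg S p (\<lambda>x. \<kappa> * P x) \<le> - reg_kernel \<theta> y a + neumann b a + \<kappa> * P a + \<epsilon>"
      unfolding G_def avg_add avg_cmult by simp
    have "\<kappa> * P a \<le> \<epsilon>" using \<kappa>[OF a] unfolding P_def by linarith
    moreover have "avg S p (\<lambda>x. - \<epsilon>) \<le> avg S p (\<lambda>x. \<kappa> * P x)"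
    proof (rule avg_mono[OF S(1)])
      fix x assume "x \<in> K"
      then have "\<bar>\<kappa> * P x\<bar> \<le> \<epsilon>" using \<kappa>[of x] C unfolding P_def by auto
      then show "- \<epsilon> \<le> \<kappa> * P x" by linarith
    qed
    ultimately show ?thesis using 1 unfolding avg_const[OF S(1)] by linarith
  qed
  ultimately show ?thesis using S(1) by blast
qed

text \<open>The energy of the signed measure \<open>p1 - p2\<close>, which has total mass zero,
  expanded bilinearly. The supports may overlap, so both weights are extended by zero to the
  union.\<close>

lemma qform_difference:
  assumes w: "weights K1 S1 p1" "weights K2 S2 p2"
    and psd: "\<And>T c. finite T \<Longrightarrow> T \<subseteq> K1 \<union> K2 \<Longrightarrow> sum c T = 0 \<Longrightarrow> 0 \<le> qform T c R"
  shows "avg S1 p1 (\<lambda>x. avg S2 p2 (R x)) + avg S2 p2 (\<lambda>x. avg S1 p1 (R x)) \<le>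
    avg S1 p1 (\<lambda>x. avg S1 p1 (R x)) + avg S2 p2 (\<lambda>x. avg S2 p2 (R x))"
proof -
  define T where "T = S1 \<union> S2"
  define q where "q S p x = (if x \<in> S then p x else 0)" for S and p :: "'a \<Rightarrow> real" and x :: 'a
  have T: "finite T" "T \<subseteq> K1 \<union> K2" using w by (auto simp: T_def weights_def)
  have 1: "avg S1 p1 f = (\<Sum>x\<in>T. q S1 p1 x * f x)" for f
    unfolding avg_def q_def using T(1) by (intro sum.mono_neutral_cong_left) (auto simp: T_def)
  have 2: "avg S2 p2 f = (\<Sum>x\<in>T. q S2 p2 x * f x)" for f
    unfolding avg_def q_def using T(1) by (intro sum.mono_neutral_cong_left) (auto simp: T_def)
  have "(\<Sum>x\<in>T. q S1 p1 x - q S2 p2 x) = 0"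
    using 1[of "\<lambda>_. 1"] 2[of "\<lambda>_. 1"] avg_const[OF w(1), of 1] avg_const[OF w(2), of 1]
    by (simp add: sum_subtractf)
  from psd[OF T this] show ?thesis
    unfolding qform_def 1 2
    by (simp add: sum_distrib_left left_diff_distrib right_diff_distrib sum_subtractf mult_ac)
qed

text \<open>Positivity of the energy is \<open>q\<close>. The diagonal terms are bounded by
  \<open>e11\<close> and \<open>e22\<close>, the cross terms by \<open>e21\<close> and
  \<open>e12\<close>; the values of \<open>neumann\<close> at the two poles and the averages of
  \<open>neumann a2\<close> over the first and of \<open>neumann a1\<close> over the second measure
  that enter there cancel, and \<open>w1\<close>, \<open>w2\<close> control what is left. Of the
  errors, 1 + 1 + 3 + 3 come from sweeping the kernels, 4 from replacing the kernel by the Neumann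
  function, 2 from the level sets and 2 from sweeping \<open>w1\<close> and
  \<open>w2\<close>.\<close>

lemma energy_estimate:
  fixes a1 a2 :: "'a::euclidean_space"
  assumes n: "DIM('a) \<ge> 3"
    and c1: "cell C1 K1 a1" "a1 \<in> C1" "a2 \<notin> C1" and c2: "cell C2 K2 a2" "a2 \<in> C2" "a1 \<notin> C2"
    and disj: "K2 \<inter> C1 = {}" "K1 \<inter> C2 = {}"
    and w1: "supersol C1 K1 a1 w1" "\<And>x. x \<in> K1 \<Longrightarrow> neumann a1 x - neumann a2 x \<le> w1 x + \<epsilon>"
    and w2: "supersol C2 K2 a2 w2" "\<And>x. x \<in> K2 \<Longrightarrow> neumann a2 x - neumann a1 x \<le> w2 x + \<epsilon>"
    and \<epsilon>: "\<epsilon> > 0"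
  shows "0 \<le> w1 a1 + w2 a2 + 16 * \<epsilon>"
proof -
  have C1: "compact C1" "compact K1" "C1 \<subseteq> cball 0 1" "K1 \<subseteq> C1" "a1 \<notin> K1" "norm a1 < 1"
    and C2: "compact C2" "compact K2" "C2 \<subseteq> cball 0 1" "K2 \<subseteq> C2" "a2 \<notin> K2" "norm a2 < 1"
    using c1 c2 by (auto simp: cell_def)
  \<comment> \<open>The size of the perturbation is fixed by the cell and the outer pole, before
    \<open>\<theta>\<close> is chosen small relative to it.\<close>
  have pert: "\<exists>\<kappa>>0. \<forall>x\<in>C. \<bar>\<kappa> * ((- 1) * neumann b x + (- 1 / 4) * (x \<bullet> x))\<bar> \<le> \<epsilon>"
    if "compact C" "C \<subseteq> cball 0 1" "b \<notin> C" "norm b < 1" for C and b :: 'a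
  proof -
    have "continuous_on C (\<lambda>x. (- 1) * neumann b x + (- 1 / 4) * (x \<bullet> x))"
      using that by (intro continuous_intros continuous_on_subset[OF continuous_on_neumann]) auto
    then have "bounded ((\<lambda>x. (- 1) * neumann b x + (- 1 / 4) * (x \<bullet> x)) ` C)"
      using that(1) by (intro compact_imp_bounded compact_continuous_image)
    then obtain B where B: "B > 0" "\<And>x. x \<in> C \<Longrightarrow> \<bar>(- 1) * neumann b x + (- 1 / 4) * (x \<bullet> x)\<bar> \<le> B"
      unfolding bounded_pos by auto
    have "\<bar>(\<epsilon> / B) * ((- 1) * neumann b x + (- 1 / 4) * (x \<bullet> x))\<bar> \<le> \<epsilon>" if "x \<in> C" for x
    proof -
      have "(\<epsilon> / B) * \<bar>(- 1) * neumann b x + (- 1 / 4) * (x \<bullet> x)\<bar> \<le> (\<epsilon> / B) * B"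
        using B(2)[OF that] B(1) \<epsilon> by (intro mult_left_mono) auto
      then show ?thesis using B(1) \<epsilon> unfolding abs_mult by simp
    qed
    then show ?thesis using B(1) \<epsilon> by (intro exI[of _ "\<epsilon> / B"]) auto
  qed
  obtain \<kappa>1 where \<kappa>1: "\<kappa>1 > 0" "\<And>x. x \<in> C1 \<Longrightarrow> \<bar>\<kappa>1 * ((- 1) * neumann a2 x + (- 1 / 4) * (x \<bullet> x))\<bar> \<le> \<epsilon>"
    using pert[OF C1(1,3) c1(3) C2(6)] by blast
  obtain \<kappa>2 where \<kappa>2: "\<kappa>2 > 0" "\<And>x. x \<in> C2 \<Longrightarrow> \<bar>\<kappa>2 * ((- 1) * neumann a1 x + (- 1 / 4) * (x \<bullet> x))\<bar> \<le> \<epsilon>"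
    using pert[OF C2(1,3) c2(3) C1(6)] by blast
  have K: "compact (K1 \<union> K2)" "K1 \<union> K2 \<subseteq> cball 0 1 - {a1}" "K1 \<union> K2 \<subseteq> cball 0 1 - {a2}"
    "K1 \<subseteq> cball 0 1" "K2 \<subseteq> cball 0 1"
    using C1 C2 c1 c2 by auto
  have "\<forall>\<^sub>F \<theta> in at_right (0::real). \<theta> \<in> {0<..<1}" by (rule eventually_at_rightI[of 0 1]) auto
  moreover note eventually_supersol_minus_reg_kernel[OF n C1(1,3) c1(3) C2(6) C2(2) K(5) disj(1) \<kappa>1(1), where K = "K1" and a = "a1"]
    eventually_supersol_minus_reg_kernel[OF n C2(1,3) c2(3) C1(6) C1(2) K(4) disj(2) \<kappa>2(1), where K = "K2" and a = "a2"]
    eventually_reg_kernel_near_neumann[OF C1(6) K(1,2) \<epsilon>] eventually_reg_kernel_near_neumann[OF C2(6) K(1,3) \<epsilon>]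
  ultimately have "\<forall>\<^sub>F \<theta> in at_right 0. \<theta> \<in> {0<..<1} \<and>
      (\<forall>y\<in>K2. supersol C1 K1 a1 (\<lambda>x. (- 1) * reg_kernel \<theta> y x + neumann a2 x + \<kappa>1 * ((- 1) * neumann a2 x + (- 1 / 4) * (x \<bullet> x)))) \<and>
      (\<forall>y\<in>K1. supersol C2 K2 a2 (\<lambda>x. (- 1) * reg_kernel \<theta> y x + neumann a1 x + \<kappa>2 * ((- 1) * neumann a1 x + (- 1 / 4) * (x \<bullet> x)))) \<and>
      (\<forall>y\<in>K1 \<union> K2. \<bar>reg_kernel \<theta> y a1 - neumann y a1\<bar> \<le> \<epsilon>) \<and> (\<forall>y\<in>K1 \<union> K2. \<bar>reg_kernel \<theta> y a2 - neumann y a2\<bar> \<le> \<epsilon>)"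
    by (intro eventually_conj)
  from eventually_happens'[OF trivial_limit_at_right_real this]
  obtain \<theta> where \<theta>': "\<theta> \<in> {0<..<1}"
    and s1: "\<forall>y\<in>K2. supersol C1 K1 a1 (\<lambda>x. (- 1) * reg_kernel \<theta> y x + neumann a2 x + \<kappa>1 * ((- 1) * neumann a2 x + (- 1 / 4) * (x \<bullet> x)))"
    and s2: "\<forall>y\<in>K1. supersol C2 K2 a2 (\<lambda>x. (- 1) * reg_kernel \<theta> y x + neumann a1 x + \<kappa>2 * ((- 1) * neumann a1 x + (- 1 / 4) * (x \<bullet> x)))"
    and near1: "\<forall>y\<in>K1 \<union> K2. \<bar>reg_kernel \<theta> y a1 - neumann y a1\<bar> \<le> \<epsilon>"
    and near2: "\<forall>y\<in>K1 \<union> K2. \<bar>reg_kernel \<theta> y a2 - neumann y a2\<bar> \<le> \<epsilon>"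
    by (elim exE conjE) (rule that)
  have \<theta>: "0 < \<theta>" "\<theta> < 1" using \<theta>' by simp_all
  have near: "\<bar>reg_kernel \<theta> y a1 - neumann a1 y\<bar> \<le> \<epsilon>" "\<bar>reg_kernel \<theta> y a2 - neumann a2 y\<bar> \<le> \<epsilon>" if "y \<in> K1 \<union> K2" for y
    using bspec[OF near1 that] bspec[OF near2 that] neumann_commute[of y] by simp_all
  obtain S1 p1 where S1: "weights K1 S1 p1" "avg S1 p1 w1 \<le> w1 a1 + \<epsilon>"
    "\<And>y. y \<in> K1 \<Longrightarrow> avg S1 p1 (reg_kernel \<theta> y) - avg S1 p1 (neumann a2) \<le> reg_kernel \<theta> y a1 - neumann a2 a1 + \<epsilon>"
    "\<And>y. y \<in> K2 \<Longrightarrow> avg S1 p1 (neumann a2) - avg S1 p1 (reg_kernel \<theta> y) \<le> neumann a2 a1 - reg_kernel \<theta> y a1 + 3 * \<epsilon>"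
    using sweep_domain[OF n c1 C2(6) \<theta> C2(2) K(5) bspec[OF s1] w1(1) \<kappa>1(2) \<epsilon>] by blast
  obtain S2 p2 where S2: "weights K2 S2 p2" "avg S2 p2 w2 \<le> w2 a2 + \<epsilon>"
    "\<And>y. y \<in> K2 \<Longrightarrow> avg S2 p2 (reg_kernel \<theta> y) - avg S2 p2 (neumann a1) \<le> reg_kernel \<theta> y a2 - neumann a1 a2 + \<epsilon>"
    "\<And>y. y \<in> K1 \<Longrightarrow> avg S2 p2 (neumann a1) - avg S2 p2 (reg_kernel \<theta> y) \<le> neumann a1 a2 - reg_kernel \<theta> y a2 + 3 * \<epsilon>"
    using sweep_domain[OF n c2 C1(6) \<theta> C1(2) K(4) bspec[OF s2] w2(1) \<kappa>2(2) \<epsilon>] by blast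
  note const = avg_const[OF S1(1)] avg_const[OF S2(1)]
  have N: "neumann a2 a1 = neumann a1 a2" by (rule neumann_commute)
  have e11: "avg S1 p1 (\<lambda>y. avg S1 p1 (reg_kernel \<theta> y) - avg S1 p1 (neumann a2)) \<le> avg S1 p1 (\<lambda>y. reg_kernel \<theta> y a1 - neumann a2 a1 + \<epsilon>)"
    by (rule avg_mono[OF S1(1) S1(3)])
  have e22: "avg S2 p2 (\<lambda>y. avg S2 p2 (reg_kernel \<theta> y) - avg S2 p2 (neumann a1)) \<le> avg S2 p2 (\<lambda>y. reg_kernel \<theta> y a2 - neumann a1 a2 + \<epsilon>)"
    by (rule avg_mono[OF S2(1) S2(3)])
  have e21: "avg S2 p2 (\<lambda>y. avg S1 p1 (neumann a2) - avg S1 p1 (reg_kernel \<theta> y)) \<le> avg S2 p2 (\<lambda>y. neumann a2 a1 - reg_kernel \<theta> y a1 + 3 * \<epsilon>)"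
    by (rule avg_mono[OF S2(1) S1(4)])
  have e12: "avg S1 p1 (\<lambda>y. avg S2 p2 (neumann a1) - avg S2 p2 (reg_kernel \<theta> y)) \<le> avg S1 p1 (\<lambda>y. neumann a1 a2 - reg_kernel \<theta> y a2 + 3 * \<epsilon>)"
    by (rule avg_mono[OF S1(1) S2(4)])
  have q: "avg S1 p1 (\<lambda>x. avg S2 p2 (reg_kernel \<theta> x)) + avg S2 p2 (\<lambda>x. avg S1 p1 (reg_kernel \<theta> x)) \<le>
      avg S1 p1 (\<lambda>x. avg S1 p1 (reg_kernel \<theta> x)) + avg S2 p2 (\<lambda>x. avg S2 p2 (reg_kernel \<theta> x))"
  proof (rule qform_difference[OF S1(1) S2(1)])
    fix T and c :: "'a \<Rightarrow> real" assume T: "finite T" "T \<subseteq> K1 \<union> K2" "sum c T = 0"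
    have "T \<subseteq> cball 0 1" using T(2) K(4,5) by blast
    from qform_reg_kernel_nonneg[OF n T(1) this \<theta> T(3)] show "0 \<le> qform T c (reg_kernel \<theta>)"
      by (simp add: reg_kernel_commute[of \<theta> _ x for x] cong: qform_cong)
  qed
  have r11: "avg S1 p1 (\<lambda>y. reg_kernel \<theta> y a1) \<le> avg S1 p1 (\<lambda>y. neumann a1 y + \<epsilon>)"
    using near(1) by (intro avg_mono[OF S1(1)]) (simp add: abs_le_iff diff_le_eq add.commute)
  have r12: "avg S1 p1 (\<lambda>y. neumann a2 y - \<epsilon>) \<le> avg S1 p1 (\<lambda>y. reg_kernel \<theta> y a2)"
    using near(2) by (intro avg_mono[OF S1(1)]) (simp add: abs_le_iff diff_le_eq add.commute)
  have r22: "avg S2 p2 (\<lambda>y. reg_kernel \<theta> y a2) \<le> avg S2 p2 (\<lambda>y. neumann a2 y + \<epsilon>)"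
    using near(2) by (intro avg_mono[OF S2(1)]) (simp add: abs_le_iff diff_le_eq add.commute)
  have r21: "avg S2 p2 (\<lambda>y. neumann a1 y - \<epsilon>) \<le> avg S2 p2 (\<lambda>y. reg_kernel \<theta> y a1)"
    using near(1) by (intro avg_mono[OF S2(1)]) (simp add: abs_le_iff diff_le_eq add.commute)
  have v1: "avg S1 p1 (\<lambda>x. neumann a1 x - neumann a2 x) \<le> avg S1 p1 (\<lambda>x. w1 x + \<epsilon>)"
    by (rule avg_mono[OF S1(1) w1(2)])
  have v2: "avg S2 p2 (\<lambda>x. neumann a2 x - neumann a1 x) \<le> avg S2 p2 (\<lambda>x. w2 x + \<epsilon>)"
    by (rule avg_mono[OF S2(1) w2(2)])
  show ?thesis
    using e11 e22 e21 e12 q r11 r12 r22 r21 v1 v2 S1(2) S2(2)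
    unfolding avg_add avg_diff const N by linarith
qed

theorem corollary2p7:
  fixes D\<^sub>1 D\<^sub>2 \<Gamma>\<^sub>1 \<Gamma>\<^sub>2 :: "'a::euclidean_space set"
    and a\<^sub>1 a\<^sub>2 :: 'a
  assumes "DIM('a) \<ge> 3"
    and "open D\<^sub>1" "connected D\<^sub>1" "D\<^sub>1 \<subseteq> ball 0 1"
    and "open D\<^sub>2" "connected D\<^sub>2" "D\<^sub>2 \<subseteq> ball 0 1"
    and "D\<^sub>1 \<inter> D\<^sub>2 = {}"
    and "a\<^sub>1 \<in> D\<^sub>1" "a\<^sub>2 \<in> D\<^sub>2"
    and "closed \<Gamma>\<^sub>1" "frontier D\<^sub>1 \<inter> ball 0 1 \<subseteq> \<Gamma>\<^sub>1" "\<Gamma>\<^sub>1 \<subseteq> frontier D\<^sub>1" "admissible D\<^sub>1 \<Gamma>\<^sub>1"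
    and "closed \<Gamma>\<^sub>2" "frontier D\<^sub>2 \<inter> ball 0 1 \<subseteq> \<Gamma>\<^sub>2" "\<Gamma>\<^sub>2 \<subseteq> frontier D\<^sub>2" "admissible D\<^sub>2 \<Gamma>\<^sub>2"
  shows "- lam DIM('a) * robin_radius D\<^sub>1 a\<^sub>1 \<Gamma>\<^sub>1 spowr (2 - real DIM('a))
         - lam DIM('a) * robin_radius D\<^sub>2 a\<^sub>2 \<Gamma>\<^sub>2 spowr (2 - real DIM('a))
         \<le> reduced_modulus (ball 0 1) {} [a\<^sub>1, a\<^sub>2] [1, - 1]"
proof -
  note n = assms(1)
  note D1 = assms(2,4) and D2 = assms(5,7) and disj = assms(8) and a1 = assms(9) and a2 = assms(10)
  note G1 = assms(11-13) and G2 = assms(15-17)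
  define l where "l = lam DIM('a)"
  have l: "l > 0" unfolding l_def by (rule lam_pos[OF n])
  obtain r1 g1 where g1: "is_robin_function D\<^sub>1 \<Gamma>\<^sub>1 a\<^sub>1 r1 g1"
    using assms(14) a1 unfolding admissible_def by blast
  obtain r2 g2 where g2: "is_robin_function D\<^sub>2 \<Gamma>\<^sub>2 a\<^sub>2 r2 g2"
    using assms(18) a2 unfolding admissible_def by blast
  have na: "norm a\<^sub>1 < 1" "norm a\<^sub>2 < 1" using a1 a2 D1 D2 by auto
  have disj': "D\<^sub>2 \<inter> D\<^sub>1 = {}" using disj by auto
  \<comment> \<open>The pole in the other domain serves as the outer point that the barrier
    requires.\<close>
  have b2: "a\<^sub>2 \<notin> closure D\<^sub>1" using open_Int_closure_eq_empty[OF D2(1), of D\<^sub>1] disj' a2 by blast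
  have b1: "a\<^sub>1 \<notin> closure D\<^sub>2" using open_Int_closure_eq_empty[OF D1(1), of D\<^sub>2] disj a1 by blast
  \<comment> \<open>The ball is connected and contains the other pole, so the frontier meets it.
    Hence both \<open>\<Gamma>\<^sub>k\<close> are nonempty, and the Robin functions have flux zero
    instead of the constant prescribed for the empty set.\<close>
  have ne: "frontier D \<inter> ball 0 1 \<noteq> {}" if "a \<in> D" "b \<in> ball 0 1" "b \<notin> D" "a \<in> ball 0 1" for D :: "'a set" and a b
  proof -
    have "ball 0 1 \<inter> D \<noteq> {}" "ball 0 1 - D \<noteq> {}" using that by blast+
    then show ?thesis
      using connected_Int_frontier[OF convex_connected[OF convex_ball], of 0 1 D] by blast
  qed
  have Gne: "\<Gamma>\<^sub>1 \<noteq> {}" "\<Gamma>\<^sub>2 \<noteq> {}"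
    using ne[of a\<^sub>1 D\<^sub>1 a\<^sub>2] ne[of a\<^sub>2 D\<^sub>2 a\<^sub>1] a1 a2 na disj G1(2) G2(2) by auto
  define w1 where "w1 x = neumann a\<^sub>1 x + (- 1) * neumann a\<^sub>2 x + (- 1 / l) * g1 x" for x
  define w2 where "w2 x = neumann a\<^sub>2 x + (- 1) * neumann a\<^sub>1 x + (- 1 / l) * g2 x" for x
  have est: "0 \<le> w1 a\<^sub>1 + w2 a\<^sub>2 + 16 * \<epsilon>" if \<epsilon>: "\<epsilon> > 0" for \<epsilon>
  proof -
    \<comment> \<open>At this level the Robin function divided by \<open>l\<close> equals
      \<open>\<epsilon>\<close>, the error allowed on the level sets.\<close>
    define \<delta> where "\<delta> = l * \<epsilon>"
    have \<delta>: "\<delta> > 0" using l \<epsilon> by (simp add: \<delta>_def)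
    define C1 where "C1 = {x \<in> closure D\<^sub>1. x = a\<^sub>1 \<or> \<delta> \<le> g1 x}"
    define K1 where "K1 = {x \<in> closure D\<^sub>1. x \<noteq> a\<^sub>1 \<and> g1 x = \<delta>}"
    define C2 where "C2 = {x \<in> closure D\<^sub>2. x = a\<^sub>2 \<or> \<delta> \<le> g2 x}"
    define K2 where "K2 = {x \<in> closure D\<^sub>2. x \<noteq> a\<^sub>2 \<and> g2 x = \<delta>}"
    note cell1 = robin_cell[OF n D1 a1 G1 g1 \<delta> C1_def K1_def]
    note cell2 = robin_cell[OF n D2 a2 G2 g2 \<delta> C2_def K2_def]
    show ?thesis
    proof (rule energy_estimate[OF n cell1(1) _ _ cell2(1)])
      show "a\<^sub>1 \<in> C1" "a\<^sub>2 \<in> C2" using a1 a2 closure_subset by (auto simp: C1_def C2_def)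
      show "a\<^sub>2 \<notin> C1" "a\<^sub>1 \<notin> C2" using b1 b2 by (auto simp: C1_def C2_def)
      show "K2 \<inter> C1 = {}" using closure_off_Gamma_disjoint[OF D1 G1(1,2) D2(2) disj] cell1(2) by (auto simp: K2_def)
      show "K1 \<inter> C2 = {}" using closure_off_Gamma_disjoint[OF D2 G2(1,2) D1(2) disj'] cell2(2) by (auto simp: K1_def)
      show "supersol C1 K1 a\<^sub>1 w1"
        unfolding w1_def[abs_def] l_def by (rule supersol_robin[OF n D1 a1 G1(1,2) Gne(1) g1 cell1(2) b2 na(2)])
      show "supersol C2 K2 a\<^sub>2 w2"
        unfolding w2_def[abs_def] l_def by (rule supersol_robin[OF n D2 a2 G2(1,2) Gne(2) g2 cell2(2) b1 na(1)])
      show "neumann a\<^sub>1 x - neumann a\<^sub>2 x \<le> w1 x + \<epsilon>" if "x \<in> K1" for x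
        using that l by (simp add: K1_def w1_def \<delta>_def)
      show "neumann a\<^sub>2 x - neumann a\<^sub>1 x \<le> w2 x + \<epsilon>" if "x \<in> K2" for x
        using that l by (simp add: K2_def w2_def \<delta>_def)
    qed (rule \<epsilon>)
  qed
  have "0 \<le> w1 a\<^sub>1 + w2 a\<^sub>2"
  proof (rule field_le_epsilon)
    fix e :: real assume "e > 0"
    then show "0 \<le> w1 a\<^sub>1 + w2 a\<^sub>2 + e" using est[of "e / 16"] by simp
  qed
  also have "w1 a\<^sub>1 + w2 a\<^sub>2 = regpart a\<^sub>1 a\<^sub>1 + regpart a\<^sub>2 a\<^sub>2 - 2 * neumann a\<^sub>1 a\<^sub>2 - (g1 a\<^sub>1 + g2 a\<^sub>2) / l"
    by (simp add: w1_def w2_def neumann_diag neumann_commute[of a\<^sub>2 a\<^sub>1] add_divide_distrib)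
  finally have "(g1 a\<^sub>1 + g2 a\<^sub>2) / l \<le> regpart a\<^sub>1 a\<^sub>1 + regpart a\<^sub>2 a\<^sub>2 - 2 * neumann a\<^sub>1 a\<^sub>2" by simp
  then have "g1 a\<^sub>1 + g2 a\<^sub>2 \<le> l * (regpart a\<^sub>1 a\<^sub>1 + regpart a\<^sub>2 a\<^sub>2 - 2 * neumann a\<^sub>1 a\<^sub>2)"
    using l by (simp add: pos_divide_le_eq mult.commute)
  then show ?thesis
    using robin_radius_value[OF n D1 a1 G1 b2 na(2) g1] robin_radius_value[OF n D2 a2 G2 b1 na(1) g2]
    unfolding reduced_modulus_ball[OF n na] l_def by linarith
qed

end
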